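(* Let $m>1$ be an integer, let $\mathbb F$ be an algebraically closed field of characteristic $p>2$, and let $\lambda=(\lambda_1,\dots,\lambda_{2m+1})\in\mathbb F^{2m+1}$. With $A_m$, $\widetilde\phi$ and $\overline e^i_j$ as in the context, put $A_m^{[p]}=\{(\phi,\widetilde\phi)\mid\phi\in A_m\}$. (1) If $\lambda=0$, then a basis of $H^2_*(\mathfrak h_m^\lambda,\mathfrak h_m^\lambda)$ consists of the cohomology classes of $$A_m^{[p]}\cup\{(0,\overline e^i_{2m+1})\mid 1\le i\le 2m+1\}.$$ (2) If $\lambda_i\neq0$ for some $1\le i\le 2m+1$, then (for such an $i$) a basis of $H^2_*(\mathfrak h_m^\lambda,\mathfrak h_m^\lambda)$ consists of the cohomology classes of $$A_m^{[p]}\cup\{(0,\overline e^j_{2m+1})\mid 1\le j\le 2m+1,\ j\neq i\}.$$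
   Context: **Heisenberg algebra.** $\mathfrak h_m$ is the Lie algebra over $\mathbb F$ with basis $e_1,\dots,e_{2m+1}$ whose only non-vanishing brackets of basis vectors are $[e_i,e_{m+i}]=e_{2m+1}$ for $1\le i\le m$ (and those forced by antisymmetry). $\mathfrak h_m^\lambda$ is $\mathfrak h_m$ with the $[p]$-map determined by $e_i^{[p]}=\lambda_ie_{2m+1}$; for $p>2$, $g=\sum a_ie_i$, $g^{[p]}=\big(\sum_{i=1}^{2m+1}a_i^p\lambda_i\big)e_{2m+1}$. Put $i'=i+m$ for $1\le i\le m$, $i'=i-m$ for $m+1\le i\le 2m$, and $(2m+1)'=2m+1$. **Ordinary cochains.** $C^q=\mathrm{Hom}(\wedge^q\mathfrak h_m,\mathfrak h_m)$ with Chevalley–Eilenberg differentials: $d^1(\psi)(g\wedge h)=[g,\psi(h)]-[h,\psi(g)]-\psi([g,h])$; $d^2(\phi)(g\wedge h\wedge k)=[g,\phi(h\wedge k)]-[h,\phi(g\wedge k)]+[k,\phi(g\wedge h)]-\phi([g,h]\wedge k)+\phi([g,k]\wedge h)-\phi([h,k]\wedge g)$. **Restricted cochains and cohomology.** Iterated brackets are left-normed: $[g_1,\dots,g_j]=[[\dots[[g_1,g_2],g_3],\dots],g_j]$, with $[g_1]=g_1$. For $\phi\in C^2$, a map $\omega:\mathfrak h_m\to\mathfrak h_m$ is $\phi$-compatible if $\omega(ag)=a^p\omega(g)$ and $$\omega(g+h)=\omega(g)+\omega(h)+\sum_{\substack{g_i=g\text{ or }h\\ g_1=g,\,g_2=h}}\frac1{\#(g)}\Big(\phi([g_1,\dots,g_{p-1}]\wedge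 g_p)-[g_p,\phi([g_1,\dots,g_{p-2}]\wedge g_{p-1})]\Big)$$ for all $a\in\mathbb F$, $g,h\in\mathfrak h_m$, where the sum is over sequences $(g_1,\dots,g_p)$ of symbols and $\#(g)$ is the number of $g_i$ equal to $g$. Put $C^1_*=C^1$, $C^2_*=\{(\phi,\omega):\phi\in C^2,\ \omega\ \phi\text{-compatible}\}$. For $\psi\in C^1$: $\mathrm{ind}^1(\psi)(g)=\psi(g^{[p]})-(\mathrm{ad}\,g)^{p-1}(\psi(g))$ and $d^1_*(\psi)=(d^1\psi,\mathrm{ind}^1(\psi))$. For $(\phi,\omega)\in C^2_*$: $$\mathrm{ind}^2(\phi,\omega)(g,h)=\phi(g\wedge h^{[p]})+[g,\omega(h)]+\phi(h\wedge(\mathrm{ad}\,h)^{p-1}(g))+[h,\phi(h\wedge(\mathrm{ad}\,h)^{p-2}(g))]$$ and $d^2_*(\phi,\omega)=(d^2\phi,\mathrm{ind}^2(\phi,\omega))$. Then $H^2_*(\mathfrak h_m^\lambda,\mathfrak h_m^\lambda)=\ker d^2_*/\mathrm{im}\,d^1_*$. **Notation.** $\widetilde\phi$ is the unique $\phi$-compatible map with $\widetilde\phi(e_i)=0$ for all $i$. $\overline e^i_j\big(\sum_k a_ke_k\big)=a_i^pe_j$. $e^{i,j}_k=e^{ij}_k$ is the alternating bilinear map sending $(e_i,e_j)$ to $e_k$ and vanishing on pairs of basis vectors $(e_r,e_s)$ with $\{r,s\}\ne\{i,j\}$ (so $e^{j,i}_k=-e^{i,j}_k$). **The set $A_m$**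 of 2-cocycles (whose classes form a basis of the ordinary cohomology $H^2(\mathfrak h_m,\mathfrak h_m)$) is the union of - $\{e^{ij}_{i'},\,e^{ij}_{j'}\mid 1\le i<j\le 2m\}$; - $\{e^{i,j'}_{j'}+e^{j,j'}_{i'},\ e^{ij}_j+e^{j,j'}_{i'}\mid 1\le i\ne j\le m\text{ or }m+1\le i\neq j\le 2m\}$; - $\{e^{kj}_{i'}+e^{ij}_{k'},\ e^{ki}_{j'}-e^{ij}_{k'}\mid 1\le k<i<j\le m\text{ or }m+1\le i<j<k\le 2m\}$; - $\{e^{i,k'}_{j'}-e^{ij}_k,\ e^{j,k'}_{i'}+e^{ij}_k\mid k\ne i,j,\text{ and either }1\le i<j\le m,\ 1\le k\le m,\text{ or }m+1\le i<j\le 2m,\ m+1\le k\le 2m\}$.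
   Formalization: The differential is taken as d^1_*(ψ) = (-d^1ψ, ind^1(ψ)) instead of (d^1ψ, ind^1(ψ)), because with the printed sign ind^2(d^1ψ, ind^1ψ)(g,h) = 2[g,ψ(h^[p])] is not zero for λ≠0, so im d^1_* is not inside ker d^2_*; for λ=0 nothing changes. *)

theory Defs
  imports "HOL-Library.Function_Algebras" "HOL-Library.Product_Plus"
    "HOL-Algebra.AbelCoset" "Jordan_Normal_Form.VS_Connect"
begin

section \<open>The Heisenberg algebra\<close>

text \<open>
  The algebra \<open>\<hh>\<^sub>m\<close> with basis \<open>e\<^sub>1, \<dots>, e\<^bsub>2m+1\<^esub>\<close> is realised as the set of coordinate functions
  supported on \<open>{1..2m+1}\<close>. Addition, negation and zero of vectors, cochains and pairs of
  cochains are the pointwise ones of \<^theory>\<open>HOL-Library.Function_Algebras\<close> and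
  \<^theory>\<open>HOL-Library.Product_Plus\<close>.
\<close>

type_synonym 'a hvec = "nat \<Rightarrow> 'a"
type_synonym 'a cochain1 = "'a hvec \<Rightarrow> 'a hvec"
type_synonym 'a cochain2 = "'a hvec \<Rightarrow> 'a hvec \<Rightarrow> 'a hvec"
type_synonym 'a cochain3 = "'a hvec \<Rightarrow> 'a hvec \<Rightarrow> 'a hvec \<Rightarrow> 'a hvec"

definition heis :: "nat \<Rightarrow> ('a::field) hvec set" where
  "heis m = {g. \<forall>i. i \<notin> {1..2*m+1} \<longrightarrow> g i = 0}"

definition scal :: "'a::field \<Rightarrow> 'a hvec \<Rightarrow> 'a hvec" (infixr \<open>*\<^sub>h\<close> 75) where
  "a *\<^sub>h g = (\<lambda>i. a * g i)"

definition bas :: "nat \<Rightarrow> ('a::field) hvec" where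
  "bas i = (\<lambda>k. if k = i then 1 else 0)"

text \<open>Bilinear extension of \<open>[e\<^sub>i, e\<^bsub>m+i\<^esub>] = e\<^bsub>2m+1\<^esub> = - [e\<^bsub>m+i\<^esub>, e\<^sub>i]\<close> for \<open>1 \<le> i \<le> m\<close>.\<close>

definition hbr :: "nat \<Rightarrow> 'a::field hvec \<Rightarrow> 'a hvec \<Rightarrow> 'a hvec" where
  "hbr m g h = (\<Sum>i=1..m. g i * h (m+i) - g (m+i) * h i) *\<^sub>h bas (2*m+1)"

text \<open>Left-normed brackets of a nonempty list of elements.\<close>

definition lnbr :: "nat \<Rightarrow> 'a::field hvec list \<Rightarrow> 'a hvec" where
  "lnbr m gs = foldl (hbr m) (hd gs) (tl gs)"

text \<open>The closed formula below for the \<open>[p]\<close>-map is the one valid for \<open>p > 2\<close>.\<close>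

definition pmap :: "nat \<Rightarrow> nat \<Rightarrow> (nat \<Rightarrow> 'a) \<Rightarrow> 'a::field hvec \<Rightarrow> 'a hvec" where
  "pmap m p lam g = (\<Sum>i=1..2*m+1. g i ^ p * lam i) *\<^sub>h bas (2*m+1)"

definition prm :: "nat \<Rightarrow> nat \<Rightarrow> nat" where
  "prm m i = (if i \<le> m then i + m else if i \<le> 2*m then i - m else i)"


section \<open>Ordinary cochains\<close>

text \<open>
  Maps defined on \<open>\<hh>\<^sub>m\<close> are extended by zero outside the carrier, so that equality of cochains
  is equality of functions.
\<close>

definition ext1 :: "nat \<Rightarrow> ('a::field) cochain1 \<Rightarrow> 'a cochain1" where
  "ext1 m f = (\<lambda>g. if g \<in> heis m then f g else 0)"

definition ext2 :: "nat \<Rightarrow> ('a::field) cochain2 \<Rightarrow> 'a cochain2" where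
  "ext2 m f = (\<lambda>g h. if g \<in> heis m \<and> h \<in> heis m then f g h else 0)"

definition ext3 :: "nat \<Rightarrow> ('a::field) cochain3 \<Rightarrow> 'a cochain3" where
  "ext3 m f = (\<lambda>g h k. if g \<in> heis m \<and> h \<in> heis m \<and> k \<in> heis m then f g h k else 0)"

definition linear_heis :: "nat \<Rightarrow> ('a::field) cochain1 \<Rightarrow> bool" where
  "linear_heis m f \<longleftrightarrow> f \<in> heis m \<rightarrow> heis m \<and>
     (\<forall>g\<in>heis m. \<forall>h\<in>heis m. f (g + h) = f g + f h) \<and>
     (\<forall>a. \<forall>g\<in>heis m. f (a *\<^sub>h g) = a *\<^sub>h f g)"

definition C1 :: "nat \<Rightarrow> ('a::field) cochain1 set" where
  "C1 m = {\<psi>. ext1 m \<psi> = \<psi> \<and> linear_heis m \<psi>}"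

text \<open>\<open>Hom(\<Lambda>\<^sup>2 \<hh>\<^sub>m, \<hh>\<^sub>m)\<close> as the space of alternating bilinear maps.\<close>

definition C2 :: "nat \<Rightarrow> ('a::field) cochain2 set" where
  "C2 m = {\<phi>. ext2 m \<phi> = \<phi> \<and> (\<forall>g\<in>heis m. linear_heis m (\<phi> g)) \<and>
     (\<forall>h\<in>heis m. linear_heis m (\<lambda>g. \<phi> g h)) \<and> (\<forall>g\<in>heis m. \<phi> g g = 0)}"

definition d1 :: "nat \<Rightarrow> ('a::field) cochain1 \<Rightarrow> 'a cochain2" where
  "d1 m \<psi> = ext2 m (\<lambda>g h. hbr m g (\<psi> h) - hbr m h (\<psi> g) - \<psi> (hbr m g h))"

definition d2 :: "nat \<Rightarrow> ('a::field) cochain2 \<Rightarrow> 'a cochain3" where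
  "d2 m \<phi> = ext3 m (\<lambda>g h k. hbr m g (\<phi> h k) - hbr m h (\<phi> g k) + hbr m k (\<phi> g h)
     - \<phi> (hbr m g h) k + \<phi> (hbr m g k) h - \<phi> (hbr m h k) g)"


section \<open>Restricted cochains and cohomology\<close>

text \<open>
  A sequence of symbols \<open>g\<close>, \<open>h\<close> is encoded as a list of Booleans (\<open>True\<close> for \<open>g\<close>), so that
  symbols are counted correctly also when the vectors \<open>g\<close> and \<open>h\<close> coincide.
\<close>

definition symseqs :: "nat \<Rightarrow> bool list set" where
  "symseqs p = {s. length s = p \<and> s ! 0 = True \<and> s ! 1 = False}"

definition compat_sum :: "nat \<Rightarrow> nat \<Rightarrow> ('a::field) cochain2 \<Rightarrow> 'a hvec \<Rightarrow> 'a hvec \<Rightarrow> 'a hvec" where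
  "compat_sum m p \<phi> g h = (\<Sum>s\<in>symseqs p. let gs = map (\<lambda>b. if b then g else h) s in
     (1 / of_nat (count_list s True)) *\<^sub>h
       (\<phi> (lnbr m (take (p - 1) gs)) (gs ! (p - 1))
        - hbr m (gs ! (p - 1)) (\<phi> (lnbr m (take (p - 2) gs)) (gs ! (p - 2)))))"

definition compat :: "nat \<Rightarrow> nat \<Rightarrow> ('a::field) cochain2 \<Rightarrow> 'a cochain1 \<Rightarrow> bool" where
  "compat m p \<phi> \<omega> \<longleftrightarrow> ext1 m \<omega> = \<omega> \<and> \<omega> \<in> heis m \<rightarrow> heis m \<and>
     (\<forall>a. \<forall>g\<in>heis m. \<omega> (a *\<^sub>h g) = a ^ p *\<^sub>h \<omega> g) \<and>
     (\<forall>g\<in>heis m. \<forall>h\<in>heis m. \<omega> (g + h) = \<omega> g + \<omega> h + compat_sum m p \<phi> g h)"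

definition C2_star :: "nat \<Rightarrow> nat \<Rightarrow> (('a::field) cochain2 \<times> 'a cochain1) set" where
  "C2_star m p = {(\<phi>, \<omega>). \<phi> \<in> C2 m \<and> compat m p \<phi> \<omega>}"

definition ind1 :: "nat \<Rightarrow> nat \<Rightarrow> (nat \<Rightarrow> 'a) \<Rightarrow> ('a::field) cochain1 \<Rightarrow> 'a cochain1" where
  "ind1 m p lam \<psi> = ext1 m (\<lambda>g. \<psi> (pmap m p lam g) - (hbr m g ^^ (p - 1)) (\<psi> g))"

text \<open>
  On the first component the Chevalley--Eilenberg differential enters with the opposite sign.
  The compatibility condition and the maps \<open>ind1\<close>, \<open>ind2\<close> follow the convention of Evans and
  Fuchs, whose differential in degree one is \<open>\<psi> \<mapsto> \<psi>([g,h]) - [g,\<psi>(h)] + [h,\<psi>(g)]\<close>, that is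
  \<open>- d1\<close>. With \<open>+ d1\<close> the composite is not zero in general: its second component
  is \<open>2[g, \<psi>(h\<^sup>[\<^sup>p\<^sup>])]\<close>. See \<open>d2_star_d1_star\<close> and \<open>ind2_unsigned\<close> below. For a vanishing \<open>[p]\<close>-map on \<open>\<hh>\<^sub>m\<close> and
  \<open>p > 2\<close>, the map \<open>ind1\<close> is zero and the sign does not affect the image.
\<close>

definition d1_star ::
    "nat \<Rightarrow> nat \<Rightarrow> (nat \<Rightarrow> 'a) \<Rightarrow> ('a::field) cochain1 \<Rightarrow> 'a cochain2 \<times> 'a cochain1" where
  "d1_star m p lam \<psi> = (- d1 m \<psi>, ind1 m p lam \<psi>)"

definition ind2 ::
    "nat \<Rightarrow> nat \<Rightarrow> (nat \<Rightarrow> 'a) \<Rightarrow> ('a::field) cochain2 \<times> 'a cochain1 \<Rightarrow> 'a cochain2" where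
  "ind2 m p lam = (\<lambda>(\<phi>, \<omega>). ext2 m (\<lambda>g h. \<phi> g (pmap m p lam h) + hbr m g (\<omega> h)
     + \<phi> h ((hbr m h ^^ (p - 1)) g) + hbr m h (\<phi> h ((hbr m h ^^ (p - 2)) g))))"

definition d2_star ::
    "nat \<Rightarrow> nat \<Rightarrow> (nat \<Rightarrow> 'a) \<Rightarrow> ('a::field) cochain2 \<times> 'a cochain1 \<Rightarrow> 'a cochain3 \<times> 'a cochain2" where
  "d2_star m p lam x = (d2 m (fst x), ind2 m p lam x)"

definition cscal ::
    "'a::field \<Rightarrow> 'a cochain2 \<times> 'a cochain1 \<Rightarrow> 'a cochain2 \<times> 'a cochain1" where
  "cscal a = (\<lambda>(\<phi>, \<omega>). (\<lambda>g h. a *\<^sub>h \<phi> g h, \<lambda>g. a *\<^sub>h \<omega> g))"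

text \<open>
  The kernel of \<open>d2_star\<close> as a module record. The fields \<open>mult\<close> and \<open>one\<close> are irrelevant for
  modules.
\<close>

definition Z2_star ::
    "nat \<Rightarrow> nat \<Rightarrow> (nat \<Rightarrow> 'a) \<Rightarrow> ('a::field, 'a cochain2 \<times> 'a cochain1) module" where
  "Z2_star m p lam = \<lparr>carrier = {x \<in> C2_star m p. d2_star m p lam x = 0},
     mult = undefined, one = undefined, zero = 0, add = (+), smult = cscal\<rparr>"

definition B2_star ::
    "nat \<Rightarrow> nat \<Rightarrow> (nat \<Rightarrow> 'a) \<Rightarrow> (('a::field) cochain2 \<times> 'a cochain1) set" where
  "B2_star m p lam = d1_star m p lam ` C1 m"

definition quotient_module ::
    "('a, 'b, 'c) module_scheme \<Rightarrow> 'b set \<Rightarrow> ('a, 'b set) module" where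
  "quotient_module M N = \<lparr>carrier = a_rcosets\<^bsub>M\<^esub> N, mult = undefined, one = undefined,
     zero = N, add = set_add M, smult = (\<lambda>a X. \<Union>x\<in>X. N +>\<^bsub>M\<^esub> (a \<odot>\<^bsub>M\<^esub> x))\<rparr>"

definition H2_star ::
    "nat \<Rightarrow> nat \<Rightarrow> (nat \<Rightarrow> 'a) \<Rightarrow> ('a::field, ('a cochain2 \<times> 'a cochain1) set) module" where
  "H2_star m p lam = quotient_module (Z2_star m p lam) (B2_star m p lam)"

definition coh_class :: "nat \<Rightarrow> nat \<Rightarrow> (nat \<Rightarrow> 'a) \<Rightarrow>
    ('a::field) cochain2 \<times> 'a cochain1 \<Rightarrow> ('a cochain2 \<times> 'a cochain1) set" where
  "coh_class m p lam x = B2_star m p lam +>\<^bsub>Z2_star m p lam\<^esub> x"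


section \<open>The cocycles\<close>

definition tilde :: "nat \<Rightarrow> nat \<Rightarrow> ('a::field) cochain2 \<Rightarrow> 'a cochain1" where
  "tilde m p \<phi> = (THE \<omega>. compat m p \<phi> \<omega> \<and> (\<forall>i\<in>{1..2*m+1}. \<omega> (bas i) = 0))"

definition ebar :: "nat \<Rightarrow> nat \<Rightarrow> nat \<Rightarrow> nat \<Rightarrow> ('a::field) cochain1" where
  "ebar m p i j = ext1 m (\<lambda>g. g i ^ p *\<^sub>h bas j)"

text \<open>The alternating bilinear map \<open>e\<^sup>i\<^sup>j\<^sub>k\<close>.\<close>

definition ee :: "nat \<Rightarrow> nat \<Rightarrow> nat \<Rightarrow> nat \<Rightarrow> ('a::field) cochain2" where
  "ee m i j k = ext2 m (\<lambda>g h. (g i * h j - g j * h i) *\<^sub>h bas k)"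

definition A_set :: "nat \<Rightarrow> ('a::field) cochain2 set" where
  "A_set m = (let e = ee m; q = prm m in
     (\<Union>{{e i j (q i), e i j (q j)} | i j. 1 \<le> i \<and> i < j \<and> j \<le> 2*m}) \<union>
     (\<Union>{{e i (q j) (q j) + e j (q j) (q i), e i j j + e j (q j) (q i)} | i j.
        i \<noteq> j \<and> ({i, j} \<subseteq> {1..m} \<or> {i, j} \<subseteq> {m+1..2*m})}) \<union>
     (\<Union>{{e k j (q i) + e i j (q k), e k i (q j) - e i j (q k)} | i j k.
        (1 \<le> k \<and> k < i \<and> i < j \<and> j \<le> m) \<or> (m + 1 \<le> i \<and> i < j \<and> j < k \<and> k \<le> 2*m)}) \<union>
     (\<Union>{{e i (q k) (q j) - e i j k, e j (q k) (q i) + e i j k} | i j k.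
        k \<noteq> i \<and> k \<noteq> j \<and> i < j \<and> ({i, j, k} \<subseteq> {1..m} \<or> {i, j, k} \<subseteq> {m+1..2*m})}))"

definition A_set_p :: "nat \<Rightarrow> nat \<Rightarrow> (('a::field) cochain2 \<times> 'a cochain1) set" where
  "A_set_p m p = (\<lambda>\<phi>. (\<phi>, tilde m p \<phi>)) ` A_set m"


section \<open>Restricted cohomology is a vector space\<close>

subsection \<open>Quotient modules\<close>

lemma quotient_module_vectorspace:
  assumes "subspace K N V"
  shows "vectorspace K (quotient_module V N)"
proof -
  interpret V: vectorspace K V using assms by (simp add: subspace_def)
  interpret N: submodule K N V using assms by (simp add: subspace_def)
  have neg: "\<ominus>\<^bsub>V\<^esub> x \<in> N" if "x \<in> N" for x
    using that N.smult_closed[of "\<ominus>\<^bsub>K\<^esub> \<one>\<^bsub>K\<^esub>" x] N.subset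
    by (metis V.R.add.inv_closed V.R.one_closed V.smult_minus_1 subset_iff)
  have "subgroup N (add_monoid V)"
    by (rule V.add.subgroupI) (use N.subset neg N.zero_closed in \<open>auto simp: a_inv_def[symmetric] simp del: N.zero_closed\<close>)
  then interpret S: abelian_subgroup N V
    by (intro abelian_subgroupI3) (auto simp: additive_subgroup_def V.abelian_group_axioms)
  let ?Q = "quotient_module V N"
  have coset: "X \<in> carrier ?Q \<longleftrightarrow> (\<exists>v\<in>carrier V. X = N +>\<^bsub>V\<^esub> v)" for X
    by (auto simp: quotient_module_def A_RCOSETS_def')
  have add: "(N +>\<^bsub>V\<^esub> v) \<oplus>\<^bsub>?Q\<^esub> (N +>\<^bsub>V\<^esub> w) = N +>\<^bsub>V\<^esub> (v \<oplus>\<^bsub>V\<^esub> w)"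
    if "v \<in> carrier V" "w \<in> carrier V" for v w
    using that by (simp add: quotient_module_def S.a_rcos_sum)
  have zero: "\<zero>\<^bsub>?Q\<^esub> = N +>\<^bsub>V\<^esub> \<zero>\<^bsub>V\<^esub>"
    by (simp add: quotient_module_def N.subset V.a_coset_add_zero)
  have smult: "a \<odot>\<^bsub>?Q\<^esub> (N +>\<^bsub>V\<^esub> v) = N +>\<^bsub>V\<^esub> (a \<odot>\<^bsub>V\<^esub> v)"
    if a: "a \<in> carrier K" and v: "v \<in> carrier V" for a v
  proof -
    have "N +>\<^bsub>V\<^esub> (a \<odot>\<^bsub>V\<^esub> x) = N +>\<^bsub>V\<^esub> (a \<odot>\<^bsub>V\<^esub> v)" if x: "x \<in> N +>\<^bsub>V\<^esub> v" for x
    proof -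
      from x obtain n where n: "n \<in> N" "x = n \<oplus>\<^bsub>V\<^esub> v" by (auto simp: a_r_coset_def')
      have "a \<odot>\<^bsub>V\<^esub> x = a \<odot>\<^bsub>V\<^esub> n \<oplus>\<^bsub>V\<^esub> a \<odot>\<^bsub>V\<^esub> v"
        using n a v N.subset by (auto simp: V.smult_r_distr)
      then have "a \<odot>\<^bsub>V\<^esub> x \<in> N +>\<^bsub>V\<^esub> (a \<odot>\<^bsub>V\<^esub> v)"
        using n a by (auto simp: a_r_coset_def')
      then show ?thesis using a v by (metis S.a_repr_independence' V.smult_closed)
    qed
    moreover have "v \<in> N +>\<^bsub>V\<^esub> v" using v by (rule S.a_rcos_self)
    ultimately have "(\<Union>x\<in>N +>\<^bsub>V\<^esub> v. N +>\<^bsub>V\<^esub> (a \<odot>\<^bsub>V\<^esub> x)) = N +>\<^bsub>V\<^esub> (a \<odot>\<^bsub>V\<^esub> v)"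
      by blast
    then show ?thesis by (simp add: quotient_module_def)
  qed
  have ex: "\<exists>v\<in>carrier V. X = N +>\<^bsub>V\<^esub> v" if "X \<in> carrier ?Q" for X
    using that coset by blast
  have mem: "N +>\<^bsub>V\<^esub> v \<in> carrier ?Q" if "v \<in> carrier V" for v
    using that coset by blast
  have "abelian_group ?Q"
  proof (rule abelian_groupI)
    fix X Y assume "X \<in> carrier ?Q" "Y \<in> carrier ?Q"
    then obtain v w where *: "v \<in> carrier V" "X = N +>\<^bsub>V\<^esub> v" "w \<in> carrier V" "Y = N +>\<^bsub>V\<^esub> w"
      using ex by meson
    show "X \<oplus>\<^bsub>?Q\<^esub> Y \<in> carrier ?Q" "X \<oplus>\<^bsub>?Q\<^esub> Y = Y \<oplus>\<^bsub>?Q\<^esub> X"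
      by (simp_all only: * add mem V.M.add.m_closed V.M.a_comm[of w v])
    fix Z assume "Z \<in> carrier ?Q"
    then obtain u where u: "u \<in> carrier V" "Z = N +>\<^bsub>V\<^esub> u"
      using ex by meson
    show "X \<oplus>\<^bsub>?Q\<^esub> Y \<oplus>\<^bsub>?Q\<^esub> Z = X \<oplus>\<^bsub>?Q\<^esub> (Y \<oplus>\<^bsub>?Q\<^esub> Z)"
      by (simp only: * u add V.M.add.m_closed V.M.a_assoc)
  next
    fix X assume "X \<in> carrier ?Q"
    then obtain v where v: "v \<in> carrier V" "X = N +>\<^bsub>V\<^esub> v" using ex by meson
    show "\<zero>\<^bsub>?Q\<^esub> \<oplus>\<^bsub>?Q\<^esub> X = X"
      by (simp only: v add zero V.M.zero_closed V.M.l_zero)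
    show "\<exists>Y\<in>carrier ?Q. Y \<oplus>\<^bsub>?Q\<^esub> X = \<zero>\<^bsub>?Q\<^esub>"
      by (rule bexI[of _ "N +>\<^bsub>V\<^esub> (\<ominus>\<^bsub>V\<^esub> v)"])
        (simp_all only: v add zero V.M.l_neg mem V.M.a_inv_closed)
  next
    show "\<zero>\<^bsub>?Q\<^esub> \<in> carrier ?Q" by (simp only: zero mem V.M.zero_closed)
  qed
  moreover have "module_axioms K ?Q"
  proof
    fix a X assume a: "a \<in> carrier K" and "X \<in> carrier ?Q"
    then obtain v where v: "v \<in> carrier V" "X = N +>\<^bsub>V\<^esub> v" using ex by meson
    show "a \<odot>\<^bsub>?Q\<^esub> X \<in> carrier ?Q"
      by (simp only: v a smult mem V.smult_closed)
    fix b assume b: "b \<in> carrier K"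
    show "(a \<oplus>\<^bsub>K\<^esub> b) \<odot>\<^bsub>?Q\<^esub> X = a \<odot>\<^bsub>?Q\<^esub> X \<oplus>\<^bsub>?Q\<^esub> b \<odot>\<^bsub>?Q\<^esub> X"
      by (simp only: v a b smult add V.R.add.m_closed V.smult_closed V.smult_l_distr)
    show "(a \<otimes>\<^bsub>K\<^esub> b) \<odot>\<^bsub>?Q\<^esub> X = a \<odot>\<^bsub>?Q\<^esub> (b \<odot>\<^bsub>?Q\<^esub> X)"
      by (simp only: v a b smult V.R.m_closed V.smult_closed V.smult_assoc1)
  next
    fix a X Y assume a: "a \<in> carrier K" and "X \<in> carrier ?Q" "Y \<in> carrier ?Q"
    then obtain v w where *: "v \<in> carrier V" "X = N +>\<^bsub>V\<^esub> v" "w \<in> carrier V" "Y = N +>\<^bsub>V\<^esub> w"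
      using ex by meson
    show "a \<odot>\<^bsub>?Q\<^esub> (X \<oplus>\<^bsub>?Q\<^esub> Y) = a \<odot>\<^bsub>?Q\<^esub> X \<oplus>\<^bsub>?Q\<^esub> a \<odot>\<^bsub>?Q\<^esub> Y"
      by (simp only: * a smult add V.M.add.m_closed V.smult_closed V.smult_r_distr)
  next
    fix X assume "X \<in> carrier ?Q"
    then obtain v where v: "v \<in> carrier V" "X = N +>\<^bsub>V\<^esub> v" using ex by meson
    show "\<one>\<^bsub>K\<^esub> \<odot>\<^bsub>?Q\<^esub> X = X"
      by (simp only: v smult V.R.one_closed V.smult_one)
  qed
  moreover have "cring K" ..
  ultimately show ?thesis
    by (intro vectorspace.intro Module.module.intro V.field_axioms)
qed

subsection \<open>The complex in degrees one and two\<close>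

lemma scal_simps [simp]:
  "a *\<^sub>h (0 :: 'a::field hvec) = 0" "0 *\<^sub>h g = 0" "1 *\<^sub>h g = g"
  "a *\<^sub>h b *\<^sub>h g = (a * b) *\<^sub>h g"
  by (auto simp: scal_def fun_eq_iff)

lemma scal_distribs:
  "a *\<^sub>h (g + h) = a *\<^sub>h g + a *\<^sub>h h" "(a + b) *\<^sub>h g = a *\<^sub>h g + b *\<^sub>h g"
  "a *\<^sub>h (g - h) = a *\<^sub>h g - a *\<^sub>h h" "a *\<^sub>h (- g) = - (a *\<^sub>h g)"
  "a *\<^sub>h (sum f X) = (\<Sum>x\<in>X. a *\<^sub>h f x)"
  by (induction X rule: infinite_finite_induct; auto simp: scal_def fun_eq_iff algebra_simps)+

lemma heis_closed [simp]:
  "0 \<in> heis m"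
  "g \<in> heis m \<Longrightarrow> h \<in> heis m \<Longrightarrow> g + h \<in> heis m"
  "g \<in> heis m \<Longrightarrow> h \<in> heis m \<Longrightarrow> g - h \<in> heis m"
  "g \<in> heis m \<Longrightarrow> - g \<in> heis m"
  "g \<in> heis m \<Longrightarrow> a *\<^sub>h g \<in> heis m"
  "hbr m g' h' \<in> heis m"
  "pmap m p lam g' \<in> heis m"
  by (auto simp: heis_def scal_def hbr_def pmap_def bas_def)

lemma hbr_linear:
  "hbr m (g + g') h = hbr m g h + hbr m g' h" "hbr m g (h + h') = hbr m g h + hbr m g h'"
  "hbr m (g - g') h = hbr m g h - hbr m g' h" "hbr m g (h - h') = hbr m g h - hbr m g h'"
  "hbr m (- g) h = - hbr m g h" "hbr m g (- h) = - hbr m g h"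
  "hbr m (a *\<^sub>h g) h = a *\<^sub>h hbr m g h" "hbr m g (a *\<^sub>h h) = a *\<^sub>h hbr m g h"
  by (auto simp: hbr_def scal_def fun_eq_iff bas_def algebra_simps
      sum.distrib sum_subtractf sum_negf sum_distrib_left)

lemma hbr_0 [simp]: "hbr m 0 h = 0" "hbr m g 0 = 0"
  by (auto simp: hbr_def)

lemma hbr_self [simp]: "hbr m g g = 0"
  by (simp add: hbr_def mult.commute)

lemma hbr_anti: "hbr m h g = - hbr m g h"
  using hbr_self[of m "g + h"] by (simp add: hbr_linear eq_neg_iff_add_eq_0 del: hbr_self) simp

lemma hbr_central [simp]:
  "hbr m (hbr m g h) k = 0" "hbr m k (hbr m g h) = 0"
  "hbr m (pmap m p lam g) k = 0" "hbr m k (pmap m p lam g) = 0"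
proof -
  have "hbr m (a *\<^sub>h bas (2*m+1)) k = 0" "hbr m k (a *\<^sub>h bas (2*m+1)) = 0" for a
    by (auto simp: hbr_def scal_def bas_def intro!: sum.neutral)
  then show "hbr m (hbr m g h) k = 0" "hbr m k (hbr m g h) = 0"
    "hbr m (pmap m p lam g) k = 0" "hbr m k (pmap m p lam g) = 0"
    unfolding hbr_def[of m g h] pmap_def by blast+
qed

lemma ad_power_0 [simp]: "2 \<le> n \<Longrightarrow> (hbr m g ^^ n) x = 0"
proof (induction n rule: dec_induct)
  case base
  then show ?case by (simp add: numeral_2_eq_2)
next
  case (step n)
  then show ?case by (simp only: funpow.simps o_apply hbr_0)
qed

lemma pmap_add:
  assumes "CHAR('a::field) = p" "p > 2"
  shows "pmap m p lam (g + h :: 'a hvec) = pmap m p lam g + pmap m p lam h"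
proof -
  have "prime p" using assms prime_CHAR_semidom[where ?'a = 'a] by simp
  then have "(x + y) ^ p = x ^ p + y ^ p" for x y :: 'a
    using assms by (intro freshmans_dream) auto
  then show ?thesis
    by (simp add: pmap_def sum.distrib scal_distribs algebra_simps)
qed

lemma pmap_scal: "pmap m p lam (a *\<^sub>h g) = a ^ p *\<^sub>h pmap m p lam g"
proof -
  have "(a *\<^sub>h g) i ^ p * lam i = a ^ p * (g i ^ p * lam i)" for i
    by (simp add: scal_def power_mult_distrib mult.assoc)
  then show ?thesis
    by (simp only: pmap_def sum_distrib_left[symmetric] scal_simps)
qed

lemma lnbr_take_Suc:
  assumes "1 \<le> k" "k < length gs"
  shows "lnbr m (take (Suc k) gs) = hbr m (lnbr m (take k gs)) (gs ! k)"
  using assms by (cases gs; cases k) (auto simp: lnbr_def take_Suc_conv_app_nth)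

lemma lnbr_heis:
  assumes "gs \<noteq> []" "set gs \<subseteq> heis m"
  shows "lnbr m gs \<in> heis m"
  using assms
proof (induction gs rule: rev_induct)
  case (snoc x gs)
  then show ?case by (cases gs) (auto simp: lnbr_def)
qed simp

lemma C1D:
  assumes "\<psi> \<in> C1 m"
  shows "g \<in> heis m \<Longrightarrow> \<psi> g \<in> heis m"
    "g \<in> heis m \<Longrightarrow> h \<in> heis m \<Longrightarrow> \<psi> (g + h) = \<psi> g + \<psi> h"
    "g \<in> heis m \<Longrightarrow> \<psi> (a *\<^sub>h g) = a *\<^sub>h \<psi> g"
    "\<psi> 0 = 0"
    "g \<in> heis m \<Longrightarrow> \<psi> (- g) = - \<psi> g"
    "g \<notin> heis m \<Longrightarrow> \<psi> g = 0"
proof -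
  show *: "g \<in> heis m \<Longrightarrow> \<psi> (a *\<^sub>h g) = a *\<^sub>h \<psi> g" for g a
    using assms by (auto simp: C1_def linear_heis_def)
  show "\<psi> 0 = 0" using *[of 0 0] by simp
  show "g \<in> heis m \<Longrightarrow> \<psi> (- g) = - \<psi> g" using *[of g "-1"] by (simp add: scal_def fun_eq_iff fun_Compl_def)
  show "g \<notin> heis m \<Longrightarrow> \<psi> g = 0" proof -
    have "ext1 m \<psi> g = \<psi> g" using assms by (simp add: C1_def)
    then show "g \<notin> heis m \<Longrightarrow> \<psi> g = 0" by (simp add: ext1_def)
  qed
qed (use assms in \<open>auto simp: C1_def linear_heis_def\<close>)

lemma C1I:
  assumes "\<And>g. g \<in> heis m \<Longrightarrow> \<psi> g \<in> heis m"
    "\<And>g h. g \<in> heis m \<Longrightarrow> h \<in> heis m \<Longrightarrow> \<psi> (g + h) = \<psi> g + \<psi> h"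
    "\<And>a g. g \<in> heis m \<Longrightarrow> \<psi> (a *\<^sub>h g) = a *\<^sub>h \<psi> g"
    "\<And>g. g \<notin> heis m \<Longrightarrow> \<psi> g = 0"
  shows "\<psi> \<in> C1 m"
  using assms by (simp add: C1_def linear_heis_def ext1_def) (rule ext, simp)

lemma C2_iff:
  "\<phi> \<in> C2 m \<longleftrightarrow>
     (\<forall>g h. g \<notin> heis m \<or> h \<notin> heis m \<longrightarrow> \<phi> g h = 0) \<and>
     (\<forall>g\<in>heis m. \<forall>h\<in>heis m. \<phi> g h \<in> heis m) \<and>
     (\<forall>g\<in>heis m. \<forall>h\<in>heis m. \<forall>k\<in>heis m. \<phi> g (h + k) = \<phi> g h + \<phi> g k \<and> \<phi> (h + k) g = \<phi> h g + \<phi> k g) \<and>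
     (\<forall>a. \<forall>g\<in>heis m. \<forall>h\<in>heis m. \<phi> g (a *\<^sub>h h) = a *\<^sub>h \<phi> g h \<and> \<phi> (a *\<^sub>h h) g = a *\<^sub>h \<phi> h g) \<and>
     (\<forall>g\<in>heis m. \<phi> g g = 0)"
proof -
  have "ext2 m \<phi> = \<phi> \<longleftrightarrow> (\<forall>g h. g \<notin> heis m \<or> h \<notin> heis m \<longrightarrow> \<phi> g h = 0)"
    unfolding ext2_def by (subst fun_eq_iff, subst fun_eq_iff) metis
  then show ?thesis
    unfolding C2_def linear_heis_def Pi_def by blast
qed

lemma d1_in_C2:
  assumes "\<psi> \<in> C1 m"
  shows "d1 m \<psi> \<in> C2 m"
  unfolding C2_iff d1_def ext2_def
  using C1D[OF assms]
  by (auto simp: hbr_linear scal_distribs algebra_simps)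

lemma C2_closed:
  assumes "\<phi> \<in> C2 m" "\<phi>' \<in> C2 m"
  shows "\<phi> + \<phi>' \<in> C2 m" "- \<phi> \<in> C2 m" "(\<lambda>g h. a *\<^sub>h \<phi> g h) \<in> C2 m" "0 \<in> C2 m"
  using assms unfolding C2_iff
  by (auto simp: scal_distribs mult.commute)

lemma d1_apply:
  "g \<in> heis m \<Longrightarrow> h \<in> heis m \<Longrightarrow> d1 m \<psi> g h = hbr m g (\<psi> h) - hbr m h (\<psi> g) - \<psi> (hbr m g h)"
  by (simp add: d1_def ext2_def)

lemma ind1_apply:
  "p > 2 \<Longrightarrow> g \<in> heis m \<Longrightarrow> ind1 m p lam \<psi> g = \<psi> (pmap m p lam g)"
  by (simp add: ind1_def ext1_def)

lemma compat_sum_d1: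
  assumes "\<psi> \<in> C1 m" "p > 2" "g \<in> heis m" "h \<in> heis m"
  shows "compat_sum m p (- d1 m \<psi>) g h = 0"
  unfolding compat_sum_def
proof (rule sum.neutral, rule ballI)
  fix s assume "s \<in> symseqs p"
  then have len: "length s = p" by (simp add: symseqs_def)
  define gs where "gs = map (\<lambda>b. if b then g else h) s"
  have gs: "length gs = p" "set gs \<subseteq> heis m"
    using assms len by (auto simp: gs_def)
  define l where "l = lnbr m (take (p - 2) gs)"
  define x where "x = gs ! (p - 2)"
  define y where "y = gs ! (p - 1)"
  have xy: "x \<in> heis m" "y \<in> heis m"
    using gs assms nth_mem[of "p - 2" gs] nth_mem[of "p - 1" gs] by (auto simp: x_def y_def)
  have l: "l \<in> heis m"
    unfolding l_def using gs assms set_take_subset[of "p - 2" gs] by (intro lnbr_heis) auto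
  have lx: "lnbr m (take (p - 1) gs) = hbr m l x"
    using lnbr_take_Suc[of "p - 2" gs m] gs assms by (simp add: l_def x_def Suc_diff_Suc numeral_2_eq_2)
  have 1: "(- d1 m \<psi>) (hbr m l x) y = hbr m y (\<psi> (hbr m l x))"
    using xy C1D[OF assms(1)] by (simp add: d1_apply)
  have 2: "hbr m y ((- d1 m \<psi>) l x) = hbr m y (\<psi> (hbr m l x))"
    using xy l C1D[OF assms(1)] by (simp add: d1_apply hbr_linear)
  show "(let gs = map (\<lambda>b. if b then g else h) s
       in (1 / of_nat (count_list s True)) *\<^sub>h
          ((- d1 m \<psi>) (lnbr m (take (p - 1) gs)) (gs ! (p - 1)) -
           hbr m (gs ! (p - 1)) ((- d1 m \<psi>) (lnbr m (take (p - 2) gs)) (gs ! (p - 2))))) = 0"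
    unfolding gs_def[symmetric] Let_def lx unfolding l_def[symmetric] x_def[symmetric] y_def[symmetric] 1 2
    by simp
qed

lemma d1_star_in_C2_star:
  assumes "CHAR('a::field) = p" "p > 2" "\<psi> \<in> C1 m"
  shows "d1_star m p lam (\<psi> :: 'a cochain1) \<in> C2_star m p"
proof -
  have "ext1 m (ind1 m p lam \<psi>) = ind1 m p lam \<psi>"
    by (auto simp: ind1_def ext1_def)
  then have "compat m p (- d1 m \<psi>) (ind1 m p lam \<psi>)"
    using assms C1D[OF assms(3)]
    by (auto simp: compat_def compat_sum_d1 ind1_apply pmap_add pmap_scal)
  then show ?thesis
    using d1_in_C2[OF assms(3)] by (auto simp: C2_star_def d1_star_def intro: C2_closed)
qed

lemma d2_star_d1_star:
  assumes "CHAR('a::field) = p" "p > 2" "\<psi> \<in> C1 m"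
  shows "d2_star m p lam (d1_star m p lam (\<psi> :: 'a cochain1)) = 0"
proof -
  note psi = C1D[OF assms(3)]
  have "d2 m (- d1 m \<psi>) g h k = 0" for g h k
  proof (cases "g \<in> heis m \<and> h \<in> heis m \<and> k \<in> heis m")
    case True
    then show ?thesis
      by (simp add: d2_def ext3_def d1_apply psi hbr_linear)
  qed (auto simp: d2_def ext3_def)
  moreover have "ind2 m p lam (- d1 m \<psi>, ind1 m p lam \<psi>) g h = 0" for g h
  proof (cases "g \<in> heis m \<and> h \<in> heis m")
    case True
    have "(hbr m h ^^ (p - 2)) g \<in> heis m"
      using True assms by (cases "p - 2") auto
    moreover have "hbr m h ((hbr m h ^^ (p - 2)) g) = 0"
      using ad_power_0[of "Suc (p - 2)" m h g] assms by simp
    ultimately show ?thesis using True assms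
      by (simp add: ind2_def ext2_def d1_apply ind1_apply psi hbr_linear)
  qed (auto simp: ind2_def ext2_def)
  ultimately show ?thesis
    by (simp add: d2_star_def d1_star_def zero_prod_def) (simp add: fun_eq_iff)
qed

text \<open>The unsigned pair \<open>(d1 \<psi>, ind1 \<psi>)\<close> is in general not a cocycle.\<close>

lemma ind2_unsigned:
  assumes "p > 2" "\<psi> \<in> C1 m" "g \<in> heis m" "h \<in> heis m"
  shows "ind2 m p lam (d1 m \<psi>, ind1 m p lam \<psi>) g h = 2 *\<^sub>h hbr m g (\<psi> (pmap m p lam h))"
proof -
  note psi = C1D[OF assms(2)]
  have "(hbr m h ^^ (p - 2)) g \<in> heis m"
    using assms by (cases "p - 2") auto
  moreover have "hbr m h ((hbr m h ^^ (p - 2)) g) = 0"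
    using ad_power_0[of "Suc (p - 2)" m h g] assms by simp
  ultimately have "ind2 m p lam (d1 m \<psi>, ind1 m p lam \<psi>) g h =
      hbr m g (\<psi> (pmap m p lam h)) + hbr m g (\<psi> (pmap m p lam h))"
    using assms by (simp add: ind2_def ext2_def d1_apply ind1_apply psi hbr_linear)
  also have "\<dots> = (1 + 1) *\<^sub>h hbr m g (\<psi> (pmap m p lam h))"
    by (simp only: scal_distribs(2) scal_simps(3))
  finally show ?thesis by (simp only: one_add_one)
qed

lemma ind1_vanishing_pmap:
  assumes "p > 2" "\<psi> \<in> C1 m" "\<forall>i\<in>{1..2*m+1}. lam i = 0"
  shows "ind1 m p lam \<psi> = 0"
proof
  fix g
  have "pmap m p lam g = 0"
    using assms(3) by (simp add: pmap_def)
  then show "ind1 m p lam \<psi> g = 0 g"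
    using assms C1D(4)[OF assms(2)] ind1_apply[of p g m lam \<psi>]
    by (cases "g \<in> heis m") (simp_all add: ind1_def ext1_def)
qed

lemma compat_sum_linear:
  "compat_sum m p (\<phi> + \<phi>') g h = compat_sum m p \<phi> g h + compat_sum m p \<phi>' g h"
  "compat_sum m p (\<lambda>g h. a *\<^sub>h \<phi> g h) g h = a *\<^sub>h compat_sum m p \<phi> g h"
  unfolding compat_sum_def Let_def scal_distribs sum.distrib[symmetric]
  by (rule sum.cong[OF refl], simp add: hbr_linear scal_distribs mult.commute)+

lemma compat_closed:
  assumes "compat m p \<phi> \<omega>" "compat m p \<phi>' \<omega>'"
  shows "compat m p (\<phi> + \<phi>') (\<omega> + \<omega>')" "compat m p (\<lambda>g h. a *\<^sub>h \<phi> g h) (\<lambda>g. a *\<^sub>h \<omega> g)"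
proof -
  have ext: "ext1 m w = w \<longleftrightarrow> (\<forall>g. g \<notin> heis m \<longrightarrow> w g = 0)" for w :: "'a cochain1"
    unfolding ext1_def by (subst fun_eq_iff) metis
  show "compat m p (\<phi> + \<phi>') (\<omega> + \<omega>')" "compat m p (\<lambda>g h. a *\<^sub>h \<phi> g h) (\<lambda>g. a *\<^sub>h \<omega> g)"
    using assms unfolding compat_def ext
    by (auto simp: compat_sum_linear scal_distribs mult.commute Pi_iff)
qed

lemma d2_star_linear:
  "d2_star m p lam (x + y) = d2_star m p lam x + d2_star m p lam y"
  "d2_star m p lam x = 0 \<Longrightarrow> d2_star m p lam (cscal a x) = 0"
proof -
  have "d2 m (\<phi> + \<phi>') g h k = d2 m \<phi> g h k + d2 m \<phi>' g h k"
    "d2 m (\<lambda>g h. a *\<^sub>h \<phi> g h) g h k = a *\<^sub>h d2 m \<phi> g h k" for \<phi> \<phi>' :: "'a cochain2" and g h k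
    by (simp_all add: d2_def ext3_def hbr_linear scal_distribs)
  moreover have "ind2 m p lam (\<phi> + \<phi>', \<omega> + \<omega>') g h = ind2 m p lam (\<phi>, \<omega>) g h + ind2 m p lam (\<phi>', \<omega>') g h"
    "ind2 m p lam (\<lambda>g h. a *\<^sub>h \<phi> g h, \<lambda>g. a *\<^sub>h \<omega> g) g h = a *\<^sub>h ind2 m p lam (\<phi>, \<omega>) g h"
    for \<phi> \<phi>' :: "'a cochain2" and \<omega> \<omega>' g h
    by (simp_all add: ind2_def ext2_def hbr_linear scal_distribs)
  ultimately have *: "d2 m (\<phi> + \<phi>') = d2 m \<phi> + d2 m \<phi>'"
    "d2 m (\<lambda>g h. a *\<^sub>h \<phi> g h) = (\<lambda>g h k. a *\<^sub>h d2 m \<phi> g h k)"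
    "ind2 m p lam (\<phi> + \<phi>', \<omega> + \<omega>') = ind2 m p lam (\<phi>, \<omega>) + ind2 m p lam (\<phi>', \<omega>')"
    "ind2 m p lam (\<lambda>g h. a *\<^sub>h \<phi> g h, \<lambda>g. a *\<^sub>h \<omega> g) = (\<lambda>g h. a *\<^sub>h ind2 m p lam (\<phi>, \<omega>) g h)"
    for \<phi> \<phi>' :: "'a cochain2" and \<omega> \<omega>'
    by (intro ext; simp)+
  show "d2_star m p lam (x + y) = d2_star m p lam x + d2_star m p lam y"
    by (cases x; cases y) (simp add: d2_star_def *)
  show "d2_star m p lam (cscal a x) = 0" if "d2_star m p lam x = 0"
  proof (cases x)
    case (Pair \<phi> \<omega>)
    then have "d2 m \<phi> = 0" "ind2 m p lam (\<phi>, \<omega>) = 0"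
      using that by (simp_all add: d2_star_def zero_prod_def)
    then show ?thesis
      using Pair by (simp add: d2_star_def cscal_def * zero_prod_def) (simp add: fun_eq_iff)
  qed
qed

lemma cscal_simps:
  "cscal (a + b) x = cscal a x + cscal b x" "cscal a (x + y) = cscal a x + cscal a y"
  "cscal (a * b) x = cscal a (cscal b x)" "cscal 1 x = x" "cscal (- 1) x = - x" "cscal 0 x = 0"
  by (auto simp: cscal_def scal_def prod_eq_iff fun_eq_iff split_beta algebra_simps)

lemma Z2_star_vectorspace: "vectorspace class_ring (Z2_star m p (lam :: nat \<Rightarrow> 'a::field))"
proof -
  let ?Z = "Z2_star m p lam"
  have simps: "add ?Z = (+)" "zero ?Z = 0" "smult ?Z = cscal"
    by (simp_all add: Z2_star_def)
  have add: "x + y \<in> carrier ?Z" if "x \<in> carrier ?Z" "y \<in> carrier ?Z" for x y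
    using that by (auto simp: Z2_star_def C2_star_def d2_star_linear C2_closed compat_closed)
  have cs: "cscal a x \<in> carrier ?Z" if "x \<in> carrier ?Z" for a x
    using that d2_star_linear(2)[of m p lam x a]
    by (auto simp: Z2_star_def C2_star_def cscal_def C2_closed compat_closed)
  have zero: "0 \<in> carrier ?Z"
  proof -
    have "compat m p 0 0"
      by (auto simp: compat_def ext1_def compat_sum_def fun_eq_iff intro!: sum.neutral)
    moreover have "d2_star m p lam 0 = 0"
      using d2_star_linear(1)[of m p lam 0 0] by simp
    moreover have "(0 :: 'a cochain2) \<in> C2 m" by (simp add: C2_iff)
    ultimately show ?thesis
      by (simp add: Z2_star_def C2_star_def zero_prod_def)
  qed
  have "abelian_group ?Z"
  proof (rule abelian_groupI)
    fix x assume "x \<in> carrier ?Z"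
    then have "cscal (- 1) x \<in> carrier ?Z" by (rule cs)
    then show "\<exists>y\<in>carrier ?Z. y \<oplus>\<^bsub>?Z\<^esub> x = \<zero>\<^bsub>?Z\<^esub>"
      by (intro bexI[of _ "cscal (- 1) x"]) (simp_all add: simps cscal_simps)
  qed (simp_all add: simps add zero ac_simps)
  moreover have "module_axioms class_ring ?Z"
    by unfold_locales (simp_all add: simps cs cscal_simps)
  ultimately show ?thesis
    by (intro vectorspace.intro Module.module.intro class_field field.axioms(1) domain.axioms(1))
qed

lemma B2_star_subspace:
  assumes "CHAR('a::field) = p" "p > 2"
  shows "subspace class_ring (B2_star m p (lam :: nat \<Rightarrow> 'a)) (Z2_star m p lam)"
proof -
  let ?B = "B2_star m p lam"
  have lin: "\<psi> + \<psi>' \<in> C1 m" "(\<lambda>g. a *\<^sub>h \<psi> g) \<in> C1 m"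
    "d1_star m p lam (\<psi> + \<psi>') = d1_star m p lam \<psi> + d1_star m p lam \<psi>'"
    "d1_star m p lam (\<lambda>g. a *\<^sub>h \<psi> g) = cscal a (d1_star m p lam \<psi>)"
    if "\<psi> \<in> C1 m" "\<psi>' \<in> C1 m" for \<psi> \<psi>' :: "'a cochain1" and a
    using C1D[OF that(1)] C1D[OF that(2)] assms(2)
    by (auto intro!: C1I ext simp: scal_distribs mult.commute d1_star_def cscal_def
        d1_def ext2_def ind1_def ext1_def hbr_linear algebra_simps)
  have "submodule class_ring ?B (Z2_star m p lam)"
  proof (rule submodule.intro)
    interpret Z: vectorspace class_ring "Z2_star m p lam" by (rule Z2_star_vectorspace)
    show "module class_ring (Z2_star m p lam)" ..
    show "?B \<subseteq> carrier (Z2_star m p lam)"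
      using d1_star_in_C2_star[OF assms] d2_star_d1_star[OF assms]
      by (auto simp: B2_star_def Z2_star_def)
    have "(0 :: 'a cochain1) \<in> C1 m" by (simp add: C1I)
    moreover have "d1_star m p lam 0 = 0"
      using lin(3)[of 0 0] \<open>0 \<in> C1 m\<close> by simp
    ultimately show "\<zero>\<^bsub>Z2_star m p lam\<^esub> \<in> ?B"
      by (auto simp: B2_star_def Z2_star_def image_iff intro!: bexI[of _ 0])
    show "v \<oplus>\<^bsub>Z2_star m p lam\<^esub> w \<in> ?B" if "v \<in> ?B" "w \<in> ?B" for v w
      using that lin(1,3) by (auto simp: B2_star_def Z2_star_def image_iff) metis
    show "c \<odot>\<^bsub>Z2_star m p lam\<^esub> v \<in> ?B" if "c \<in> carrier class_ring" "v \<in> ?B" for c v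
      using that lin(2,4) by (auto simp: B2_star_def Z2_star_def image_iff) metis
  qed
  then show ?thesis
    by (simp add: subspace_def Z2_star_vectorspace)
qed

theorem H2_star_vectorspace:
  assumes "CHAR('a::field) = p" "p > 2"
  shows "vectorspace class_ring (H2_star m p (lam :: nat \<Rightarrow> 'a))"
  unfolding H2_star_def using assms by (intro quotient_module_vectorspace B2_star_subspace)

end

theory Submission
  imports Defs
begin

text \<open>
  On \<open>V = span {e\<^sub>1, \<dots>, e\<^bsub>2m\<^esub>}\<close> the bracket is \<open>[g, h] = \<beta>(g, h) z\<close> for a symplectic form \<open>\<beta>\<close> and the
  central element \<open>z = e\<^bsub>2m+1\<^esub>\<close>. The theorem follows from a computation of the ordinary second
  cohomology, the lifting of its basis to restricted cocycles, and a description of the restricted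
  cocycles with vanishing first component.

  Ordinary cohomology. Since \<open>m > 1\<close>, a 2-cocycle sends \<open>(g, z)\<close> into the centre
  (\<open>cocycle_center_is_central\<close>). A coboundary then removes both the values on \<open>(g, z)\<close> and all
  \<open>z\<close>-components (\<open>gauge_normalizes\<close>). What remains is an alternating map \<open>\<phi>\<close> on \<open>V\<close> with values in
  \<open>V\<close>, and the cocycle condition says that \<open>T(g, h, k) = \<beta>(k, \<phi>(g, h))\<close> has vanishing cyclic sum.
  So the cohomology is the kernel of \<open>\<Lambda>\<^sup>2 V\<^sup>* \<otimes> V\<^sup>* \<rightarrow> \<Lambda>\<^sup>3 V\<^sup>*\<close>. The coordinate \<open>T(e\<^sub>i, e\<^sub>j, e\<^sub>k)\<close> is free
  when \<open>k \<in> {i, j}\<close>. For three distinct indices, the three coordinates sum to zero, so one of them is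
  determined by the other two. The set \<open>A\<^sub>m\<close> corresponds to a choice, for each three-element index
  set, of the dependent coordinate: an index \<open>d\<close> of the set is marked (\<open>shared\<close>), and every element
  of \<open>A\<^sub>m\<close> has one pivot coordinate in which no other element is supported (\<open>A_set_eq\<close>, \<open>pivot_basis_cocycle\<close>).

  Lifting. On a normalised cocycle the compatibility sum vanishes for \<open>p > 3\<close>, and for \<open>p = 3\<close> it is
  \<open>[g - h, \<phi>(g, h)]\<close> (\<open>compat_sum_normal\<close>), which by the cyclic identity is a symmetric additive
  2-cocycle in characteristic 3. Such a cocycle that vanishes on proportional vectors is the
  coboundary of a \<open>p\<close>-homogeneous map vanishing on the basis (\<open>symmetric_cocycle_trivial\<close>). Hence
  \<open>\<phi>~\<close> exists, it has central values, and \<open>(\<phi>, \<phi>~)\<close> is a restricted cocycle.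

  Vanishing first component. A restricted cocycle \<open>(0, \<omega>)\<close> is a \<open>p\<close>-semilinear map into the centre, a
  combination of the \<open>(0, ebar\<^sup>j\<^bsub>2m+1\<^esub>)\<close>. The coboundaries among these come from derivations, which
  scale \<open>z\<close> by some \<open>c\<close>, and give \<open>c \<Sum>\<^sub>j \<lambda>\<^sub>j ebar\<^sup>j\<^bsub>2m+1\<^esub>\<close>. If \<open>\<lambda>\<^sub>i \<noteq> 0\<close>, this is one relation, which
  eliminates the index \<open>i\<close>. If \<open>\<lambda> = 0\<close>, there is no relation.

  All this is packaged by duality. The pivot coordinates, corrected so as to vanish on coboundaries,
  and the coordinates of \<open>\<omega>\<close> modulo \<open>\<lambda>\<close> form a family of linear functionals on the restricted
  cocycles. It is dual to the claimed basis, and its common kernel is the space of coboundaries. By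
  \<open>quotient_module_basis_dual\<close> this is enough.
\<close>

section \<open>Bases of quotient spaces\<close>

text \<open>
  Biorthogonality gives independence modulo \<open>N\<close>. For spanning, subtract from \<open>v\<close> the combination of
  the \<open>x i\<close> with coefficients \<open>\<pi> i v\<close>: all functionals vanish on the difference, so it lies in \<open>N\<close>. The
  family is indexed because biorthogonality also provides injectivity of the cosets.
\<close>

lemma quotient_module_basis_dual:
  fixes x :: "'i \<Rightarrow> 'b" and \<pi> :: "'i \<Rightarrow> 'b \<Rightarrow> 'k"
  assumes sub: "subspace K N V" and fin: "finite I" and x: "x ` I \<subseteq> carrier V"
    and closed: "\<And>i v. i \<in> I \<Longrightarrow> v \<in> carrier V \<Longrightarrow> \<pi> i v \<in> carrier K"
    and add: "\<And>i v w. i \<in> I \<Longrightarrow> v \<in> carrier V \<Longrightarrow> w \<in> carrier V \<Longrightarrow> \<pi> i (v \<oplus>\<^bsub>V\<^esub> w) = \<pi> i v \<oplus>\<^bsub>K\<^esub> \<pi> i w"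
    and smult: "\<And>i a v. i \<in> I \<Longrightarrow> a \<in> carrier K \<Longrightarrow> v \<in> carrier V \<Longrightarrow> \<pi> i (a \<odot>\<^bsub>V\<^esub> v) = a \<otimes>\<^bsub>K\<^esub> \<pi> i v"
    and dual: "\<And>i j. i \<in> I \<Longrightarrow> j \<in> I \<Longrightarrow> \<pi> i (x j) = (if i = j then \<one>\<^bsub>K\<^esub> else \<zero>\<^bsub>K\<^esub>)"
    and vanish: "\<And>i v. i \<in> I \<Longrightarrow> v \<in> N \<Longrightarrow> \<pi> i v = \<zero>\<^bsub>K\<^esub>"
    and separate: "\<And>v. v \<in> carrier V \<Longrightarrow> (\<And>i. i \<in> I \<Longrightarrow> \<pi> i v = \<zero>\<^bsub>K\<^esub>) \<Longrightarrow> v \<in> N"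
  shows "inj_on (\<lambda>v. N +>\<^bsub>V\<^esub> v) (x ` I)"
    and "vectorspace.basis K (quotient_module V N) ((\<lambda>v. N +>\<^bsub>V\<^esub> v) ` x ` I)"
proof -
  let ?Q = "quotient_module V N"
  let ?T = "\<lambda>v. N +>\<^bsub>V\<^esub> v"
  interpret V: vectorspace K V using sub by (simp add: subspace_def)
  interpret N: submodule K N V using sub by (simp add: subspace_def)
  interpret Q: vectorspace K ?Q using sub by (rule quotient_module_vectorspace)
  have neg: "\<ominus>\<^bsub>V\<^esub> v \<in> N" if "v \<in> N" for v
    using that N.smult_closed[of "\<ominus>\<^bsub>K\<^esub> \<one>\<^bsub>K\<^esub>" v] N.subset
    by (metis V.R.add.inv_closed V.R.one_closed V.smult_minus_1 subset_iff)
  have "subgroup N (add_monoid V)"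
    by (rule V.add.subgroupI) (use N.subset neg N.zero_closed in \<open>auto simp: a_inv_def[symmetric] simp del: N.zero_closed\<close>)
  then interpret S: abelian_subgroup N V
    by (intro abelian_subgroupI3) (auto simp: additive_subgroup_def V.abelian_group_axioms)
  have coset: "X \<in> carrier ?Q \<longleftrightarrow> (\<exists>v\<in>carrier V. X = ?T v)" for X
    by (auto simp: quotient_module_def A_RCOSETS_def')
  have T_eq: "?T v = ?T w \<longleftrightarrow> v \<ominus>\<^bsub>V\<^esub> w \<in> N" if "v \<in> carrier V" "w \<in> carrier V" for v w
    using that S.a_rcos_module_rev S.a_rcos_module S.a_rcos_self S.a_repr_independence'
    by (metis V.M.minus_eq)
  have T_add: "?T (v \<oplus>\<^bsub>V\<^esub> w) = ?T v \<oplus>\<^bsub>?Q\<^esub> ?T w" if "v \<in> carrier V" "w \<in> carrier V" for v w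
    using that by (simp add: quotient_module_def S.a_rcos_sum)
  have T_smult: "?T (a \<odot>\<^bsub>V\<^esub> v) = a \<odot>\<^bsub>?Q\<^esub> ?T v" if a: "a \<in> carrier K" and v: "v \<in> carrier V" for a v
  proof -
    have "?T (a \<odot>\<^bsub>V\<^esub> w) = ?T (a \<odot>\<^bsub>V\<^esub> v)" if w: "w \<in> ?T v" for w
    proof -
      from w obtain n where n: "n \<in> N" "w = n \<oplus>\<^bsub>V\<^esub> v" by (auto simp: a_r_coset_def')
      have "a \<odot>\<^bsub>V\<^esub> w = a \<odot>\<^bsub>V\<^esub> n \<oplus>\<^bsub>V\<^esub> a \<odot>\<^bsub>V\<^esub> v"
        using n a v N.subset by (auto simp: V.smult_r_distr)
      then have "a \<odot>\<^bsub>V\<^esub> w \<in> ?T (a \<odot>\<^bsub>V\<^esub> v)"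
        using n a by (auto simp: a_r_coset_def')
      then show ?thesis using a v by (metis S.a_repr_independence' V.smult_closed)
    qed
    moreover have "v \<in> ?T v" using v by (rule S.a_rcos_self)
    ultimately have "(\<Union>w\<in>?T v. ?T (a \<odot>\<^bsub>V\<^esub> w)) = ?T (a \<odot>\<^bsub>V\<^esub> v)" by blast
    then show ?thesis by (simp add: quotient_module_def)
  qed
  have T_zero: "?T v = \<zero>\<^bsub>?Q\<^esub> \<longleftrightarrow> v \<in> N" if "v \<in> carrier V" for v
  proof -
    have minus_0: "\<ominus>\<^bsub>V\<^esub> \<zero>\<^bsub>V\<^esub> = \<zero>\<^bsub>V\<^esub>" by (rule V.M.minus_equality) simp_all
    show ?thesis
      using that T_eq[of v "\<zero>\<^bsub>V\<^esub>"] V.M.a_coset_add_zero[OF N.subset]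
      by (simp add: quotient_module_def V.M.minus_eq minus_0)
  qed
  have xV: "x i \<in> carrier V" if "i \<in> I" for i using x that by blast
  define u where "u a = (\<Oplus>\<^bsub>V\<^esub>i\<in>I. a i \<odot>\<^bsub>V\<^esub> x i)" for a
  have u: "u a \<in> carrier V" if "a \<in> I \<rightarrow> carrier K" for a
    unfolding u_def using that xV by (intro V.M.finsum_closed) auto
  have pi_0: "\<pi> i \<zero>\<^bsub>V\<^esub> = \<zero>\<^bsub>K\<^esub>" if "i \<in> I" for i
    using vanish[OF that] by simp
  have pi_u: "\<pi> j (u a) = a j" if a: "a \<in> I \<rightarrow> carrier K" and j: "j \<in> I" for a j
  proof -
    have "F \<subseteq> I \<Longrightarrow> \<pi> j (\<Oplus>\<^bsub>V\<^esub>i\<in>F. a i \<odot>\<^bsub>V\<^esub> x i) = (if j \<in> F then a j else \<zero>\<^bsub>K\<^esub>)" if "finite F" for F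
      using that
    proof (induction F)
      case empty
      then show ?case using pi_0 j by simp
    next
      case (insert k F)
      have F: "(\<lambda>i. a i \<odot>\<^bsub>V\<^esub> x i) \<in> F \<rightarrow> carrier V" and k: "a k \<odot>\<^bsub>V\<^esub> x k \<in> carrier V"
        using insert.prems a xV by auto
      have "\<pi> j (\<Oplus>\<^bsub>V\<^esub>i\<in>insert k F. a i \<odot>\<^bsub>V\<^esub> x i) = a k \<otimes>\<^bsub>K\<^esub> \<pi> j (x k) \<oplus>\<^bsub>K\<^esub> \<pi> j (\<Oplus>\<^bsub>V\<^esub>i\<in>F. a i \<odot>\<^bsub>V\<^esub> x i)"
        using insert.prems insert.hyps F k j a xV by (simp add: V.M.finsum_insert add smult V.M.finsum_closed Pi_iff)
      then show ?case
        using insert.prems insert.hyps insert.IH j a dual[OF j, of k] by (auto simp: Pi_iff)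
    qed
    from this[OF fin] show ?thesis using j by (simp add: u_def)
  qed
  have x_inj: "i = j" if "i \<in> I" "j \<in> I" "?T (x i) = ?T (x j)" for i j
  proof (rule ccontr)
    assume "i \<noteq> j"
    have "(x i \<ominus>\<^bsub>V\<^esub> x j) \<oplus>\<^bsub>V\<^esub> x j = x i" using xV that by (simp add: V.M.minus_eq V.M.a_assoc V.M.l_neg)
    then have "\<pi> i (x i) = \<pi> i (x i \<ominus>\<^bsub>V\<^esub> x j) \<oplus>\<^bsub>K\<^esub> \<pi> i (x j)"
      using add[of i "x i \<ominus>\<^bsub>V\<^esub> x j" "x j"] xV that by simp
    moreover have "\<pi> i (x i \<ominus>\<^bsub>V\<^esub> x j) = \<zero>\<^bsub>K\<^esub>"
      using T_eq[OF xV xV] that vanish by blast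
    ultimately show False using dual[of i i] dual[of i j] that \<open>i \<noteq> j\<close> by simp
  qed
  then show "inj_on ?T (x ` I)" by (auto simp: inj_on_def)
  have inj: "inj_on (\<lambda>i. ?T (x i)) I" using x_inj by (auto simp: inj_on_def)
  have img: "?T ` x ` I = (\<lambda>i. ?T (x i)) ` I" by auto
  have sub_Q: "?T ` x ` I \<subseteq> carrier ?Q" using xV coset by blast
  have lc: "Q.lincomb a (?T ` x ` I) = ?T (u (\<lambda>i. a (?T (x i))))"
    if a: "a \<in> ?T ` x ` I \<rightarrow> carrier K" for a
  proof -
    have aT: "a (?T (x i)) \<in> carrier K" if "i \<in> I" for i
      using a that by (auto simp: Pi_iff)
    have "Q.lincomb a (?T ` x ` I) = (\<Oplus>\<^bsub>?Q\<^esub>i\<in>I. a (?T (x i)) \<odot>\<^bsub>?Q\<^esub> ?T (x i))"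
      unfolding Q.lincomb_def img
      by (rule Q.M.finsum_reindex[OF _ inj]) (use a sub_Q in \<open>auto intro!: Q.smult_closed\<close>)
    also have "\<dots> = (\<Oplus>\<^bsub>?Q\<^esub>i\<in>I. ?T (a (?T (x i)) \<odot>\<^bsub>V\<^esub> x i))"
      by (rule Q.M.finsum_cong') (use a xV in \<open>auto simp: coset T_smult[symmetric] Pi_iff intro!: bexI[of _ "_ \<odot>\<^bsub>V\<^esub> x _"]\<close>)
    also have "\<dots> = ?T (u (\<lambda>i. a (?T (x i))))"
    proof -
      have "F \<subseteq> I \<Longrightarrow> (\<Oplus>\<^bsub>?Q\<^esub>i\<in>F. ?T (a (?T (x i)) \<odot>\<^bsub>V\<^esub> x i)) = ?T (\<Oplus>\<^bsub>V\<^esub>i\<in>F. a (?T (x i)) \<odot>\<^bsub>V\<^esub> x i)"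
        if "finite F" for F using that
      proof (induction F)
        case empty
        have "?T \<zero>\<^bsub>V\<^esub> = \<zero>\<^bsub>?Q\<^esub>" using T_zero[OF V.M.zero_closed] N.zero_closed by blast
        then show ?case by simp
      next
        case (insert k F)
        have *: "a (?T (x i)) \<odot>\<^bsub>V\<^esub> x i \<in> carrier V" if "i \<in> insert k F" for i
          using aT[of i] xV[of i] that insert.prems by (intro V.smult_closed) auto
        then have **: "?T (a (?T (x i)) \<odot>\<^bsub>V\<^esub> x i) \<in> carrier ?Q" if "i \<in> insert k F" for i
          using that coset by blast
        have F: "(\<lambda>i. a (?T (x i)) \<odot>\<^bsub>V\<^esub> x i) \<in> F \<rightarrow> carrier V"
          "(\<lambda>i. ?T (a (?T (x i)) \<odot>\<^bsub>V\<^esub> x i)) \<in> F \<rightarrow> carrier ?Q"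
          using * ** by blast+
        show ?case
          unfolding V.M.finsum_insert[OF insert.hyps F(1) *[OF insertI1]]
            Q.M.finsum_insert[OF insert.hyps F(2) **[OF insertI1]]
            T_add[OF *[OF insertI1] V.M.finsum_closed[OF F(1)]]
          using insert.IH insert.prems by simp
      qed
      from this[OF fin] show ?thesis by (simp add: u_def)
    qed
    finally show ?thesis .
  qed
  have finT: "finite (?T ` x ` I)" using fin by simp
  show "Q.basis (?T ` x ` I)"
    unfolding Q.basis_def
  proof (intro conjI sub_Q)
    show "Q.lin_indpt (?T ` x ` I)"
    proof (rule Q.finite_lin_indpt2[OF finT sub_Q])
      fix a assume a: "a \<in> ?T ` x ` I \<rightarrow> carrier K" and 0: "Q.lincomb a (?T ` x ` I) = \<zero>\<^bsub>?Q\<^esub>"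
      let ?a = "\<lambda>i. a (?T (x i))"
      have a': "?a \<in> I \<rightarrow> carrier K" using a by auto
      have "u ?a \<in> N" using 0 lc[OF a] T_zero[OF u[OF a']] by simp
      then have "?a j = \<zero>\<^bsub>K\<^esub>" if "j \<in> I" for j
        using pi_u[OF a' that] vanish[OF that] by simp
      then show "\<forall>v\<in>?T ` x ` I. a v = \<zero>\<^bsub>K\<^esub>" by auto
    qed
    have "X \<in> Q.span (?T ` x ` I)" if "X \<in> carrier ?Q" for X
    proof -
      from that[unfolded coset] obtain v where v: "v \<in> carrier V" "X = ?T v" ..
      let ?a = "\<lambda>i. \<pi> i v"
      have a: "?a \<in> I \<rightarrow> carrier K" using closed v by auto
      have diff: "v \<ominus>\<^bsub>V\<^esub> u ?a \<in> carrier V" using v u[OF a] by simp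
      have "\<pi> i (v \<ominus>\<^bsub>V\<^esub> u ?a) = \<zero>\<^bsub>K\<^esub>" if i: "i \<in> I" for i
      proof -
        have "(v \<ominus>\<^bsub>V\<^esub> u ?a) \<oplus>\<^bsub>V\<^esub> u ?a = v"
          using v u[OF a] by (simp add: V.M.minus_eq V.M.a_assoc V.M.l_neg)
        then have "\<pi> i v = \<pi> i (v \<ominus>\<^bsub>V\<^esub> u ?a) \<oplus>\<^bsub>K\<^esub> \<pi> i v"
          using add[OF i diff u[OF a]] pi_u[OF a i] by metis
        then show ?thesis
          using closed[OF i v(1)] closed[OF i diff] V.R.add.r_cancel_one' by blast
      qed
      then have "v \<ominus>\<^bsub>V\<^esub> u ?a \<in> N" using separate diff by blast
      then have X: "X = ?T (u ?a)" using T_eq[OF v(1) u[OF a]] v by simp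
      define b where "b = (\<lambda>Y. \<pi> (inv_into I (\<lambda>i. ?T (x i)) Y) v)"
      have b: "b (?T (x i)) = \<pi> i v" if "i \<in> I" for i
        using inv_into_f_f[OF inj that] by (simp add: b_def)
      then have b': "b \<in> ?T ` x ` I \<rightarrow> carrier K" using closed v by auto
      have "u (\<lambda>i. b (?T (x i))) = u ?a" unfolding u_def
        by (rule V.M.finsum_cong') (use a xV b in auto)
      then have "X = Q.lincomb b (?T ` x ` I)" using lc[OF b'] X by simp
      then show ?thesis unfolding Q.span_def using finT b' by blast
    qed
    then show "Q.span (?T ` x ` I) = carrier ?Q"
      using Q.span_is_subset2[OF sub_Q] by blast
  qed
qed

section \<open>Coordinates and the symplectic form\<close>

text \<open>
  The form \<open>\<beta>\<close> with \<open>[g, h] = \<beta>(g, h) z\<close>; it ignores the coefficient of \<open>z\<close>.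
\<close>

definition symp :: "nat \<Rightarrow> ('a::field) hvec \<Rightarrow> 'a hvec \<Rightarrow> 'a" where
  "symp m g h = (\<Sum>i=1..m. g i * h (m+i) - g (m+i) * h i)"

abbreviation ctr :: "nat \<Rightarrow> ('a::field) hvec" where
  "ctr m \<equiv> bas (2*m+1)"

text \<open>
  The sign of the pairing of a basis vector with its conjugate: \<open>\<beta>(e\<^sub>i, e\<^bsub>i'\<^esub>)\<close>.
\<close>

definition half_sign :: "nat \<Rightarrow> nat \<Rightarrow> 'a::field" where
  "half_sign m i = (if i \<le> m then 1 else - 1)"

lemma hbr_symp: "hbr m g h = symp m g h *\<^sub>h ctr m"
  by (simp add: hbr_def symp_def)

lemma prm_simps [simp]:
  assumes "i \<in> {1..2*m}"
  shows "prm m i \<in> {1..2*m}" "prm m (prm m i) = i" "half_sign m (prm m i) = - half_sign m i" "prm m i \<noteq> i"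
    "prm m i \<le> m \<longleftrightarrow> \<not> i \<le> m" "Suc 0 \<le> prm m i" "prm m i \<le> 2 * m"
  using assms by (auto simp: prm_def half_sign_def)

lemma half_sign_square [simp]: "half_sign m i * half_sign m i = 1" "half_sign m i * (half_sign m i * x) = x"
  by (simp_all add: half_sign_def)

lemma prm_eq_iff:
  "i \<in> {1..2*m} \<Longrightarrow> j \<in> {1..2*m} \<Longrightarrow> prm m i = prm m j \<longleftrightarrow> i = j"
  by (metis prm_simps(2))

lemma bas_apply: "bas i k = (if k = i then 1 else 0)"
  by (simp add: bas_def)

lemma bas_heis [simp]: "i \<in> {1..2*m+1} \<Longrightarrow> bas i \<in> heis m"
  by (auto simp: heis_def bas_def)

lemma symp_bas [simp]:
  assumes "i \<in> {1..2*m}"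
  shows "symp m (bas i) h = half_sign m i * h (prm m i)"
    and "symp m h (bas i) = - (half_sign m i * h (prm m i))"
proof -
  have lo: "(\<Sum>k=1..m. (if k = i then f k else 0)) = (if i \<le> m then f i else 0)" for f :: "nat \<Rightarrow> 'a"
    using assms by (auto simp: sum.delta)
  have hi: "(\<Sum>k=1..m. (if m + k = i then f k else 0)) = (if i \<le> m then 0 else f (i - m))" for f :: "nat \<Rightarrow> 'a"
  proof -
    have "(\<Sum>k=1..m. (if m + k = i then f k else 0)) = (\<Sum>k=1..m. (if k = i - m then (if m < i then f k else 0) else 0))"
      by (rule sum.cong) auto
    also have "\<dots> = (if i \<le> m then 0 else f (i - m))" using assms by (auto simp: sum.delta)
    finally show ?thesis .
  qed
  have "symp m (bas i) h = (\<Sum>k=1..m. (if k = i then h (m + k) else 0)) - (\<Sum>k=1..m. (if m + k = i then h k else 0))"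
    unfolding symp_def sum_subtractf[symmetric] by (rule sum.cong) (auto simp: bas_def)
  then show 1: "symp m (bas i) h = half_sign m i * h (prm m i)"
    using assms by (simp only: lo hi) (auto simp: half_sign_def prm_def add.commute)
  have "symp m h (bas i) = - symp m (bas i) h"
    by (simp add: symp_def sum_negf[symmetric] mult.commute)
  then show "symp m h (bas i) = - (half_sign m i * h (prm m i))" using 1 by simp
qed

lemma symp_ctr [simp]: "symp m (bas (Suc (2*m))) h = 0" "symp m h (bas (Suc (2*m))) = 0"
  by (auto simp: symp_def bas_def intro!: sum.neutral)

lemma symp_scal [simp]: "symp m (a *\<^sub>h g) h = a * symp m g h" "symp m g (a *\<^sub>h h) = a * symp m g h"
  by (simp_all add: symp_def scal_def sum_distrib_left algebra_simps)

lemma symp_add: "symp m (g + g') h = symp m g h + symp m g' h" "symp m g (h + h') = symp m g h + symp m g h'"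
  by (simp_all add: symp_def sum.distrib[symmetric] algebra_simps)

lemma symp_diff: "symp m (g - g') h = symp m g h - symp m g' h" "symp m g (h - h') = symp m g h - symp m g h'"
  by (simp_all add: symp_def sum_subtractf[symmetric] algebra_simps)

lemma symp_0 [simp]: "symp m 0 h = 0" "symp m h 0 = 0"
  by (simp_all add: symp_def)

lemma heis_expand:
  assumes "g \<in> heis m"
  shows "g = (\<Sum>i=1..2*m+1. g i *\<^sub>h bas i)"
proof
  fix k
  have ap: "(\<Sum>i\<in>A. f i) k = (\<Sum>i\<in>A. f i k)" if "finite A" for A and f :: "nat \<Rightarrow> 'a hvec"
    using that by (induction A) auto
  have "(\<Sum>i=1..2*m+1. g i *\<^sub>h bas i) k = (\<Sum>i=1..2*m+1. if i = k then g k else 0)"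
    unfolding ap[OF finite_atLeastAtMost] by (rule sum.cong) (auto simp: scal_def bas_def)
  also have "\<dots> = g k" using assms by (auto simp: heis_def)
  finally show "g k = (\<Sum>i=1..2*m+1. g i *\<^sub>h bas i) k" by simp
qed

lemma linear_heis_expand:
  assumes f: "linear_heis m f" and g: "g \<in> heis m"
  shows "f g = (\<Sum>i=1..2*m+1. g i *\<^sub>h f (bas i))"
proof -
  have scal: "f (a *\<^sub>h h) = a *\<^sub>h f h" if "h \<in> heis m" for a h
    using f that by (auto simp: linear_heis_def)
  have f0: "f 0 = 0" using scal[of 0 0] by simp
  have "A \<subseteq> {1..2*m+1} \<Longrightarrow> f (\<Sum>i\<in>A. g i *\<^sub>h bas i) = (\<Sum>i\<in>A. g i *\<^sub>h f (bas i)) \<and> (\<Sum>i\<in>A. g i *\<^sub>h bas i) \<in> heis m"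
    if "finite A" for A using that
  proof (induction A)
    case (insert x A)
    have x: "g x *\<^sub>h bas x \<in> heis m" "bas x \<in> heis m" and A: "(\<Sum>i\<in>A. g i *\<^sub>h bas i) \<in> heis m"
      using insert by auto
    then have "f (g x *\<^sub>h bas x + (\<Sum>i\<in>A. g i *\<^sub>h bas i)) = f (g x *\<^sub>h bas x) + f (\<Sum>i\<in>A. g i *\<^sub>h bas i)"
      using f unfolding linear_heis_def by blast
    then show ?case
      using insert.IH insert.prems scal[OF x(2)] heis_closed(2)[OF x(1) A]
      by (simp only: sum.insert[OF insert.hyps]) simp
  qed (simp add: f0)
  from this[of "{1..2*m+1}"] show ?thesis using heis_expand[OF g] by simp
qed

lemma linear_heis_eq_0:
  assumes "linear_heis m f" "g \<in> heis m" "\<And>i. i \<in> {1..2*m+1} \<Longrightarrow> f (bas i) = 0"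
  shows "f g = 0"
  using linear_heis_expand[OF assms(1,2)] assms(3) by simp

lemma C2D:
  assumes "\<phi> \<in> C2 m"
  shows "g \<in> heis m \<Longrightarrow> linear_heis m (\<phi> g)"
    "h \<in> heis m \<Longrightarrow> linear_heis m (\<lambda>g. \<phi> g h)"
    "g \<in> heis m \<Longrightarrow> \<phi> g g = 0"
    "g \<in> heis m \<Longrightarrow> h \<in> heis m \<Longrightarrow> \<phi> g h \<in> heis m"
    "g \<in> heis m \<Longrightarrow> h \<in> heis m \<Longrightarrow> k \<in> heis m \<Longrightarrow> \<phi> g (h + k) = \<phi> g h + \<phi> g k"
    "g \<in> heis m \<Longrightarrow> h \<in> heis m \<Longrightarrow> k \<in> heis m \<Longrightarrow> \<phi> (h + k) g = \<phi> h g + \<phi> k g"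
    "g \<in> heis m \<Longrightarrow> h \<in> heis m \<Longrightarrow> \<phi> g (a *\<^sub>h h) = a *\<^sub>h \<phi> g h"
    "g \<in> heis m \<Longrightarrow> h \<in> heis m \<Longrightarrow> \<phi> (a *\<^sub>h g) h = a *\<^sub>h \<phi> g h"
    "g \<notin> heis m \<or> h \<notin> heis m \<Longrightarrow> \<phi> g h = 0"
    "g \<in> heis m \<Longrightarrow> \<phi> g 0 = 0" "g \<in> heis m \<Longrightarrow> \<phi> 0 g = 0"
proof -
  show "g \<in> heis m \<Longrightarrow> linear_heis m (\<phi> g)" "h \<in> heis m \<Longrightarrow> linear_heis m (\<lambda>g. \<phi> g h)"
    using assms by (auto simp: C2_def)
  note iff = assms[unfolded C2_iff]
  show "g \<in> heis m \<Longrightarrow> \<phi> g g = 0"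
    "g \<in> heis m \<Longrightarrow> h \<in> heis m \<Longrightarrow> \<phi> g h \<in> heis m"
    "g \<in> heis m \<Longrightarrow> h \<in> heis m \<Longrightarrow> k \<in> heis m \<Longrightarrow> \<phi> g (h + k) = \<phi> g h + \<phi> g k"
    "g \<in> heis m \<Longrightarrow> h \<in> heis m \<Longrightarrow> k \<in> heis m \<Longrightarrow> \<phi> (h + k) g = \<phi> h g + \<phi> k g"
    "g \<notin> heis m \<or> h \<notin> heis m \<Longrightarrow> \<phi> g h = 0"
    using iff by auto
  show *: "\<phi> g (a *\<^sub>h h) = a *\<^sub>h \<phi> g h" if "g \<in> heis m" "h \<in> heis m" for g h a using iff that by auto
  show **: "\<phi> (a *\<^sub>h g) h = a *\<^sub>h \<phi> g h" if "g \<in> heis m" "h \<in> heis m" for g h a using iff that by auto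
  show "g \<in> heis m \<Longrightarrow> \<phi> g 0 = 0" using *[of g 0 0] by simp
  show "g \<in> heis m \<Longrightarrow> \<phi> 0 g = 0" using **[of 0 g 0] by simp
qed

lemma C2_anti:
  assumes "\<phi> \<in> C2 m" "g \<in> heis m" "h \<in> heis m"
  shows "\<phi> h g = - \<phi> g h"
proof -
  have "\<phi> (g + h) (g + h) = (\<phi> g g + \<phi> h g) + (\<phi> g h + \<phi> h h)"
    using assms by (simp only: C2D(5,6)[OF assms(1)] heis_closed)
  then have "\<phi> g h + \<phi> h g = 0"
    using assms C2D(3)[OF assms(1)] by (simp add: add.commute)
  then show ?thesis by (simp add: add_eq_0_iff)
qed

lemma C2_eq_0:
  assumes \<phi>: "\<phi> \<in> C2 m" and 0: "\<And>i j. i \<in> {1..2*m+1} \<Longrightarrow> j \<in> {1..2*m+1} \<Longrightarrow> \<phi> (bas i) (bas j) = 0"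
  shows "\<phi> = 0"
proof (intro ext)
  fix g h k
  have "\<phi> g h = 0"
  proof (cases "g \<in> heis m \<and> h \<in> heis m")
    case True
    have "\<phi> (bas i) h = 0" if "i \<in> {1..2*m+1}" for i
      using linear_heis_eq_0[OF C2D(1)[OF \<phi>, of "bas i"]] 0 that True by simp
    then show ?thesis
      using linear_heis_eq_0[OF C2D(2)[OF \<phi>, of h]] True by simp
  qed (use C2D(9)[OF \<phi>] in auto)
  then show "\<phi> g h k = 0 g h k" by simp
qed

section \<open>Normalised cocycles\<close>

text \<open>
  Essentially cocycles \<open>\<Lambda>\<^sup>2 V \<rightarrow> V\<close>. For \<open>m > 1\<close> and characteristic other than 2, each cohomology class
  contains exactly one of them, so that they replace the quotient by coboundaries.
\<close>

definition normal_cocycles :: "nat \<Rightarrow> ('a::field) cochain2 set" where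
  "normal_cocycles m = {\<phi> \<in> C2 m. d2 m \<phi> = 0 \<and> (\<forall>g\<in>heis m. \<phi> g (ctr m) = 0) \<and>
     (\<forall>g\<in>heis m. \<forall>h\<in>heis m. \<phi> g h (2*m+1) = 0)}"

lemma normal_cocyclesD:
  assumes "\<phi> \<in> normal_cocycles m"
  shows "\<phi> \<in> C2 m" "d2 m \<phi> = 0" "g \<in> heis m \<Longrightarrow> \<phi> g (ctr m) = 0" "g \<in> heis m \<Longrightarrow> \<phi> (ctr m) g = 0"
    "g \<in> heis m \<Longrightarrow> h \<in> heis m \<Longrightarrow> \<phi> g h (2*m+1) = 0"
    "\<phi> g (hbr m h k) = 0" "\<phi> (hbr m h k) g = 0"
proof -
  show \<phi>: "\<phi> \<in> C2 m" and "d2 m \<phi> = 0" and r: "\<And>g. g \<in> heis m \<Longrightarrow> \<phi> g (ctr m) = 0"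
    and "g \<in> heis m \<Longrightarrow> h \<in> heis m \<Longrightarrow> \<phi> g h (2*m+1) = 0"
    using assms by (auto simp: normal_cocycles_def)
  show l: "\<And>g. g \<in> heis m \<Longrightarrow> \<phi> (ctr m) g = 0"
    using C2_anti[OF \<phi> _ bas_heis] r by simp
  show "\<phi> g (hbr m h k) = 0" "\<phi> (hbr m h k) g = 0"
    using r l C2D(7,8,9)[OF \<phi>] by (cases "g \<in> heis m"; simp add: hbr_symp)+
qed

text \<open>
  Brackets inside the arguments of \<open>\<phi>\<close> are multiples of \<open>z\<close> and contribute nothing; only the outer
  brackets of the cocycle identity survive.
\<close>

lemma normal_cocycle_cyclic:
  assumes \<phi>: "\<phi> \<in> normal_cocycles m" and "g \<in> heis m" "h \<in> heis m" "k \<in> heis m"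
  shows "symp m g (\<phi> h k) - symp m h (\<phi> g k) + symp m k (\<phi> g h) = 0"
proof -
  have "d2 m \<phi> g h k = (symp m g (\<phi> h k) - symp m h (\<phi> g k) + symp m k (\<phi> g h)) *\<^sub>h ctr m"
    using assms by (simp add: d2_def ext3_def normal_cocyclesD[OF \<phi>]) (simp add: hbr_symp scal_def fun_eq_iff algebra_simps)
  moreover have "d2 m \<phi> g h k (2*m+1) = 0" using normal_cocyclesD(2)[OF \<phi>] by simp
  ultimately show ?thesis by (simp add: scal_def bas_def)
qed

lemma normal_cocycleI:
  assumes \<phi>: "\<phi> \<in> C2 m" and ctr: "\<And>g. g \<in> heis m \<Longrightarrow> \<phi> g (ctr m) = 0"
    and top: "\<And>g h. g \<in> heis m \<Longrightarrow> h \<in> heis m \<Longrightarrow> \<phi> g h (2*m+1) = 0"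
    and cyc: "\<And>g h k. g \<in> heis m \<Longrightarrow> h \<in> heis m \<Longrightarrow> k \<in> heis m \<Longrightarrow>
       symp m g (\<phi> h k) - symp m h (\<phi> g k) + symp m k (\<phi> g h) = 0"
  shows "\<phi> \<in> normal_cocycles m"
proof -
  have "d2 m \<phi> g h k = 0" for g h k
  proof (cases "g \<in> heis m \<and> h \<in> heis m \<and> k \<in> heis m")
    case True
    have l: "\<phi> (hbr m x y) w = 0" if "w \<in> heis m" for x y w
      using that ctr C2_anti[OF \<phi> _ bas_heis, of w] by (simp add: hbr_symp C2D[OF \<phi>])
    have "d2 m \<phi> g h k = (symp m g (\<phi> h k) - symp m h (\<phi> g k) + symp m k (\<phi> g h)) *\<^sub>h ctr m"
      using True by (simp add: d2_def ext3_def l) (simp add: hbr_symp scal_def fun_eq_iff algebra_simps)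
    then show ?thesis using cyc True by simp
  qed (auto simp: d2_def ext3_def)
  then have "d2 m \<phi> = 0" by (simp add: fun_eq_iff)
  then show ?thesis using assms by (simp add: normal_cocycles_def)
qed

lemma symp_bas_bas:
  assumes "i \<in> {1..2*m}" "j \<in> {1..2*m}"
  shows "symp m (bas i) (bas j) = (if j = prm m i then half_sign m i else 0)"
  using assms by (subst symp_bas(1)) (auto simp: bas_apply)

text \<open>
  Since \<open>m > 1\<close>, some conjugate pair \<open>e\<^sub>j, e\<^bsub>j'\<^esub>\<close> commutes with \<open>e\<^sub>i\<close>. In the cocycle identity for
  \<open>e\<^sub>j, e\<^bsub>j'\<^esub>, e\<^sub>i\<close> the three outer brackets are central and two of the inner ones vanish, so the
  remaining term \<open>\<phi>(z, e\<^sub>i)\<close> is central too.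
\<close>

lemma cocycle_center_is_central:
  assumes \<phi>: "(\<phi> :: 'a::field cochain2) \<in> C2 m" "d2 m \<phi> = 0" and m: "m > 1" and i: "i \<in> {1..2*m}" and k: "k \<noteq> 2*m+1"
  shows "\<phi> (bas i) (ctr m) k = 0"
proof -
  \<comment> \<open>one of the first two indices, chosen outside the conjugate pair of \<open>i\<close>\<close>
  define j :: nat where "j = (if i = 1 \<or> i = m + 1 then 2 else 1)"
  have j: "j \<in> {1..2*m}" "j + m \<in> {1..2*m}" "i \<noteq> j" "i \<noteq> prm m j" "prm m j = j + m" "prm m (j + m) = j" "j \<le> m"
    using m i by (auto simp: j_def prm_def)
  have hb: "(bas i :: 'a hvec) \<in> heis m" "(bas j :: 'a hvec) \<in> heis m" "(bas (j + m) :: 'a hvec) \<in> heis m"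
    "(ctr m :: 'a hvec) \<in> heis m"
    using i j by auto
  have br: "hbr m (bas j) (bas (j+m)) = (ctr m :: 'a hvec)" "hbr m (bas j) (bas i) = (0 :: 'a hvec)"
    "hbr m (bas (j+m)) (bas i) = (0 :: 'a hvec)"
    using i j by (simp_all add: hbr_symp symp_bas_bas half_sign_def del: symp_bas)
  have "d2 m \<phi> (bas j) (bas (j+m)) (bas i) k = - \<phi> (ctr m) (bas i) k"
    using hb k unfolding d2_def ext3_def
    by (simp add: br C2D[OF \<phi>(1)]) (simp add: hbr_symp scal_def bas_apply)
  then show ?thesis using \<phi>(2) C2_anti[OF \<phi>(1) hb(4,1)] by simp
qed

text \<open>
  The 1-cochain \<open>\<psi>\<close> with \<open>[g, \<psi>(h)] = \<phi>(g, h)\<^sub>z z\<close> if \<open>h = z\<close>, and half of that for \<open>h \<in> V\<close>; it exists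
  because \<open>\<beta>\<close> is nondegenerate. For \<open>h \<in> V\<close> the coboundary collects this term twice, once from each
  argument, which is the reason for the factor \<open>1/2\<close>. The argument \<open>(h + h\<^sub>z z)/2\<close> combines the two
  cases into one linear expression.
\<close>

definition gauge :: "nat \<Rightarrow> ('a::field) cochain2 \<Rightarrow> 'a cochain1" where
  "gauge m \<phi> = ext1 m (\<lambda>h k. if k \<in> {1..2*m}
     then half_sign m (prm m k) * \<phi> (bas (prm m k)) ((1/2) *\<^sub>h (h + h (2*m+1) *\<^sub>h ctr m)) (2*m+1) else 0)"

lemma gauge_C1:
  assumes \<phi>: "\<phi> \<in> C2 m"
  shows "gauge m \<phi> \<in> C1 m"
proof (rule C1I)
  have E: "bas (prm m k) \<in> heis m" if "k \<in> {1..2*m}" for k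
    using prm_simps(1)[OF that] by auto
  have c: "ctr m \<in> heis m" by simp
  fix g :: "'a hvec" assume g: "g \<in> heis m"
  show "gauge m \<phi> g \<in> heis m" using g by (auto simp: gauge_def ext1_def heis_def)
  show "gauge m \<phi> (a *\<^sub>h g) = a *\<^sub>h gauge m \<phi> g" for a
  proof -
    have "(1/2) *\<^sub>h (a *\<^sub>h g + (a *\<^sub>h g) (2*m+1) *\<^sub>h ctr m) = a *\<^sub>h (1/2) *\<^sub>h (g + g (2*m+1) *\<^sub>h ctr m)"
      by (simp add: scal_def fun_eq_iff algebra_simps)
    then have "\<phi> (bas (prm m k)) ((1/2) *\<^sub>h (a *\<^sub>h g + (a *\<^sub>h g) (2*m+1) *\<^sub>h ctr m))
       = a *\<^sub>h \<phi> (bas (prm m k)) ((1/2) *\<^sub>h (g + g (2*m+1) *\<^sub>h ctr m))" if "k \<in> {1..2*m}" for k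
      by (simp only: C2D(7)[OF \<phi> E[OF that]] heis_closed g c)
    then show ?thesis
      using g unfolding gauge_def ext1_def by (simp add: fun_eq_iff) (simp add: scal_def)
  qed
  fix h :: "'a hvec" assume h: "h \<in> heis m"
  show "gauge m \<phi> (g + h) = gauge m \<phi> g + gauge m \<phi> h"
  proof -
    have "(1/2) *\<^sub>h ((g + h) + (g + h) (2*m+1) *\<^sub>h ctr m) = (1/2) *\<^sub>h (g + g (2*m+1) *\<^sub>h ctr m) + (1/2) *\<^sub>h (h + h (2*m+1) *\<^sub>h ctr m)"
      by (simp add: scal_def fun_eq_iff algebra_simps)
    then have "\<phi> (bas (prm m k)) ((1/2) *\<^sub>h ((g + h) + (g + h) (2*m+1) *\<^sub>h ctr m))
       = \<phi> (bas (prm m k)) ((1/2) *\<^sub>h (g + g (2*m+1) *\<^sub>h ctr m)) + \<phi> (bas (prm m k)) ((1/2) *\<^sub>h (h + h (2*m+1) *\<^sub>h ctr m))" if "k \<in> {1..2*m}" for k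
      by (simp only: C2D(5)[OF \<phi> E[OF that]] heis_closed g h c)
    then show ?thesis
      using g h unfolding gauge_def ext1_def by (simp add: fun_eq_iff algebra_simps)
  qed
next
  fix g :: "'a hvec" assume "g \<notin> heis m" then show "gauge m \<phi> g = 0" by (simp add: gauge_def ext1_def)
qed

lemma gauge_bas:
  assumes \<phi>: "\<phi> \<in> C2 m" and two: "(2::'a::field) \<noteq> 0" and i: "i \<in> {1..2*m}"
  shows "hbr m (bas i) (gauge m \<phi> (ctr m)) = \<phi> (bas i) (ctr m) (2*m+1) *\<^sub>h (ctr m :: 'a hvec)"
    and "j \<in> {1..2*m} \<Longrightarrow> hbr m (bas i) (gauge m \<phi> (bas j)) = (1/2 * \<phi> (bas i) (bas j) (2*m+1)) *\<^sub>h ctr m"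
proof -
  have p: "prm m i \<in> {1..2*m}" using i by simp
  have "(1/2) *\<^sub>h (ctr m + ctr m (2*m+1) *\<^sub>h ctr m) = (ctr m :: 'a hvec)"
    using two by (auto simp: fun_eq_iff scal_def bas_apply field_simps)
  then show "hbr m (bas i) (gauge m \<phi> (ctr m)) = \<phi> (bas i) (ctr m) (2*m+1) *\<^sub>h (ctr m :: 'a hvec)"
    using i p by (simp add: hbr_symp gauge_def ext1_def)
  assume j: "j \<in> {1..2*m}"
  have "(1/2) *\<^sub>h (bas j + bas j (2*m+1) *\<^sub>h ctr m) = (1/2) *\<^sub>h (bas j :: 'a hvec)"
    using j by (auto simp: fun_eq_iff scal_def bas_apply)
  then show "hbr m (bas i) (gauge m \<phi> (bas j)) = (1/2 * \<phi> (bas i) (bas j) (2*m+1)) *\<^sub>h ctr m"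
    using i j p C2D(7)[OF \<phi>, of "bas i" "bas j" "1/2"]
    by (simp add: hbr_symp gauge_def ext1_def) (simp add: scal_def)
qed

lemma d2_d1:
  assumes "CHAR('a::field) = p" "p > 2" "\<psi> \<in> C1 m"
  shows "d2 m (- d1 m (\<psi> :: 'a cochain1)) = 0"
  using d2_star_d1_star[OF assms, of undefined] by (simp add: d2_star_def d1_star_def zero_prod_def)

lemma d2_add: "d2 m (\<phi> + \<phi>') = d2 m \<phi> + d2 m \<phi>'"
  using d2_star_linear(1)[of m undefined undefined "(\<phi>, undefined)" "(\<phi>', undefined)"]
  by (simp add: d2_star_def)

lemma two_neq_0: "CHAR('a::field) > 2 \<Longrightarrow> (2::'a) \<noteq> 0"
  using of_nat_eq_0_iff_char_dvd[of 2, where 'a='a] by (auto dest: dvd_imp_le)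

text \<open>
  It suffices to check the values on pairs of basis vectors. Those at \<open>(e\<^sub>i, z)\<close> are central by
  \<open>cocycle_center_is_central\<close>, so the gauge term cancels them completely.
\<close>

lemma gauge_normalizes:
  assumes \<phi>: "(\<phi> :: 'a::field cochain2) \<in> C2 m" "d2 m \<phi> = 0" and m: "m > 1" and p: "CHAR('a) = p" "p > 2"
  shows "\<phi> + - d1 m (gauge m \<phi>) \<in> normal_cocycles m"
proof -
  let ?\<psi> = "gauge m \<phi>" and ?\<phi> = "\<phi> + - d1 m (gauge m \<phi>)"
  have two: "(2::'a) \<noteq> 0" using two_neq_0 p by auto
  note g = gauge_bas[OF \<phi>(1) two]
  note \<psi> = gauge_C1[OF \<phi>(1)]
  have C: "?\<phi> \<in> C2 m" using \<phi>(1) d1_in_C2[OF \<psi>] by (intro C2_closed) auto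
  have c: "ctr m \<in> heis m" by simp
  have top: "?\<psi> h (2*m+1) = 0" for h by (auto simp: gauge_def ext1_def)
  have ctr_bas: "?\<phi> (bas i) (ctr m) = 0" if i: "i \<in> {1..2*m+1}" for i
  proof (cases "i = 2*m+1")
    case True
    then show ?thesis using C2D(3)[OF C c] by simp
  next
    case False
    then have i': "i \<in> {1..2*m}" using i by auto
    have "\<phi> (bas i) (ctr m) = \<phi> (bas i) (ctr m) (2*m+1) *\<^sub>h ctr m"
      using cocycle_center_is_central[OF \<phi> m i'] by (auto simp: fun_eq_iff scal_def bas_apply)
    moreover have "d1 m ?\<psi> (bas i) (ctr m) = hbr m (bas i) (?\<psi> (ctr m))"
      using i c C1D(4)[OF \<psi>] by (simp add: d1_apply) (simp add: hbr_symp C1D(4)[OF \<psi>])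
    ultimately show ?thesis using g(1)[OF i'] by simp
  qed
  have ctr: "?\<phi> h (ctr m) = 0" if "h \<in> heis m" for h
    using linear_heis_eq_0[OF C2D(2)[OF C c] that] ctr_bas by simp
  have top_bas: "?\<phi> (bas i) (bas j) (2*m+1) = 0" if i: "i \<in> {1..2*m+1}" and j: "j \<in> {1..2*m+1}" for i j
  proof (cases "i = 2*m+1 \<or> j = 2*m+1")
    case True
    then show ?thesis using ctr[of "bas i"] ctr[of "bas j"] C2_anti[OF C c, of "bas j"] i j by auto
  next
    case False
    then have i': "i \<in> {1..2*m}" and j': "j \<in> {1..2*m}" using i j by auto
    have b: "(bas i :: 'a hvec) \<in> heis m" "(bas j :: 'a hvec) \<in> heis m" using i j by auto
    have anti: "\<phi> (bas j) (bas i) = - \<phi> (bas i) (bas j)" using C2_anti[OF \<phi>(1)] b by blast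
    have "?\<psi> (hbr m (bas i) (bas j)) (2*m+1) = 0" by (rule top)
    then show ?thesis
      using b by (simp add: d1_apply g(2)[OF i' j'] g(2)[OF j' i'] anti)
        (simp add: scal_def bas_apply two field_simps)
  qed
  have top': "?\<phi> h k (2*m+1) = 0" if "h \<in> heis m" "k \<in> heis m" for h k
  proof -
    have sum0: "(\<Sum>i\<in>A. f i) k = (\<Sum>i\<in>A. f i k)" if "finite A" for A and f :: "nat \<Rightarrow> 'a hvec" and k
      using that by (induction A) auto
    have 1: "?\<phi> (bas i) k (2*m+1) = 0" if "i \<in> {1..2*m+1}" for i
      unfolding linear_heis_expand[OF C2D(1)[OF C bas_heis[OF that]] \<open>k \<in> heis m\<close>] sum0[OF finite_atLeastAtMost]
      using top_bas[OF that] by (auto simp: scal_def intro!: sum.neutral)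
    show ?thesis
      unfolding linear_heis_expand[OF C2D(2)[OF C \<open>k \<in> heis m\<close>] \<open>h \<in> heis m\<close>] sum0[OF finite_atLeastAtMost]
      using 1 by (auto simp: scal_def intro!: sum.neutral)
  qed
  have "d2 m ?\<phi> = 0" using \<phi>(2) d2_d1[OF p \<psi>] by (simp add: d2_add del: add_uminus_conv_diff)
  then show ?thesis using C ctr top' by (simp add: normal_cocycles_def)
qed

section \<open>The pivot triples indexing the cocycles\<close>

text \<open>
  Among three distinct indices, \<open>d\<close> is the marked one. The four alternatives are the index sets
  occurring in the definition of \<open>A\<^sub>m\<close>: for a set containing a conjugate pair, \<open>d\<close> is the third
  index; for a set contained in one half, \<open>d\<close> is extremal; for a set meeting both halves without a
  conjugate pair, \<open>d\<close> is the one that is alone in its half. The coordinate \<open>T(r, t, d)\<close> is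
  the one that both elements of \<open>A\<^sub>m\<close> attached to the set have in common.
\<close>

definition shared :: "nat \<Rightarrow> nat \<Rightarrow> nat \<Rightarrow> nat \<Rightarrow> bool" where
  "shared m d r t \<longleftrightarrow> {d, r, t} \<subseteq> {1..2*m} \<and> d \<noteq> r \<and> d \<noteq> t \<and> r \<noteq> t \<and>
     (r = prm m t
      \<or> {d, r, t} \<subseteq> {1..m} \<and> d < r \<and> d < t
      \<or> {d, r, t} \<subseteq> {m+1..2*m} \<and> r < d \<and> t < d
      \<or> ({r, t} \<subseteq> {1..m} \<and> d \<in> {m+1..2*m} \<or> {r, t} \<subseteq> {m+1..2*m} \<and> d \<in> {1..m}) \<and> d \<noteq> prm m r \<and> d \<noteq> prm m t)"

lemma shared_distinct: "shared m d r t \<Longrightarrow> d \<noteq> r \<and> d \<noteq> t \<and> r \<noteq> t"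
  by (simp add: shared_def)

lemma shared_sym: "shared m d r t \<longleftrightarrow> shared m d t r"
  unfolding shared_def by (auto simp: prm_def)

lemma shared_unique: "shared m d r t \<Longrightarrow> \<not> shared m r d t"
  unfolding shared_def prm_def by (auto split: if_splits)

text \<open>
  Together with \<open>shared_unique\<close>: every three-element set of indices has exactly one marked element.
\<close>

lemma shared_exists:
  assumes rg: "{a, b, c} \<subseteq> {1..2*m}" and ne: "a \<noteq> b" "a \<noteq> c" "b \<noteq> c"
  shows "shared m a b c \<or> shared m b a c \<or> shared m c a b"
proof -
  have mixed: "shared m d r t \<or> shared m r d t \<or> shared m t d r"
    if "{d, r, t} \<subseteq> {1..2*m}" "r \<noteq> t" "r \<le> m \<longleftrightarrow> t \<le> m" "d \<le> m \<longleftrightarrow> \<not> t \<le> m" for d r t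
  proof -
    have ne: "d \<noteq> r" "d \<noteq> t" using that by auto
    consider "d = prm m r" | "d = prm m t" | "d \<noteq> prm m r" "d \<noteq> prm m t" by blast
    then show ?thesis
    proof cases
      case 1
      then have "shared m t d r" using that ne unfolding shared_def by blast
      then show ?thesis by blast
    next
      case 2
      then have "shared m r d t" using that ne unfolding shared_def by blast
      then show ?thesis by blast
    next
      case 3
      have "{r, t} \<subseteq> {1..m} \<and> d \<in> {m+1..2*m} \<or> {r, t} \<subseteq> {m+1..2*m} \<and> d \<in> {1..m}" using that by auto
      then have "shared m d r t" using 3 that ne unfolding shared_def by blast
      then show ?thesis by blast
    qed
  qed
  have pure: "shared m d r t"
    if "{d, r, t} \<subseteq> {1..m} \<and> d < r \<and> d < t \<or> {d, r, t} \<subseteq> {m+1..2*m} \<and> r < d \<and> t < d" "r \<noteq> t" for d r t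
    using that unfolding shared_def by auto
  consider "(b \<le> m \<longleftrightarrow> c \<le> m) \<and> (a \<le> m \<longleftrightarrow> \<not> c \<le> m)" | "(a \<le> m \<longleftrightarrow> c \<le> m) \<and> (b \<le> m \<longleftrightarrow> \<not> c \<le> m)"
    | "(a \<le> m \<longleftrightarrow> b \<le> m) \<and> (c \<le> m \<longleftrightarrow> \<not> b \<le> m)" | "{a, b, c} \<subseteq> {1..m}" | "{a, b, c} \<subseteq> {m+1..2*m}"
    using rg by fastforce
  then show ?thesis
  proof cases
    case 1
    then show ?thesis using mixed[of a b c] rg ne shared_sym by blast
  next
    case 2
    then show ?thesis using mixed[of b a c] rg ne shared_sym by blast
  next
    case 3
    then show ?thesis using mixed[of c a b] rg ne shared_sym by blast
  next
    case 4
    have "a < b \<and> a < c \<or> b < a \<and> b < c \<or> c < a \<and> c < b" using ne by linarith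
    then show ?thesis using 4 ne pure[of a b c] pure[of b a c] pure[of c a b] by auto
  next
    case 5
    have "b < a \<and> c < a \<or> a < b \<and> c < b \<or> a < c \<and> b < c" using ne by linarith
    then show ?thesis using 5 ne pure[of a b c] pure[of b a c] pure[of c a b] by auto
  qed
qed

text \<open>
  A triple \<open>(d, r, t)\<close> stands for the coordinate \<open>T(e\<^sub>d, e\<^sub>r, e\<^sub>t)\<close>. These are the pivots, one for each
  element of \<open>A\<^sub>m\<close>.
\<close>

definition pivot_triples :: "nat \<Rightarrow> (nat \<times> nat \<times> nat) set" where
  "pivot_triples m = {(i, j, k). 1 \<le> i \<and> i < j \<and> j \<le> 2*m \<and> (k = i \<or> k = j)} \<union> {(d, r, t). shared m d r t}"

text \<open>
  The last alternative in \<open>shared\<close>, expressed by halves: it is disjoint from the case of a conjugate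
  pair \<open>r = t'\<close>, where \<open>r\<close> and \<open>t\<close> lie in different halves.
\<close>

definition opposed :: "nat \<Rightarrow> nat \<Rightarrow> nat \<Rightarrow> nat \<Rightarrow> bool" where
  "opposed m d r t \<longleftrightarrow> (r \<le> m \<longleftrightarrow> t \<le> m) \<and> (d \<le> m \<longleftrightarrow> \<not> t \<le> m)"

text \<open>
  The cocycle with pivot \<open>(d, r, t)\<close>. For distinct indices it is, up to a sign,
  \<open>e\<^sup>d\<^sup>r\<^bsub>t'\<^esub> \<plusminus> e\<^sup>t\<^sup>r\<^bsub>d'\<^esub>\<close>, where the inner sign is that of \<open>\<beta>(e\<^sub>t, e\<^bsub>t'\<^esub>) \<beta>(e\<^sub>d, e\<^bsub>d'\<^esub>)\<close> and makes the cyclic sum of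
  the associated trilinear form vanish. The outer sign is negative on opposed triples,
  in agreement with the elements of \<open>A\<^sub>m\<close>.
\<close>

definition basis_cocycle :: "nat \<Rightarrow> nat \<times> nat \<times> nat \<Rightarrow> ('a::field) cochain2" where
  "basis_cocycle m = (\<lambda>(d, r, t).
     if t = d \<or> t = r then ee m d r (prm m t)
     else if opposed m d r t then ee m t r (prm m d) - ee m d r (prm m t)
     else if d \<le> m \<longleftrightarrow> t \<le> m then ee m d r (prm m t) + ee m t r (prm m d)
     else ee m d r (prm m t) - ee m t r (prm m d))"

lemma ee_anti: "ee m j i k = - ee m i j k"
  by (auto simp: ee_def ext2_def fun_eq_iff scal_def algebra_simps)

lemma pivot_triples_range:
  "(d, r, t) \<in> pivot_triples m \<Longrightarrow> d \<in> {1..2*m} \<and> r \<in> {1..2*m} \<and> t \<in> {1..2*m}"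
  by (auto simp: pivot_triples_def shared_def)

lemma finite_pivot_triples: "finite (pivot_triples m)"
  by (rule finite_subset[of _ "{..2*m} \<times> {..2*m} \<times> {..2*m}"]) (auto simp: pivot_triples_def shared_def)

lemma A_set_iff:
  "x \<in> A_set m \<longleftrightarrow> (let e = ee m; q = prm m in
     (\<exists>i j. 1 \<le> i \<and> i < j \<and> j \<le> 2*m \<and> (x = e i j (q i) \<or> x = e i j (q j)))
   \<or> (\<exists>i j. i \<noteq> j \<and> ({i, j} \<subseteq> {1..m} \<or> {i, j} \<subseteq> {m+1..2*m}) \<and>
        (x = e i (q j) (q j) + e j (q j) (q i) \<or> x = e i j j + e j (q j) (q i)))
   \<or> (\<exists>i j k. ((1 \<le> k \<and> k < i \<and> i < j \<and> j \<le> m) \<or> (m + 1 \<le> i \<and> i < j \<and> j < k \<and> k \<le> 2*m)) \<and>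
        (x = e k j (q i) + e i j (q k) \<or> x = e k i (q j) - e i j (q k)))
   \<or> (\<exists>i j k. (k \<noteq> i \<and> k \<noteq> j \<and> i < j \<and> ({i, j, k} \<subseteq> {1..m} \<or> {i, j, k} \<subseteq> {m+1..2*m})) \<and>
        (x = e i (q k) (q j) - e i j k \<or> x = e j (q k) (q i) + e i j k)))"
proof -
  have 2: "y \<in> \<Union>{f i j |i j. P i j} \<longleftrightarrow> (\<exists>i j. P i j \<and> y \<in> f i j)" for y :: 'b and f and P :: "nat \<Rightarrow> nat \<Rightarrow> bool"
    by blast
  have 3: "y \<in> \<Union>{f i j k |i j k. P i j k} \<longleftrightarrow> (\<exists>i j k. P i j k \<and> y \<in> f i j k)" for y :: 'b and f and P :: "nat \<Rightarrow> nat \<Rightarrow> nat \<Rightarrow> bool"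
    by blast
  show ?thesis
    unfolding A_set_def Let_def Un_iff 2 3 insert_iff empty_iff by (simp only: simp_thms conj_assoc disj_assoc)
qed

lemma A_setI:
  "1 \<le> i \<Longrightarrow> i < j \<Longrightarrow> j \<le> 2*m \<Longrightarrow> x = ee m i j (prm m i) \<or> x = ee m i j (prm m j) \<Longrightarrow> x \<in> A_set m"
  "i \<noteq> j \<Longrightarrow> {i, j} \<subseteq> {1..m} \<or> {i, j} \<subseteq> {m+1..2*m} \<Longrightarrow>
     x = ee m i (prm m j) (prm m j) + ee m j (prm m j) (prm m i) \<or> x = ee m i j j + ee m j (prm m j) (prm m i) \<Longrightarrow>
     x \<in> A_set m"
  "1 \<le> k \<and> k < i \<and> i < j \<and> j \<le> m \<or> m + 1 \<le> i \<and> i < j \<and> j < k \<and> k \<le> 2*m \<Longrightarrow>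
     x = ee m k j (prm m i) + ee m i j (prm m k) \<or> x = ee m k i (prm m j) - ee m i j (prm m k) \<Longrightarrow> x \<in> A_set m"
  "k \<noteq> i \<Longrightarrow> k \<noteq> j \<Longrightarrow> i < j \<Longrightarrow> {i, j, k} \<subseteq> {1..m} \<or> {i, j, k} \<subseteq> {m+1..2*m} \<Longrightarrow>
     x = ee m i (prm m k) (prm m j) - ee m i j k \<or> x = ee m j (prm m k) (prm m i) + ee m i j k \<Longrightarrow> x \<in> A_set m"
  unfolding A_set_iff Let_def
     apply (rule disjI1, blast)
    apply (rule disjI2, rule disjI1, blast)
   apply (rule disjI2, rule disjI2, rule disjI1, blast)
  apply (rule disjI2, rule disjI2, rule disjI2, blast)
  done

lemma basis_cocycle_in_A_set:
  assumes "(d, r, t) \<in> pivot_triples m"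
  shows "basis_cocycle m (d, r, t) \<in> A_set m"
proof (cases "t = d \<or> t = r")
  case True
  then have "1 \<le> d" "d < r" "r \<le> 2*m" using assms by (auto simp: pivot_triples_def shared_def)
  from A_setI(1)[OF this] show ?thesis using True by (auto simp: basis_cocycle_def)
next
  case False
  then have sh: "shared m d r t" using assms by (auto simp: pivot_triples_def)
  then have rg: "d \<in> {1..2*m}" "r \<in> {1..2*m}" "t \<in> {1..2*m}" by (auto simp: shared_def)
  consider "r = prm m t" "d \<noteq> r" "d \<noteq> t" | "{d, r, t} \<subseteq> {1..m}" "d < r" "d < t" "r \<noteq> t"
    | "{d, r, t} \<subseteq> {m+1..2*m}" "r < d" "t < d" "r \<noteq> t"
    | "{r, t} \<subseteq> {1..m} \<and> d \<in> {m+1..2*m} \<or> {r, t} \<subseteq> {m+1..2*m} \<and> d \<in> {1..m}" "d \<noteq> prm m r" "d \<noteq> prm m t" "r \<noteq> t"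
    using sh by (auto simp: shared_def)
  then show ?thesis
  proof cases
    case 1
    show ?thesis
    proof (cases "d \<le> m \<longleftrightarrow> t \<le> m")
      case True
      then have "basis_cocycle m (d, r, t) = ee m d (prm m t) (prm m t) + ee m t (prm m t) (prm m d)"
        using 1 False rg by (auto simp: basis_cocycle_def opposed_def)
      moreover have "{d, t} \<subseteq> {1..m} \<or> {d, t} \<subseteq> {m+1..2*m}" using True rg by auto
      ultimately show ?thesis using A_setI(2)[of d t m] 1 by auto
    next
      case False2: False
      have pr: "prm m t = r" "prm m r = t" and r: "d \<le> m \<longleftrightarrow> r \<le> m"
        using 1(1) False2 rg by simp_all
      have "opposed m d r t = False" using pr rg False2 prm_simps(5)[OF rg(3)] by (simp add: opposed_def)
      then have "basis_cocycle m (d, r, t) = ee m d r r - ee m t r (prm m d)"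
        using False False2 by (simp add: basis_cocycle_def pr)
      also have "\<dots> = ee m d r r + ee m r (prm m r) (prm m d)"
        unfolding ee_anti[of m r t] pr by simp
      finally have "basis_cocycle m (d, r, t) = ee m d r r + ee m r (prm m r) (prm m d)" .
      moreover have "{d, r} \<subseteq> {1..m} \<or> {d, r} \<subseteq> {m+1..2*m}" using r rg by auto
      ultimately show ?thesis using A_setI(2)[of d r m] 1 by auto
    qed
  next
    case 2
    then have "basis_cocycle m (d, r, t) = ee m d r (prm m t) + ee m t r (prm m d)" by (auto simp: basis_cocycle_def opposed_def)
    moreover from this have "basis_cocycle m (d, r, t) = ee m d r (prm m t) - ee m r t (prm m d)"
      unfolding ee_anti[of m t r] by simp
    moreover have "t < r \<or> r < t" using 2 by linarith
    ultimately show ?thesis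
      using A_setI(3)[of d t r m "basis_cocycle m (d, r, t)"] A_setI(3)[of d r t m "basis_cocycle m (d, r, t)"] 2 by auto
  next
    case 3
    then have "basis_cocycle m (d, r, t) = ee m d r (prm m t) + ee m t r (prm m d)" by (auto simp: basis_cocycle_def opposed_def)
    moreover from this have "basis_cocycle m (d, r, t) = ee m d r (prm m t) - ee m r t (prm m d)"
      unfolding ee_anti[of m t r] by simp
    moreover have "t < r \<or> r < t" using 3 by linarith
    ultimately show ?thesis
      using A_setI(3)[of d t r m "basis_cocycle m (d, r, t)"] A_setI(3)[of d r t m "basis_cocycle m (d, r, t)"] 3 by auto
  next
    case 4
    define k where "k = prm m d"
    have k: "d = prm m k" "k \<noteq> r" "k \<noteq> t" "{r, t, k} \<subseteq> {1..m} \<or> {r, t, k} \<subseteq> {m+1..2*m}"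
      using 4 rg unfolding k_def by (auto simp: prm_def split: if_splits)
    have c: "basis_cocycle m (d, r, t) = ee m t r k - ee m d r (prm m t)"
      using 4 False unfolding k_def by (auto simp: basis_cocycle_def opposed_def)
    show ?thesis
    proof (cases "t < r")
      case True
      have "basis_cocycle m (d, r, t) = ee m r (prm m k) (prm m t) + ee m t r k"
        unfolding c ee_anti[of m d r] k(1)[symmetric] by simp
      then show ?thesis using A_setI(4)[of k t r m] True k by auto
    next
      case False
      have "basis_cocycle m (d, r, t) = ee m r (prm m k) (prm m t) - ee m r t k"
        unfolding c ee_anti[of m d r] k(1)[symmetric] ee_anti[of m t r] by simp
      then show ?thesis using A_setI(4)[of k r t m] False 4 k by auto
    qed
  qed
qed

text \<open>
  The rewriting of \<open>A\<^sub>m\<close> that removes its case distinctions: from here on only uniqueness and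
  existence of the marked index are used.
\<close>

lemma A_set_eq: "A_set m = basis_cocycle m ` pivot_triples m"
proof (intro equalityI subsetI)
  fix x :: "'a cochain2" assume "x \<in> basis_cocycle m ` pivot_triples m"
  then show "x \<in> A_set m" using basis_cocycle_in_A_set by auto
next
  fix x :: "'a cochain2" assume "x \<in> A_set m"
  then consider
      (1) i j where "1 \<le> i" "i < j" "j \<le> 2*m" "x = ee m i j (prm m i) \<or> x = ee m i j (prm m j)"
    | (2) i j where "i \<noteq> j" "{i, j} \<subseteq> {1..m} \<or> {i, j} \<subseteq> {m+1..2*m}"
        "x = ee m i (prm m j) (prm m j) + ee m j (prm m j) (prm m i) \<or> x = ee m i j j + ee m j (prm m j) (prm m i)"
    | (3) i j k where "1 \<le> k \<and> k < i \<and> i < j \<and> j \<le> m \<or> m + 1 \<le> i \<and> i < j \<and> j < k \<and> k \<le> 2*m"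
        "x = ee m k j (prm m i) + ee m i j (prm m k) \<or> x = ee m k i (prm m j) - ee m i j (prm m k)"
    | (4) i j k where "k \<noteq> i" "k \<noteq> j" "i < j" "{i, j, k} \<subseteq> {1..m} \<or> {i, j, k} \<subseteq> {m+1..2*m}"
        "x = ee m i (prm m k) (prm m j) - ee m i j k \<or> x = ee m j (prm m k) (prm m i) + ee m i j k"
    unfolding A_set_iff Let_def by (elim disjE exE conjE) metis+
  then show "x \<in> basis_cocycle m ` pivot_triples m"
  proof cases
    case (1 i j)
    then have "(i, j, i) \<in> pivot_triples m" "(i, j, j) \<in> pivot_triples m" by (auto simp: pivot_triples_def)
    moreover have "x = basis_cocycle m (i, j, i) \<or> x = basis_cocycle m (i, j, j)" using 1 by (auto simp: basis_cocycle_def)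
    ultimately show ?thesis by blast
  next
    case (2 i j)
    have j: "i \<in> {1..2*m}" "j \<in> {1..2*m}" "i \<noteq> prm m j" "i \<noteq> j" using 2 by (auto simp: prm_def)
    moreover have jj: "j \<noteq> prm m j" using prm_simps(4)[OF j(2)] by metis
    ultimately have "shared m i (prm m j) j" "shared m i j (prm m j)" by (auto simp: shared_def)
    then have "(i, prm m j, j) \<in> pivot_triples m" "(i, j, prm m j) \<in> pivot_triples m" by (auto simp: pivot_triples_def)
    moreover have h: "i \<le> m \<longleftrightarrow> j \<le> m" using 2 by auto
    then have "(basis_cocycle m (i, prm m j, j) :: 'a cochain2) = ee m i (prm m j) (prm m j) + ee m j (prm m j) (prm m i)"
      "(basis_cocycle m (i, j, prm m j) :: 'a cochain2) = ee m i j j - ee m (prm m j) j (prm m i)"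
      using j jj by (simp_all add: basis_cocycle_def opposed_def)
    then have "x = basis_cocycle m (i, prm m j, j) \<or> x = basis_cocycle m (i, j, prm m j)"
      using 2(3) unfolding ee_anti[of m "prm m j" j] by simp
    ultimately show ?thesis by blast
  next
    case (3 i j k)
    have "shared m k i j" "shared m k j i" using 3(1) by (elim disjE; simp add: shared_def)+
    then have "(k, i, j) \<in> pivot_triples m" "(k, j, i) \<in> pivot_triples m" by (auto simp: pivot_triples_def)
    moreover have "(basis_cocycle m (k, j, i) :: 'a cochain2) = ee m k j (prm m i) + ee m i j (prm m k)"
      "(basis_cocycle m (k, i, j) :: 'a cochain2) = ee m k i (prm m j) + ee m j i (prm m k)"
      using 3(1) by (elim disjE; simp add: basis_cocycle_def opposed_def)+
    then have "x = basis_cocycle m (k, j, i) \<or> x = basis_cocycle m (k, i, j)"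
      using 3(2) unfolding ee_anti[of m j i] by simp
    ultimately show ?thesis by blast
  next
    case (4 i j k)
    have k: "k \<in> {1..2*m}" and d: "prm m k \<noteq> i" "prm m k \<noteq> j" using 4 by (auto simp: prm_def)
    have s: "{i, j} \<subseteq> {1..m} \<and> prm m k \<in> {m+1..2*m} \<or> {i, j} \<subseteq> {m+1..2*m} \<and> prm m k \<in> {1..m}"
      using 4 by (auto simp: prm_def)
    have "prm m k \<noteq> prm m i" "prm m k \<noteq> prm m j" "{i, j} \<subseteq> {1..2*m}"
      using 4 k by (auto simp: prm_eq_iff)
    then have "shared m (prm m k) i j" "shared m (prm m k) j i"
      using s d 4(3) prm_simps(1)[OF k] unfolding shared_def by blast+
    then have "(prm m k, i, j) \<in> pivot_triples m" "(prm m k, j, i) \<in> pivot_triples m" by (auto simp: pivot_triples_def)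
    moreover have "opposed m (prm m k) i j" "opposed m (prm m k) j i" using s by (auto simp: opposed_def)
    then have "(basis_cocycle m (prm m k, i, j) :: 'a cochain2) = ee m j i k - ee m (prm m k) i (prm m j)"
      "(basis_cocycle m (prm m k, j, i) :: 'a cochain2) = ee m i j k - ee m (prm m k) j (prm m i)"
      using k d[symmetric] 4(3) by (simp_all add: basis_cocycle_def)
    then have "(basis_cocycle m (prm m k, i, j) :: 'a cochain2) = ee m i (prm m k) (prm m j) - ee m i j k"
      "(basis_cocycle m (prm m k, j, i) :: 'a cochain2) = ee m j (prm m k) (prm m i) + ee m i j k"
      unfolding ee_anti[of m j i] ee_anti[of m "prm m k"] by simp_all
    ultimately show ?thesis using 4(5) by (metis image_eqI)
  qed
qed

section \<open>Independence and completeness of the pivots\<close>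

lemma ee_C2:
  assumes "k \<in> {1..2*m+1}"
  shows "ee m i j k \<in> C2 m"
  using assms unfolding C2_iff ee_def ext2_def
  by (auto simp: heis_def scal_def bas_def fun_eq_iff algebra_simps)

lemma ee_apply:
  "g \<in> heis m \<Longrightarrow> h \<in> heis m \<Longrightarrow> ee m i j k g h = (g i * h j - g j * h i) *\<^sub>h bas k"
  by (simp add: ee_def ext2_def)

lemma ee_bas:
  assumes a: "a \<in> {1..2*m+1}" and b: "b \<in> {1..2*m+1}"
  shows "ee m i j k (bas a) (bas b) l =
    (if k = l then (if a = i \<and> b = j then 1 else 0) - (if a = j \<and> b = i then 1 else 0) else (0::'a::field))"
proof -
  have delta: "bas x i * bas y j = (if x = i \<and> y = j then 1 else (0::'a))" for i j x y
    by (cases "i = x"; cases "j = y") (simp_all add: bas_apply)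
  have unit: "c * bas k l = (if k = l then c else (0::'a))" for c
    by (cases "l = k") (simp_all add: bas_apply)
  show ?thesis
    unfolding ee_apply[OF bas_heis[OF a] bas_heis[OF b]] scal_def delta unit
    by (rule if_cong[OF refl _ refl]) (simp only: conj_commute)
qed

lemma symp_ee:
  assumes "g \<in> heis m" "h \<in> heis m" "t \<in> {1..2*m}"
  shows "symp m k (ee m i j (prm m t) g h) = half_sign m t * k t * (g i * h j - g j * h i)"
proof -
  have "symp m k (bas (prm m t)) = half_sign m t * k t"
    unfolding symp_bas(2)[OF prm_simps(1)[OF assms(3)]] prm_simps(2,3)[OF assms(3)] by simp
  then show ?thesis unfolding ee_apply[OF assms(1,2)] symp_scal by simp
qed

text \<open>
  In terms of coordinates, \<open>\<beta>(k, e\<^sup>i\<^sup>j\<^bsub>t'\<^esub>(g, h))\<close> is \<open>\<plusminus> k\<^sub>t\<close> times the 2-by-2 minor of \<open>(g, h)\<close> at \<open>i, j\<close>.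
  The cyclic sum over \<open>g, h, k\<close> is therefore a 3-by-3 determinant with rows \<open>d, r, t\<close>. It has two
  equal rows if \<open>t \<in> {d, r}\<close>. Otherwise the two terms give determinants that differ by exchanging the
  rows \<open>d\<close> and \<open>t\<close>, and the signs are such that they cancel.
\<close>

lemma ee_twisted_cocycle:
  assumes d: "d \<in> {1..2*m}" and r: "r \<in> {1..2*m}" and t: "t \<in> {1..2*m}"
  shows "t = d \<or> t = r \<Longrightarrow> (ee m d r (prm m t) :: 'a cochain2) \<in> normal_cocycles m"
    and "half_sign m t = (half_sign m d :: 'a) \<Longrightarrow> (ee m d r (prm m t) + ee m t r (prm m d) :: 'a cochain2) \<in> normal_cocycles m"
    and "half_sign m t = - (half_sign m d :: 'a::field) \<Longrightarrow> (ee m d r (prm m t) - ee m t r (prm m d) :: 'a cochain2) \<in> normal_cocycles m"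
    and "half_sign m t = - (half_sign m d :: 'a::field) \<Longrightarrow> (ee m t r (prm m d) - ee m d r (prm m t) :: 'a cochain2) \<in> normal_cocycles m"
proof -
  have C: "ee m i j (prm m t) \<in> C2 m" "ee m i j (prm m d) \<in> C2 m" for i j
    using prm_simps(1)[OF d] prm_simps(1)[OF t] by (auto intro!: ee_C2)
  have ctr: "ee m d r k g (bas (Suc (2*m))) = 0" "ee m t r k g (bas (Suc (2*m))) = 0" for k and g :: "'a hvec"
    using d r t by (auto simp: ee_def ext2_def bas_apply)
  have top: "ee m i j (prm m t) g h (Suc (2*m)) = 0" "ee m i j (prm m d) g h (Suc (2*m)) = 0"
    for i j and g h :: "'a hvec"
    using prm_simps(7)[OF d] prm_simps(7)[OF t] by (auto simp: ee_def ext2_def bas_apply scal_def)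
  note sy = symp_ee[OF _ _ t] symp_ee[OF _ _ d]
  show "(ee m d r (prm m t) :: 'a cochain2) \<in> normal_cocycles m" if eq: "t = d \<or> t = r"
  proof (rule normal_cocycleI)
    fix g h k :: "'a hvec" assume "g \<in> heis m" "h \<in> heis m" "k \<in> heis m"
    then have "symp m g (ee m d r (prm m t) h k) - symp m h (ee m d r (prm m t) g k) + symp m k (ee m d r (prm m t) g h)
      = half_sign m t * (g t * (h d * k r - h r * k d) - h t * (g d * k r - g r * k d) + k t * (g d * h r - g r * h d))"
      by (simp add: sy algebra_simps)
    then show "symp m g (ee m d r (prm m t) h k) - symp m h (ee m d r (prm m t) g k) + symp m k (ee m d r (prm m t) g h) = 0"
      using eq by (auto simp: algebra_simps)
  qed (simp_all add: C ctr top)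
  show "(ee m d r (prm m t) + ee m t r (prm m d) :: 'a cochain2) \<in> normal_cocycles m" if eq: "half_sign m t = (half_sign m d :: 'a)"
  proof (rule normal_cocycleI)
    let ?p = "(ee m d r (prm m t) + ee m t r (prm m d) :: 'a cochain2)"
    fix g h k :: "'a hvec" assume "g \<in> heis m" "h \<in> heis m" "k \<in> heis m"
    then show "symp m g (?p h k) - symp m h (?p g k) + symp m k (?p g h) = 0"
      by (simp add: symp_add sy eq algebra_simps)
  qed (simp_all add: C2_closed C ctr top)
  show "(ee m d r (prm m t) - ee m t r (prm m d) :: 'a cochain2) \<in> normal_cocycles m" if eq: "half_sign m t = - (half_sign m d :: 'a)"
  proof (rule normal_cocycleI)
    let ?p = "(ee m d r (prm m t) - ee m t r (prm m d) :: 'a cochain2)"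
    show "?p \<in> C2 m" using C2_closed(1)[OF C(1) C2_closed(2)[OF C(2) C(2)]] by simp
    fix g h k :: "'a hvec" assume "g \<in> heis m" "h \<in> heis m" "k \<in> heis m"
    then show "symp m g (?p h k) - symp m h (?p g k) + symp m k (?p g h) = 0"
      by (simp add: symp_diff sy eq algebra_simps)
  qed (simp_all add: ctr top)
  show "(ee m t r (prm m d) - ee m d r (prm m t) :: 'a cochain2) \<in> normal_cocycles m" if eq: "half_sign m t = - (half_sign m d :: 'a)"
  proof (rule normal_cocycleI)
    let ?p = "(ee m t r (prm m d) - ee m d r (prm m t) :: 'a cochain2)"
    show "?p \<in> C2 m" using C2_closed(1)[OF C(2) C2_closed(2)[OF C(1) C(1)]] by simp
    fix g h k :: "'a hvec" assume "g \<in> heis m" "h \<in> heis m" "k \<in> heis m"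
    then show "symp m g (?p h k) - symp m h (?p g k) + symp m k (?p g h) = 0"
      by (simp add: symp_diff sy eq algebra_simps)
  qed (simp_all add: ctr top)
qed

lemma basis_cocycle_normal:
  assumes "q \<in> pivot_triples m"
  shows "basis_cocycle m q \<in> normal_cocycles m"
proof -
  obtain d r t where q: "q = (d, r, t)" by (cases q)
  then have rg: "d \<in> {1..2*m}" "r \<in> {1..2*m}" "t \<in> {1..2*m}" using assms by (auto simp: pivot_triples_def shared_def)
  note tw = ee_twisted_cocycle[OF rg]
  have "half_sign m t = (half_sign m d :: 'a)" if "d \<le> m \<longleftrightarrow> t \<le> m" using that by (auto simp: half_sign_def)
  moreover have "half_sign m t = - (half_sign m d :: 'a)" if "d \<le> m \<longleftrightarrow> \<not> t \<le> m" using that by (auto simp: half_sign_def)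
  ultimately show ?thesis
    unfolding q basis_cocycle_def prod.case opposed_def using tw by (simp only: split: if_split) blast
qed

text \<open>
  Up to the sign in front, the coefficient of \<open>e\<^bsub>t'\<^esub>\<close> in \<open>(\<phi> - d\<psi>)(e\<^sub>d, e\<^sub>r)\<close>, where \<open>\<psi>\<close> is the gauge
  of \<open>\<phi>\<close>, written out as a linear expression in \<open>\<phi>\<close>. The second summand comes from \<open>\<psi>([e\<^sub>d, e\<^sub>r])\<close> and makes the functional vanish on
  coboundaries, and the sign matches the one in \<open>basis_cocycle\<close>.
\<close>

definition pivot :: "nat \<Rightarrow> nat \<times> nat \<times> nat \<Rightarrow> ('a::field) cochain2 \<Rightarrow> 'a" where
  "pivot m = (\<lambda>(d, r, t) \<phi>. (if t \<noteq> d \<and> t \<noteq> r \<and> opposed m d r t then - 1 else 1) *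
     (\<phi> (bas d) (bas r) (prm m t) + symp m (bas d) (bas r) * half_sign m t * \<phi> (bas t) (ctr m) (2*m+1)))"

lemma pivot_linear:
  "pivot m q (\<phi> + \<phi>') = pivot m q \<phi> + pivot m q \<phi>'"
  "pivot m q (\<lambda>g h. a *\<^sub>h \<phi> g h) = a * pivot m q \<phi>"
  "pivot m q (- \<phi>) = - pivot m q \<phi>" "pivot m q 0 = 0"
  by (cases q; simp add: pivot_def scal_def algebra_simps)+

lemma pivot_d1:
  assumes q: "q \<in> pivot_triples m" and \<psi>: "\<psi> \<in> C1 m"
  shows "pivot m q (d1 m \<psi>) = (0 :: 'a::field)"
proof -
  obtain d r t where q': "q = (d, r, t)" by (cases q)
  then have rg: "d \<in> {1..2*m}" "r \<in> {1..2*m}" "t \<in> {1..2*m}" using pivot_triples_range q by blast+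
  have b: "(bas d :: 'a hvec) \<in> heis m" "(bas r :: 'a hvec) \<in> heis m" "(bas t :: 'a hvec) \<in> heis m" "(ctr m :: 'a hvec) \<in> heis m"
    using rg by auto
  have "prm m t \<noteq> 2*m+1" using prm_simps(7)[OF rg(3)] by simp
  then have "d1 m \<psi> (bas d) (bas r) (prm m t) = - (symp m (bas d) (bas r) * \<psi> (ctr m) (prm m t))"
    using b by (simp add: d1_apply) (simp add: hbr_symp C1D[OF \<psi>], simp add: scal_def bas_apply)
  moreover have "d1 m \<psi> (bas t) (ctr m) (2*m+1) = half_sign m t * \<psi> (ctr m) (prm m t)"
    using b rg by (simp add: d1_apply) (simp add: hbr_symp C1D[OF \<psi>], simp add: scal_def bas_apply)
  ultimately show ?thesis unfolding q' by (simp add: pivot_def algebra_simps)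
qed

text \<open>
  The second coordinate \<open>(t, r, d)\<close> in the support of a cocycle on distinct indices is never a pivot, not even
  up to exchanging the first two entries: otherwise \<open>t\<close> or \<open>r\<close> would be marked along with \<open>d\<close>.
\<close>

lemma pivot_basis_cocycle:
  assumes q: "q \<in> pivot_triples m" and q2: "q2 \<in> pivot_triples m"
  shows "pivot m q (basis_cocycle m q2) = (if q = q2 then 1 else (0 :: 'a::field))"
proof -
  obtain d r t where q': "q = (d, r, t)" by (cases q)
  obtain d2 r2 t2 where q2': "q2 = (d2, r2, t2)" by (cases q2)
  have rg: "d \<in> {1..2*m}" "r \<in> {1..2*m}" "t \<in> {1..2*m}" using pivot_triples_range q q' by blast+
  have rg2: "d2 \<in> {1..2*m}" "r2 \<in> {1..2*m}" "t2 \<in> {1..2*m}" using pivot_triples_range q2 q2' by blast+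
  have e: "ee m i j (prm m k) (bas d) (bas r) (prm m t) =
      (if k = t then (if d = i \<and> r = j then 1 else 0) - (if d = j \<and> r = i then 1 else 0) else (0 :: 'a))"
    if "k \<in> {1..2*m}" for i j k
    using rg that by (simp add: ee_bas prm_eq_iff)
  note nc = basis_cocycle_normal[OF q2, where 'a='a]
  have "basis_cocycle m q2 (bas t) (ctr m) (2*m+1) = (0::'a)"
    using normal_cocyclesD(3)[OF nc bas_heis] rg by simp
  then have p: "pivot m q (basis_cocycle m q2) = (if t \<noteq> d \<and> t \<noteq> r \<and> opposed m d r t then - 1 else 1 :: 'a) * basis_cocycle m q2 (bas d) (bas r) (prm m t)"
    by (simp add: pivot_def q')
  consider (pp) "d < r \<and> (t = d \<or> t = r)" "d2 < r2 \<and> (t2 = d2 \<or> t2 = r2)"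
    | (ps) "d < r \<and> (t = d \<or> t = r)" "shared m d2 r2 t2"
    | (sp) "shared m d r t" "d2 < r2 \<and> (t2 = d2 \<or> t2 = r2)"
    | (ss) "shared m d r t" "shared m d2 r2 t2"
    using q q2 unfolding q' q2' pivot_triples_def by auto
  then show ?thesis
  proof cases
    case pp
    then have "basis_cocycle m q2 = (ee m d2 r2 (prm m t2) :: 'a cochain2)" by (auto simp: q2' basis_cocycle_def)
    moreover have "ee m d2 r2 (prm m t2) (bas d) (bas r) (prm m t) = (if q = q2 then 1 else 0 :: 'a)"
      unfolding e[OF rg2(3)] q' q2' using pp by auto
    ultimately show ?thesis using pp(1) unfolding p by auto
  next
    case ps
    then have ne: "t2 \<noteq> d2" "t2 \<noteq> r2" "d2 \<noteq> r2" using shared_distinct by blast+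
    have "ee m d2 r2 (prm m t2) (bas d) (bas r) (prm m t) = (0 :: 'a)"
      unfolding e[OF rg2(3)] using ps(1) ne by auto
    moreover have "ee m t2 r2 (prm m d2) (bas d) (bas r) (prm m t) = (0 :: 'a)"
      unfolding e[OF rg2(1)] using ps(1) ne by auto
    moreover have "q \<noteq> q2" using ps(1) ne unfolding q' q2' by auto
    ultimately show ?thesis unfolding p unfolding q2' basis_cocycle_def prod.case by simp
  next
    case sp
    then have ne: "t \<noteq> d" "t \<noteq> r" "d \<noteq> r" using shared_distinct by blast+
    have "basis_cocycle m q2 = (ee m d2 r2 (prm m t2) :: 'a cochain2)" using sp by (auto simp: q2' basis_cocycle_def)
    moreover have "ee m d2 r2 (prm m t2) (bas d) (bas r) (prm m t) = (0 :: 'a)"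
      unfolding e[OF rg2(3)] using sp(2) ne by auto
    moreover have "q \<noteq> q2" using sp(2) ne unfolding q' q2' by auto
    ultimately show ?thesis unfolding p by simp
  next
    case ss
    have ne: "t \<noteq> d" "t \<noteq> r" "d \<noteq> r" "t2 \<noteq> d2" "t2 \<noteq> r2" "d2 \<noteq> r2"
      using ss[THEN shared_distinct] by auto
    have u: "\<not> shared m r d t" "\<not> shared m t d r" "\<not> shared m t r d"
      using shared_unique[OF ss(1)] shared_unique[OF iffD1[OF shared_sym ss(1)]] shared_sym[of m t r d] by simp_all
    have 1: "\<not> (t2 = t \<and> d = r2 \<and> r = d2)" "\<not> (d2 = t \<and> d = t2 \<and> r = r2)" "\<not> (d2 = t \<and> d = r2 \<and> r = t2)"
      using ss(2) u by auto
    have z: "ee m t2 r2 (prm m d2) (bas d) (bas r) (prm m t) = (0::'a)"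
    proof (cases "d2 = t")
      case True
      then have "\<not> (d = t2 \<and> r = r2)" "\<not> (d = r2 \<and> r = t2)" using 1 by blast+
      then show ?thesis unfolding e[OF rg2(1)] by (simp only: if_False if_True if_not_P diff_self if_cancel)
    qed (simp only: e[OF rg2(1)] if_False)
    have A: "ee m d2 r2 (prm m t2) (bas d) (bas r) (prm m t) = (if q = q2 then 1 else 0::'a)"
    proof (cases "t2 = t")
      case True
      then have "\<not> (d = r2 \<and> r = d2)" using 1 by blast
      then show ?thesis unfolding e[OF rg2(3)] q' q2' using True by (simp only: if_False if_True if_not_P diff_0_right prod.inject simp_thms)
    next
      case False
      then show ?thesis unfolding e[OF rg2(3)] q' q2' by simp
    qed
    have ne2: "(t2 = d2 \<or> t2 = r2) = False" using ne by blast
    have val: "basis_cocycle m q2 (bas d) (bas r) (prm m t) =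
        (if opposed m d2 r2 t2 then - 1 else 1 :: 'a) * ee m d2 r2 (prm m t2) (bas d) (bas r) (prm m t)"
      unfolding q2' basis_cocycle_def prod.case ne2 by (simp add: z)
    have sgn: "(if t \<noteq> d \<and> t \<noteq> r \<and> opposed m d r t then - 1 else 1 :: 'a) = (if opposed m d r t then - 1 else 1)"
      using ne(1,2) by simp
    show ?thesis
    proof (cases "q = q2")
      case True
      then have "opposed m d2 r2 t2 = opposed m d r t" by (simp add: q' q2')
      then show ?thesis unfolding p sgn val A using True by simp
    next
      case False
      then show ?thesis unfolding p val A by simp
    qed
  qed
qed

text \<open>
  A coordinate \<open>T(e\<^sub>i, e\<^sub>j, e\<^sub>k)\<close> with \<open>k \<in> {i, j}\<close> is a pivot up to the order of \<open>i\<close> and \<open>j\<close>. Among the three coordinates on distinct indices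
  two are pivots, and the cyclic identity gives the third.
\<close>

lemma normal_cocycle_eq_0:
  assumes \<phi>: "\<phi> \<in> normal_cocycles m" and 0: "\<And>q. q \<in> pivot_triples m \<Longrightarrow> pivot m q \<phi> = (0 :: 'a::field)"
  shows "\<phi> = 0"
proof (rule C2_eq_0[OF normal_cocyclesD(1)[OF \<phi>]])
  note D = normal_cocyclesD[OF \<phi>]
  have b: "(bas i :: 'a hvec) \<in> heis m" if "i \<in> {1..2*m}" for i using that by auto
  have anti: "\<phi> (bas j) (bas i) k = - \<phi> (bas i) (bas j) k" if "i \<in> {1..2*m}" "j \<in> {1..2*m}" for i j k
    using C2_anti[OF D(1) b[OF that(1)] b[OF that(2)]] by simp
  have z: "\<phi> (bas d) (bas r) (prm m t) = 0" if "(d, r, t) \<in> pivot_triples m" for d r t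
  proof -
    have "t \<in> {1..2*m}" using pivot_triples_range that by blast
    then have "\<phi> (bas t) (ctr m) (2*m+1) = 0" using D(3)[OF b] by simp
    then show ?thesis using 0[OF that] by (simp add: pivot_def split: if_splits)
  qed
  have main: "\<phi> (bas i) (bas j) (prm m k) = 0" if rg: "i \<in> {1..2*m}" "j \<in> {1..2*m}" "k \<in> {1..2*m}" for i j k
  proof -
    consider "i = j" | "i < j" "k = i \<or> k = j" | "j < i" "k = i \<or> k = j" | "i \<noteq> j" "i \<noteq> k" "j \<noteq> k"
      using linorder_less_linear[of i j] by blast
    then show ?thesis
    proof cases
      case 1
      then show ?thesis using C2D(3)[OF D(1) b] rg by simp
    next
      case 2
      then show ?thesis using rg by (intro z) (auto simp: pivot_triples_def)
    next
      case 3
      then have "\<phi> (bas j) (bas i) (prm m k) = 0" using rg by (intro z) (auto simp: pivot_triples_def)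
      then show ?thesis using anti[OF rg(1,2)] by simp
    next
      case 4
      then consider "shared m i j k" | "shared m j i k" | "shared m k i j" "shared m k j i"
        using shared_exists[of i j k m] shared_sym rg by auto
      then show ?thesis
      proof cases
        case 1
        then show ?thesis by (intro z) (auto simp: pivot_triples_def)
      next
        case 2
        then have "\<phi> (bas j) (bas i) (prm m k) = 0" by (intro z) (auto simp: pivot_triples_def)
        then show ?thesis using anti[OF rg(1,2)] by simp
      next
        case 3
        then have "\<phi> (bas k) (bas i) (prm m j) = 0" "\<phi> (bas k) (bas j) (prm m i) = 0"
          by (auto intro!: z simp: pivot_triples_def)
        then have "\<phi> (bas i) (bas k) (prm m j) = 0" "\<phi> (bas j) (bas k) (prm m i) = 0"
          using anti[OF rg(1,3)] anti[OF rg(2,3)] by simp_all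
        then have "half_sign m k * \<phi> (bas i) (bas j) (prm m k) = 0"
          using normal_cocycle_cyclic[OF \<phi> b[OF rg(1)] b[OF rg(2)] b[OF rg(3)]] rg by simp
        then show ?thesis by (auto simp: half_sign_def split: if_splits)
      qed
    qed
  qed
  fix i j assume ij: "i \<in> {1..2*m+1}" "j \<in> {1..2*m+1}"
  then have bb: "(bas i :: 'a hvec) \<in> heis m" "(bas j :: 'a hvec) \<in> heis m" by auto
  show "\<phi> (bas i) (bas j) = 0"
  proof (cases "i = 2*m+1 \<or> j = 2*m+1")
    case True
    then show ?thesis using D(3,4) bb by auto
  next
    case False
    then have ij': "i \<in> {1..2*m}" "j \<in> {1..2*m}" using ij by auto
    have "\<phi> (bas i) (bas j) k = 0" for k
    proof -
      consider "k \<in> {1..2*m}" | "k = 2*m+1" | "k \<notin> {1..2*m+1}" by fastforce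
      then show ?thesis
      proof cases
        case 1
        then show ?thesis using main[OF ij' prm_simps(1)[OF 1]] by simp
      next
        case 2
        then show ?thesis using D(5)[OF bb] by simp
      next
        case 3
        then show ?thesis using C2D(4)[OF D(1) bb] by (simp add: heis_def)
      qed
    qed
    then show ?thesis by (simp add: fun_eq_iff)
  qed
qed

lemma cocycle_is_gauge_coboundary:
  assumes \<phi>: "(\<phi> :: 'a::field cochain2) \<in> C2 m" "d2 m \<phi> = 0" and m: "m > 1" and p: "CHAR('a) = p" "p > 2"
    and 0: "\<And>q. q \<in> pivot_triples m \<Longrightarrow> pivot m q \<phi> = 0"
  shows "\<phi> + - d1 m (gauge m \<phi>) = 0"
proof (rule normal_cocycle_eq_0)
  show "\<phi> + - d1 m (gauge m \<phi>) \<in> normal_cocycles m" by (rule gauge_normalizes[OF \<phi> m p])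
  show "pivot m q (\<phi> + - d1 m (gauge m \<phi>)) = 0" if "q \<in> pivot_triples m" for q
    using 0[OF that] pivot_d1[OF that gauge_C1[OF \<phi>(1)]] by (simp only: pivot_linear) simp
qed

section \<open>Lifting normalised cocycles\<close>

lemma symseqs_3: "symseqs 3 = {[True, False, True], [True, False, False]}"
proof -
  have "s \<in> {[True, False, True], [True, False, False]}" if "s \<in> symseqs 3" for s
  proof -
    from that obtain a b c where "s = [a, b, c]"
      by (auto simp: symseqs_def length_Suc_conv eval_nat_numeral)
    then show ?thesis using that by (cases c) (auto simp: symseqs_def)
  qed
  then show ?thesis by (auto simp: symseqs_def)
qed

lemma lnbr_long: "k + 3 \<le> length gs \<Longrightarrow> lnbr m (take (k + 3) gs) = 0"
  using lnbr_take_Suc[of "k + 2" gs m] lnbr_take_Suc[of "k + 1" gs m]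
  by (simp add: numeral_3_eq_3 numeral_2_eq_2)

text \<open>
  Brackets of length three vanish on the Heisenberg algebra, which leaves no term when \<open>p > 3\<close>. For
  \<open>p = 3\<close> there are two sequences, \<open>(g, h, g)\<close> and \<open>(g, h, h)\<close>, with weights \<open>1/2 = -1\<close> and \<open>1\<close>.
\<close>

lemma compat_sum_normal:
  assumes \<phi>: "\<phi> \<in> normal_cocycles m" and p: "CHAR('a) = p" "p > 2" and gh: "g \<in> heis m" "h \<in> heis m"
  shows "compat_sum m p \<phi> g h = (if p = 3 then hbr m (g - h) (\<phi> g h) else (0 :: 'a::field hvec))"
proof (cases "p = 3")
  case True
  have "of_nat 3 = (0::'a)" using of_nat_eq_0_iff_char_dvd[of 3, where 'a='a] p True by simp
  then have three: "1 + 2 = (0::'a)" by simp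
  moreover have two: "(2::'a) \<noteq> 0" using three by (metis add.right_neutral one_neq_zero)
  ultimately have half: "1 / 2 = (- 1 :: 'a)" by (simp add: field_simps eq_neg_iff_add_eq_0)
  show ?thesis
    unfolding compat_sum_def True symseqs_3
    using gh half normal_cocyclesD(7)[OF \<phi>]
    by (simp add: lnbr_def numeral_2_eq_2 numeral_3_eq_3 hbr_linear) (simp add: numeral_2_eq_2[symmetric] half scal_def fun_eq_iff)
next
  case False
  have "prime p" using p prime_CHAR_semidom[where ?'a = 'a] by simp
  then have "p \<noteq> 4" by (auto simp: prime_nat_iff dest!: spec[of _ 2])
  then have p5: "p \<ge> 5" using p False by linarith
  have z: "\<phi> 0 x = 0" for x
    using C2D(9,11)[OF normal_cocyclesD(1)[OF \<phi>]] by (cases "x \<in> heis m") auto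
  show ?thesis
    unfolding compat_sum_def
  proof (simp add: False, rule sum.neutral, rule ballI)
    fix s assume "s \<in> symseqs p"
    then have len: "length s = p" by (simp add: symseqs_def)
    define gs where "gs = map (\<lambda>b. if b then g else h) s"
    have "lnbr m (take (p - 1) gs) = 0" "lnbr m (take (p - 2) gs) = 0"
      using lnbr_long[of "p - 4" gs m] lnbr_long[of "p - 5" gs m] p5 len
      by (simp_all add: gs_def)
    then show "(let gs = map (\<lambda>b. if b then g else h) s
       in (1 / of_nat (count_list s True)) *\<^sub>h
          (\<phi> (lnbr m (take (p - Suc 0) gs)) (gs ! (p - Suc 0)) -
           hbr m (gs ! (p - Suc 0)) (\<phi> (lnbr m (take (p - 2) gs)) (gs ! (p - 2))))) = 0"
      unfolding gs_def[symmetric] Let_def by (simp add: z)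
  qed
qed

text \<open>
  For \<open>p = 3\<close>, the part of the difference of the two sides that is linear in \<open>g\<close>, \<open>h\<close> and \<open>k\<close> equals the
  cyclic sum of \<open>T\<close> plus \<open>3 T(g, k, h)\<close>; all other parts cancel.
\<close>

lemma compat_sum_cocycle:
  assumes \<phi>: "\<phi> \<in> normal_cocycles m" and p: "CHAR('a) = p" "p > 2"
    and "g \<in> heis m" "h \<in> heis m" "k \<in> heis m"
  shows "compat_sum m p \<phi> g h + compat_sum m p \<phi> (g + h) k
    = compat_sum m p \<phi> h k + compat_sum m p \<phi> g (h + k :: 'a::field hvec)"
proof (cases "p = 3")
  case True
  have "of_nat 3 = (0::'a)" using of_nat_eq_0_iff_char_dvd[of 3, where 'a='a] p True by simp
  then have three: "(3::'a) = 0" by simp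
  note D = C2D[OF normal_cocyclesD(1)[OF \<phi>]]
  have "symp m (g - h) (\<phi> g h) + symp m (g + h - k) (\<phi> (g + h) k)
      - (symp m (h - k) (\<phi> h k) + symp m (g - (h + k)) (\<phi> g (h + k)))
      = 3 * symp m h (\<phi> g k) + (symp m g (\<phi> h k) - symp m h (\<phi> g k) + symp m k (\<phi> g h))"
    using assms(4-6) by (simp add: D(5,6) symp_diff symp_add algebra_simps)
  also have "\<dots> = 0"
    using normal_cocycle_cyclic[OF \<phi> assms(4-6)] three by simp
  finally have "symp m (g - h) (\<phi> g h) + symp m (g + h - k) (\<phi> (g + h) k)
      = symp m (h - k) (\<phi> h k) + symp m (g - (h + k)) (\<phi> g (h + k))" by simp
  moreover have "compat_sum m p \<phi> x y = symp m (x - y) (\<phi> x y) *\<^sub>h ctr m" if "x \<in> heis m" "y \<in> heis m" for x y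
    using compat_sum_normal[OF \<phi> p that] True by (simp add: hbr_symp)
  ultimately show ?thesis
    using assms(4-6) by (simp only: heis_closed scal_distribs(2)[symmetric])
qed (use assms in \<open>simp add: compat_sum_normal\<close>)

lemma compat_sum_sym:
  assumes \<phi>: "\<phi> \<in> normal_cocycles m" and p: "CHAR('a) = p" "p > 2" and gh: "g \<in> heis m" "h \<in> heis m"
  shows "compat_sum m p \<phi> g h = compat_sum m p \<phi> h (g :: 'a::field hvec)"
proof -
  have "\<phi> h g = - \<phi> g h" using C2_anti[OF normal_cocyclesD(1)[OF \<phi>] gh] .
  moreover have "hbr m (h - g) (- \<phi> g h) = hbr m (g - h) (\<phi> g h)"
    by (simp add: hbr_linear)
  ultimately show ?thesis using gh by (simp only: compat_sum_normal[OF \<phi> p])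
qed

lemma compat_sum_scal:
  assumes \<phi>: "\<phi> \<in> normal_cocycles m" and p: "CHAR('a) = p" "p > 2" and gh: "g \<in> heis m" "h \<in> heis m"
  shows "compat_sum m p \<phi> (a *\<^sub>h g) (a *\<^sub>h h) = a ^ p *\<^sub>h compat_sum m p \<phi> g (h :: 'a::field hvec)"
proof -
  have "a *\<^sub>h g - a *\<^sub>h h = a *\<^sub>h (g - h)" by (simp only: scal_distribs(3))
  then show ?thesis
    using gh C2D(7,8)[OF normal_cocyclesD(1)[OF \<phi>]]
    by (simp add: compat_sum_normal[OF \<phi> p] hbr_linear(7,8) power3_eq_cube mult.assoc)
qed

lemma compat_sum_parallel:
  assumes \<phi>: "\<phi> \<in> normal_cocycles m" and p: "CHAR('a) = p" "p > 2" and g: "g \<in> heis m"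
  shows "compat_sum m p \<phi> (a *\<^sub>h g) (b *\<^sub>h g) = (0 :: 'a::field hvec)"
  using g C2D(3,7,8)[OF normal_cocyclesD(1)[OF \<phi>]]
  by (simp add: compat_sum_normal[OF \<phi> p])

definition trunc :: "nat \<Rightarrow> ('a::field) hvec \<Rightarrow> 'a hvec" where
  "trunc k g = (\<lambda>i. if i < k then g i else 0)"

lemma trunc_simps:
  "trunc (Suc k) g = trunc k g + g k *\<^sub>h bas k" "trunc k (g + h) = trunc k g + trunc k h"
  "trunc k (a *\<^sub>h g) = a *\<^sub>h trunc k g" "g \<in> heis m \<Longrightarrow> trunc k g \<in> heis m"
  "g \<in> heis m \<Longrightarrow> trunc (Suc 0) g = 0" "g \<in> heis m \<Longrightarrow> trunc (2*m+2) g = g"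
  by (auto simp: trunc_def fun_eq_iff scal_def bas_def heis_def less_Suc_eq)

lemma hbr_sum: "hbr m x (sum f A) = (\<Sum>i\<in>A. hbr m x (f i))"
  by (induction A rule: infinite_finite_induct) (simp_all only: sum.infinite sum.empty sum.insert hbr_0 hbr_linear simp_thms)

lemma heis_sum: "(\<And>i. i \<in> A \<Longrightarrow> f i \<in> heis m) \<Longrightarrow> sum f A \<in> heis m"
  by (induction A rule: infinite_finite_induct) (simp_all only: sum.infinite sum.empty sum.insert heis_closed insert_iff simp_thms)

text \<open>
  If \<open>\<omega>(g + h) = \<omega>(g) + \<omega>(h) + S(g, h)\<close> and \<open>\<omega>\<close> vanishes on multiples of basis vectors, then adding the
  coordinates of \<open>g\<close> one after the other forces \<open>\<omega>(g) = \<Sum>\<^sub>j S(g\<^sub>1 e\<^sub>1 + \<dots> + g\<^bsub>j-1\<^esub> e\<^bsub>j-1\<^esub>, g\<^sub>j e\<^sub>j)\<close>. The proof takes this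
  as the definition and recovers the functional equation by induction on the number of coordinates.
\<close>

lemma symmetric_cocycle_trivial:
  fixes S :: "('a::field) hvec \<Rightarrow> 'a hvec \<Rightarrow> 'a hvec"
  assumes heis: "\<And>g h. g \<in> heis m \<Longrightarrow> h \<in> heis m \<Longrightarrow> S g h \<in> heis m"
    and sym: "\<And>g h. g \<in> heis m \<Longrightarrow> h \<in> heis m \<Longrightarrow> S g h = S h g"
    and coc: "\<And>g h k. g \<in> heis m \<Longrightarrow> h \<in> heis m \<Longrightarrow> k \<in> heis m \<Longrightarrow> S g h + S (g + h) k = S h k + S g (h + k)"
    and par: "\<And>g a b. g \<in> heis m \<Longrightarrow> S (a *\<^sub>h g) (b *\<^sub>h g) = 0"
    and scal: "\<And>g h a. g \<in> heis m \<Longrightarrow> h \<in> heis m \<Longrightarrow> S (a *\<^sub>h g) (a *\<^sub>h h) = a ^ p *\<^sub>h S g h"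
    and central: "\<And>g h k. g \<in> heis m \<Longrightarrow> h \<in> heis m \<Longrightarrow> hbr m k (S g h) = 0"
  obtains \<omega> where "ext1 m \<omega> = \<omega>" "\<omega> \<in> heis m \<rightarrow> heis m"
    "\<And>a g. g \<in> heis m \<Longrightarrow> \<omega> (a *\<^sub>h g) = a ^ p *\<^sub>h \<omega> g"
    "\<And>g h. g \<in> heis m \<Longrightarrow> h \<in> heis m \<Longrightarrow> \<omega> (g + h) = \<omega> g + \<omega> h + S g h"
    "\<And>i. i \<in> {1..2*m+1} \<Longrightarrow> \<omega> (bas i) = 0" "\<And>g h. hbr m g (\<omega> h) = 0"
proof -
  define F where "F k g = (\<Sum>j=1..<k. S (trunc j g) (g j *\<^sub>h bas j))" for k and g :: "'a hvec"
  define \<omega> where "\<omega> = ext1 m (F (2*m+2))"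
  have b: "x *\<^sub>h bas j \<in> heis m" if "j \<in> {1..2*m+1}" for j and x :: 'a
    using that by (intro heis_closed bas_heis)
  \<comment> \<open>both sides are what remains of \<open>\<omega>(g + h + x + y)\<close> after grouping the summands in two ways\<close>
  have four: "S g h + S (g + h) (x + y) = S g x + S h y + S (g + x) (h + y)"
    if g: "g \<in> heis m" and h: "h \<in> heis m" and x: "x \<in> heis m" and y: "y \<in> heis m" and 0: "S x y = 0" for g h x y
  proof -
    have xy: "x + y \<in> heis m" "y + x \<in> heis m" "h + y \<in> heis m" using h x y by auto
    have "S g h + S (g + h) (x + y) = S h (y + x) + S g (h + (x + y))"
      using coc[OF g h xy(1)] by (simp only: add.commute[of x y])
    also have "S h (y + x) = S h y + S (h + y) x - S y x"
      using coc[OF h y x] by (simp only: add_diff_cancel_left' eq_diff_eq add.commute)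
    also have "S y x = 0" using sym[OF x y] 0 by simp
    also have "S (h + y) x = S x (h + y)" by (rule sym[OF xy(3) x])
    finally have 1: "S g h + S (g + h) (x + y) = S h y + (S x (h + y) + S g (x + (h + y)))"
      by (simp only: diff_0_right ac_simps)
    also have "S x (h + y) + S g (x + (h + y)) = S g x + S (g + x) (h + y)"
      using coc[OF g x xy(3)] by simp
    finally show ?thesis by (simp only: ac_simps)
  qed
  have F_add: "F k (g + h) = F k g + F k h + S (trunc k g) (trunc k h)"
    if g: "g \<in> heis m" and h: "h \<in> heis m" and k: "1 \<le> k" "k \<le> 2*m+2" for g h k
    using k
  proof (induction k rule: dec_induct)
    case base
    have 0: "S 0 0 = 0" using par[of 0 0 0] by simp
    have F1: "F 1 u = 0" for u by (simp add: F_def)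
    have t1: "trunc 1 u = 0" if "u \<in> heis m" for u :: "'a hvec" using trunc_simps(5)[OF that] by simp
    show ?case by (simp only: F1 t1[OF g] t1[OF h] 0 add_0_left)
  next
    case (step k)
    let ?G = "trunc k g" and ?H = "trunc k h" and ?x = "g k *\<^sub>h bas k" and ?y = "h k *\<^sub>h bas k"
    have kr: "k \<in> {1..2*m+1}" using step by auto
    have Suc: "F (Suc k) u = F k u + S (trunc k u) (u k *\<^sub>h bas k)" for u
      using step(1) by (simp add: F_def)
    have sc: "(g + h) k *\<^sub>h bas k = ?x + ?y" by (simp add: scal_distribs)
    have "S ?x ?y = 0" using par[OF bas_heis[OF kr]] .
    then have 4: "S ?G ?H + S (?G + ?H) (?x + ?y) = S ?G ?x + S ?H ?y + S (?G + ?x) (?H + ?y)"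
      using g h kr by (intro four trunc_simps b)
    have IH: "F k (g + h) = F k g + F k h + S ?G ?H" by (rule step.IH) (use step.prems in simp)
    have "F (Suc k) (g + h) = F k g + F k h + (S ?G ?H + S (?G + ?H) (?x + ?y))"
      by (simp only: Suc IH sc trunc_simps(2) add.assoc)
    then show ?case by (simp only: 4 Suc trunc_simps(1) ac_simps)
  qed
  show ?thesis
  proof
    show "ext1 m \<omega> = \<omega>" by (auto simp: \<omega>_def ext1_def)
    have tm: "trunc j g \<in> heis m" "g j *\<^sub>h bas j \<in> heis m" if "g \<in> heis m" "j \<in> {1..<2*m+2}" for g j
      using that by (auto intro: trunc_simps b)
    show "\<omega> \<in> heis m \<rightarrow> heis m"
    proof
      fix g :: "'a hvec" assume g: "g \<in> heis m"
      then have "F (2*m+2) g \<in> heis m" unfolding F_def by (intro heis_sum heis tm)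
      then show "\<omega> g \<in> heis m" using g by (simp add: \<omega>_def ext1_def)
    qed
    show "\<omega> (a *\<^sub>h g) = a ^ p *\<^sub>h \<omega> g" if g: "g \<in> heis m" for a g
    proof -
      have "S (trunc j (a *\<^sub>h g)) ((a *\<^sub>h g) j *\<^sub>h bas j) = a ^ p *\<^sub>h S (trunc j g) (g j *\<^sub>h bas j)"
        if "j \<in> {1..<2*m+2}" for j
      proof -
        have "(a *\<^sub>h g) j *\<^sub>h bas j = a *\<^sub>h (g j *\<^sub>h bas j :: 'a hvec)" by (simp add: scal_def mult.assoc)
        moreover have "j \<in> {1..2*m+1}" using that by auto
        ultimately show ?thesis
          using scal[OF trunc_simps(4)[OF g] b] by (simp only: trunc_simps(3))
      qed
      then have "F (2*m+2) (a *\<^sub>h g) = a ^ p *\<^sub>h F (2*m+2) g"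
        unfolding F_def scal_distribs(5) by (rule sum.cong[OF refl])
      then show ?thesis using g by (simp add: \<omega>_def ext1_def)
    qed
    show "\<omega> (g + h) = \<omega> g + \<omega> h + S g h" if g: "g \<in> heis m" and h: "h \<in> heis m" for g h
      using F_add[OF g h, of "2*m+2"] g h by (simp add: \<omega>_def ext1_def trunc_simps(6)[of _ m, simplified])
    show "\<omega> (bas i) = 0" if i: "i \<in> {1..2*m+1}" for i
    proof -
      have "S (trunc j (bas i)) (bas i j *\<^sub>h bas j) = 0" if "j \<in> {1..<2*m+2}" for j
      proof (cases "j = i")
        case True
        have "trunc j (bas i) = 0 *\<^sub>h (bas i :: 'a hvec)" using True by (auto simp: trunc_def bas_def fun_eq_iff)
        then show ?thesis using par[OF bas_heis[OF i], of 0 "bas i j"] True by simp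
      next
        case False
        have "S (trunc j (bas i)) 0 = 0"
          using par[OF trunc_simps(4)[OF bas_heis[OF i]], of 1 j 0] by simp
        then show ?thesis using False by (simp add: bas_apply)
      qed
      then have "F (2*m+2) (bas i) = 0" unfolding F_def by (intro sum.neutral ballI)
      then show ?thesis using i by (simp add: \<omega>_def ext1_def)
    qed
    show "hbr m g (\<omega> h) = 0" for g h
    proof (cases "h \<in> heis m")
      case True
      then have "hbr m g (F (2*m+2) h) = 0"
        unfolding F_def hbr_sum by (intro sum.neutral ballI central tm)
      then show ?thesis using True by (simp add: \<omega>_def ext1_def)
    qed (simp add: \<omega>_def ext1_def)
  qed
qed

lemma semilinear_expand:
  assumes add: "\<And>g h. g \<in> heis m \<Longrightarrow> h \<in> heis m \<Longrightarrow> \<omega> (g + h) = \<omega> g + \<omega> h"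
    and scal: "\<And>a g. g \<in> heis m \<Longrightarrow> \<omega> (a *\<^sub>h g) = a ^ p *\<^sub>h (\<omega> g :: 'a::field hvec)"
    and p: "p > 0" and g: "g \<in> heis m"
  shows "\<omega> g = (\<Sum>i=1..2*m+1. g i ^ p *\<^sub>h \<omega> (bas i))"
proof -
  have "\<omega> (0 *\<^sub>h 0) = 0 ^ p *\<^sub>h \<omega> 0" by (rule scal) simp
  then have 0: "\<omega> 0 = 0" using p by (simp add: zero_power)
  have "A \<subseteq> {1..2*m+1} \<Longrightarrow> \<omega> (\<Sum>i\<in>A. g i *\<^sub>h bas i) = (\<Sum>i\<in>A. g i ^ p *\<^sub>h \<omega> (bas i)) \<and> (\<Sum>i\<in>A. g i *\<^sub>h bas i) \<in> heis m"
    if "finite A" for A using that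
  proof (induction A)
    case (insert x A)
    have x: "bas x \<in> heis m" "g x *\<^sub>h bas x \<in> heis m" and A: "(\<Sum>i\<in>A. g i *\<^sub>h bas i) \<in> heis m"
      using insert by auto
    show ?case
      using insert.IH insert.prems add[OF x(2) A] scal[OF x(1)] heis_closed(2)[OF x(2) A]
      by (simp only: sum.insert[OF insert.hyps]) simp
  qed (simp add: 0)
  from this[of "{1..2*m+1}"] show ?thesis using heis_expand[OF g] by simp
qed

lemma compat_eqI:
  assumes "compat m p \<phi> \<omega>" "compat m p \<phi> \<omega>'" "p > 0"
    and "\<And>i. i \<in> {1..2*m+1} \<Longrightarrow> \<omega> (bas i) = \<omega>' (bas i)"
  shows "\<omega> = (\<omega>' :: 'a::field cochain1)"
proof (rule ext)
  fix g
  let ?D = "\<lambda>g. \<omega> g - \<omega>' g"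
  have "\<omega> g - \<omega>' g = 0"
  proof (cases "g \<in> heis m")
    case True
    have "\<omega> (a *\<^sub>h x) = a ^ p *\<^sub>h \<omega> x" "\<omega>' (a *\<^sub>h x) = a ^ p *\<^sub>h \<omega>' x"
      "\<omega> (x + y) = \<omega> x + \<omega> y + compat_sum m p \<phi> x y" "\<omega>' (x + y) = \<omega>' x + \<omega>' y + compat_sum m p \<phi> x y"
      if "x \<in> heis m" "y \<in> heis m" for x y a
      using assms(1,2) that unfolding compat_def by blast+
    note c = this
    have "?D (x + y) = ?D x + ?D y" if "x \<in> heis m" "y \<in> heis m" for x y
      unfolding c(3,4)[OF that] by simp
    moreover have "?D (a *\<^sub>h x) = a ^ p *\<^sub>h ?D x" if "x \<in> heis m" for a x
      unfolding c(1,2)[OF that that] by (simp only: scal_distribs(3))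
    ultimately have "?D g = (\<Sum>i=1..2*m+1. g i ^ p *\<^sub>h ?D (bas i))"
      using semilinear_expand[of m ?D p g] assms(3) True by blast
    then show ?thesis using assms(4) by simp
  next
    case False
    have "ext1 m \<omega> = \<omega>" "ext1 m \<omega>' = \<omega>'" using assms by (auto simp: compat_def)
    then have "\<omega> g = 0" "\<omega>' g = 0" using False by (metis ext1_def)+
    then show ?thesis by simp
  qed
  then show "\<omega> g = \<omega>' g" by simp
qed

text \<open>
  The compatibility sum satisfies the hypotheses of \<open>symmetric_cocycle_trivial\<close>, which gives existence.
  Uniqueness holds because two compatible maps for the same \<open>\<phi>\<close> differ by a \<open>p\<close>-semilinear map, and
  this is determined by its values on the basis.
\<close>

lemma tilde_normal:
  assumes \<phi>: "\<phi> \<in> normal_cocycles m" and p: "CHAR('a::field) = p" "p > 2"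
  shows "compat m p \<phi> (tilde m p \<phi> :: 'a cochain1)"
    and "i \<in> {1..2*m+1} \<Longrightarrow> tilde m p \<phi> (bas i) = (0 :: 'a hvec)"
    and "hbr m g (tilde m p \<phi> h) = (0 :: 'a hvec)"
proof -
  let ?S = "compat_sum m p \<phi>"
  obtain \<omega> where \<omega>: "ext1 m \<omega> = \<omega>" "\<omega> \<in> heis m \<rightarrow> heis m"
    "\<And>a g. g \<in> heis m \<Longrightarrow> \<omega> (a *\<^sub>h g) = a ^ p *\<^sub>h \<omega> g"
    "\<And>g h. g \<in> heis m \<Longrightarrow> h \<in> heis m \<Longrightarrow> \<omega> (g + h) = \<omega> g + \<omega> h + ?S g h"
    "\<And>i. i \<in> {1..2*m+1} \<Longrightarrow> \<omega> (bas i) = 0" "\<And>g h. hbr m g (\<omega> h) = 0"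
  proof -
    have "?S g h \<in> heis m" "hbr m k (?S g h) = 0" if "g \<in> heis m" "h \<in> heis m" for g h k
      using that by (auto simp: compat_sum_normal[OF \<phi> p])
    from symmetric_cocycle_trivial[of m ?S p, OF this(1) compat_sum_sym[OF \<phi> p] compat_sum_cocycle[OF \<phi> p]
        compat_sum_parallel[OF \<phi> p] compat_sum_scal[OF \<phi> p] this(2)] that
    show thesis by blast
  qed
  have c: "compat m p \<phi> \<omega>" using \<omega>(1-4) unfolding compat_def by blast
  have "\<exists>!\<omega>. compat m p \<phi> \<omega> \<and> (\<forall>i\<in>{1..2*m+1}. \<omega> (bas i) = 0)"
  proof (rule ex1I)
    show "compat m p \<phi> \<omega> \<and> (\<forall>i\<in>{1..2*m+1}. \<omega> (bas i) = 0)" using c \<omega>(5) by blast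
    show "\<omega>' = \<omega>" if "compat m p \<phi> \<omega>' \<and> (\<forall>i\<in>{1..2*m+1}. \<omega>' (bas i) = 0)" for \<omega>'
      using compat_eqI[of m p \<phi> \<omega>' \<omega>] that c \<omega>(5) p by auto
  qed
  then have "tilde m p \<phi> = \<omega>"
    unfolding tilde_def by (rule the1_equality) (use c \<omega>(5) in blast)
  then show "compat m p \<phi> (tilde m p \<phi>)" "i \<in> {1..2*m+1} \<Longrightarrow> tilde m p \<phi> (bas i) = (0 :: 'a hvec)"
    "hbr m g (tilde m p \<phi> h) = (0 :: 'a hvec)"
    using c \<omega>(5,6) by auto
qed

section \<open>Restricted cocycles and their coordinates\<close>

lemma compat_sum_0: "compat_sum m p 0 g h = (0 :: 'a::field hvec)"
proof -
  have "(\<lambda>g h. 0 *\<^sub>h (0 :: 'a::field cochain2) g h) = 0" by (simp add: fun_eq_iff)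
  then show ?thesis using compat_sum_linear(2)[of m p 0 "0 :: 'a cochain2" g h] by simp
qed

text \<open>
  Every term of \<open>ind2\<close> vanishes separately: \<open>\<phi>\<close> kills the centre, which contains the values of the
  \<open>[p]\<close>-map and of \<open>ad h\<close>, and \<open>\<phi>~\<close> has values in the centre.
\<close>

lemma lifted_normal_cocycle:
  assumes \<phi>: "\<phi> \<in> normal_cocycles m" and p: "CHAR('a::field) = p" "p > 2"
  shows "(\<phi>, tilde m p \<phi> :: 'a cochain1) \<in> carrier (Z2_star m p lam)"
proof -
  note D = normal_cocyclesD[OF \<phi>]
  note t = tilde_normal[OF \<phi> p]
  have "ind2 m p lam (\<phi>, tilde m p \<phi>) g h = 0" for g h
  proof (cases "g \<in> heis m \<and> h \<in> heis m")
    case True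
    have "\<phi> g (pmap m p lam h) = 0"
      using True D(3) C2D(7)[OF D(1)] by (simp add: pmap_def)
    moreover have "(hbr m h ^^ (p - 1)) g = 0" using p by simp
    moreover obtain n where "p - 2 = Suc n" using p by (cases "p - 2") auto
    then have "\<phi> h ((hbr m h ^^ (p - 2)) g) = 0" using D(6) by simp
    ultimately show ?thesis
      using True t(3) C2D(10)[OF D(1)] by (simp add: ind2_def ext2_def)
  qed (auto simp: ind2_def ext2_def)
  then have "ind2 m p lam (\<phi>, tilde m p \<phi>) = 0" by (simp add: fun_eq_iff)
  then show ?thesis
    using D(1,2) t(1) by (simp add: Z2_star_def C2_star_def d2_star_def zero_prod_def)
qed

lemma ebar_apply: "g \<in> heis m \<Longrightarrow> ebar m p i j g = g i ^ p *\<^sub>h bas j"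
  by (simp add: ebar_def ext1_def)

lemma ebar_cocycle:
  assumes p: "CHAR('a::field) = p" "p > 2"
  shows "(0, ebar m p j (2*m+1) :: 'a cochain1) \<in> carrier (Z2_star m p lam)"
proof -
  have "prime p" using p prime_CHAR_semidom[where ?'a = 'a] by simp
  then have fd: "(x + y) ^ p = x ^ p + y ^ p" for x y :: 'a
    using p by (intro freshmans_dream) auto
  let ?e = "ebar m p j (2*m+1) :: 'a cochain1"
  have e: "?e g = g j ^ p *\<^sub>h ctr m" if "g \<in> heis m" for g using that by (rule ebar_apply)
  have "compat m p 0 ?e"
    unfolding compat_def
  proof (intro conjI allI ballI funcsetI)
    show "ext1 m ?e = ?e" by (auto simp: ebar_def ext1_def)
    show "?e g \<in> heis m" if "g \<in> heis m" for g
      using that by (simp only: e heis_closed bas_heis) simp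
    show "?e (a *\<^sub>h g) = a ^ p *\<^sub>h ?e g" if "g \<in> heis m" for a g
      using that by (simp only: e heis_closed scal_simps) (simp add: scal_def power_mult_distrib)
    show "?e (g + h) = ?e g + ?e h + compat_sum m p 0 g h" if "g \<in> heis m" "h \<in> heis m" for g h
      using that by (simp only: e heis_closed compat_sum_0 plus_fun_apply fd scal_distribs(2) add_0_right)
  qed
  moreover have "(0 :: 'a cochain2) \<in> C2 m" by (simp add: C2_iff)
  moreover have "d2 m (0 :: 'a cochain2) = 0" by (auto simp: d2_def ext3_def fun_eq_iff)
  moreover have "ind2 m p lam (0, ?e) = 0"
  proof -
    have "ind2 m p lam (0, ?e) g h = 0" for g h
      using e[of h] by (simp add: ind2_def ext2_def hbr_symp)
    then show ?thesis by (simp add: fun_eq_iff)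
  qed
  ultimately show ?thesis by (simp add: Z2_star_def C2_star_def d2_star_def zero_prod_def)
qed

lemma ind1_bas:
  assumes \<psi>: "\<psi> \<in> C1 m" and p: "p > 2" and j: "j \<in> {1..2*m+1}"
  shows "ind1 m p lam \<psi> (bas j) = lam j *\<^sub>h (\<psi> (ctr m) :: 'a::field hvec)"
proof -
  have "(\<Sum>i=1..2*m+1. bas j i ^ p * lam i) = (\<Sum>i=1..2*m+1. if i = j then lam i else 0)"
    by (rule sum.cong) (use p in \<open>auto simp: bas_apply\<close>)
  then have "pmap m p lam (bas j) = lam j *\<^sub>h (ctr m :: 'a hvec)"
    using j by (simp only: pmap_def) simp
  then show ?thesis
    using p j C1D(3)[OF \<psi>, of "ctr m" "lam j"] by (simp add: ind1_apply)
qed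

text \<open>
  The derivation of weight \<open>c\<close> on \<open>e\<^sub>1, \<dots>, e\<^sub>m\<close> and on \<open>z\<close>, and of weight \<open>0\<close> on the other basis vectors. It scales \<open>z\<close> by
  \<open>c\<close>, and therefore produces the coboundary \<open>(0, c \<Sum>\<^sub>j \<lambda>\<^sub>j ebar\<^sup>j\<^bsub>2m+1\<^esub>)\<close>.
\<close>

definition half_scaling :: "nat \<Rightarrow> 'a::field \<Rightarrow> 'a cochain1" where
  "half_scaling m c = ext1 m (\<lambda>g k. if k \<le> m \<or> k = 2*m+1 then c * g k else 0)"

lemma half_scaling_derivation:
  shows "half_scaling m c \<in> C1 m" and "d1 m (half_scaling m c) = 0"
    and "half_scaling m c (ctr m) = c *\<^sub>h ctr m"
proof -
  show C: "half_scaling m c \<in> C1 m"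
    by (rule C1I) (auto simp: half_scaling_def ext1_def heis_def scal_def fun_eq_iff algebra_simps)
  show ctr: "half_scaling m c (ctr m) = c *\<^sub>h ctr m"
    by (auto simp: half_scaling_def ext1_def scal_def fun_eq_iff bas_apply)
  have "d1 m (half_scaling m c) g h = 0" for g h
  proof (cases "g \<in> heis m \<and> h \<in> heis m")
    case True
    have S: "symp m x (half_scaling m c y) = - c * (\<Sum>i=1..m. x (m+i) * y i)" if "y \<in> heis m" for x y
    proof -
      have "symp m x (half_scaling m c y) = (\<Sum>i=1..m. - c * (x (m+i) * y i))"
        unfolding symp_def by (rule sum.cong) (use that in \<open>auto simp: half_scaling_def ext1_def\<close>)
      then show ?thesis by (simp only: sum_distrib_left)
    qed
    have "symp m g (half_scaling m c h) - symp m h (half_scaling m c g) = c * symp m g h"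
      using True by (simp only: S) (simp add: symp_def sum_subtractf algebra_simps)
    then have "symp m g (half_scaling m c h) *\<^sub>h ctr m - symp m h (half_scaling m c g) *\<^sub>h ctr m
        = (symp m g h * c) *\<^sub>h (ctr m :: 'a hvec)"
      by (simp add: scal_def fun_eq_iff algebra_simps)
    moreover have "half_scaling m c (symp m g h *\<^sub>h ctr m) = (symp m g h * c) *\<^sub>h ctr m"
      using C1D(3)[OF C, of "ctr m" "symp m g h"] ctr by simp
    ultimately show ?thesis using True by (simp add: d1_apply hbr_symp)
  qed (auto simp: d1_def ext2_def)
  then show "d1 m (half_scaling m c) = 0" by (simp add: fun_eq_iff)
qed

text \<open>
  The \<open>j\<close>-th coordinate of \<open>\<omega>\<close> modulo the vector \<open>\<lambda>\<close>, normalised by the index \<open>i\<close>. If \<open>\<lambda>\<close> is zero, the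
  correction term vanishes whatever \<open>i\<close> is, since its factor \<open>\<lambda>\<^sub>j\<close> is zero.
\<close>

definition frobenius_coord :: "nat \<Rightarrow> (nat \<Rightarrow> 'a) \<Rightarrow> nat \<Rightarrow> nat \<Rightarrow> ('a::field) cochain1 \<Rightarrow> 'a" where
  "frobenius_coord m lam i j \<omega> = \<omega> (bas j) (2*m+1) - lam j / lam i * \<omega> (bas i) (2*m+1)"

lemma frobenius_coord_linear:
  "frobenius_coord m lam i j (\<omega> + \<omega>') = frobenius_coord m lam i j \<omega> + frobenius_coord m lam i j \<omega>'"
  "frobenius_coord m lam i j (\<lambda>g. a *\<^sub>h \<omega> g) = a * frobenius_coord m lam i j \<omega>"
  by (simp_all add: frobenius_coord_def scal_def algebra_simps)

text \<open>
  The admissible choices for the index to be left out. A value outside the range leaves out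
  nothing, so that the two cases of the theorem can be treated at once.
\<close>

definition excluded :: "nat \<Rightarrow> (nat \<Rightarrow> 'a::field) \<Rightarrow> nat \<Rightarrow> bool" where
  "excluded m lam i \<longleftrightarrow> (if i \<in> {1..2*m+1} then lam i \<noteq> 0 else \<forall>j\<in>{1..2*m+1}. lam j = 0)"

lemma frobenius_coord_ind1:
  assumes "\<psi> \<in> C1 m" "p > 2" "excluded m lam i" "j \<in> {1..2*m+1}"
  shows "frobenius_coord m lam i j (ind1 m p lam \<psi>) = 0"
  using assms by (cases "i \<in> {1..2*m+1}") (simp_all add: frobenius_coord_def ind1_bas excluded_def scal_def)

lemma frobenius_coord_tilde:
  assumes "\<phi> \<in> normal_cocycles m" "CHAR('a::field) = p" "p > 2" "excluded m lam i" "j \<in> {1..2*m+1}"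
  shows "frobenius_coord m lam i j (tilde m p \<phi>) = (0 :: 'a)"
  using tilde_normal(2)[OF assms(1-3)] assms(4,5)
  by (cases "i \<in> {1..2*m+1}") (simp_all add: frobenius_coord_def excluded_def)

lemma frobenius_coord_ebar:
  assumes "p > 2" "excluded m lam i" "j \<in> {1..2*m+1}" "k \<in> {1..2*m+1}" "k \<noteq> i"
  shows "frobenius_coord m lam i j (ebar m p k (2*m+1)) = (if j = k then 1 else (0 :: 'a::field))"
proof -
  have e: "ebar m p k (2*m+1) (bas l) (2*m+1) = (if l = k then 1 else (0 :: 'a))" if "l \<in> {1..2*m+1}" for l
    using ebar_apply[OF bas_heis[OF that], of p k "2*m+1", where 'a='a] assms(1)
    by (simp add: scal_def bas_apply)
  show ?thesis
  proof (cases "i \<in> {1..2*m+1}")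
    case True
    then show ?thesis using assms(5) unfolding frobenius_coord_def e[OF assms(3)] e[OF True] by simp
  next
    case False
    then show ?thesis using assms(2,3) unfolding frobenius_coord_def e[OF assms(3)] by (simp add: excluded_def)
  qed
qed

text \<open>
  Subtracting the coboundary of the gauge leaves \<open>(0, \<omega>')\<close> with \<open>\<omega>'\<close> semilinear and central. The
  remaining coordinates say that \<open>\<omega>'(e\<^sub>j)\<close> is proportional to \<open>\<lambda>\<^sub>j\<close>, and \<open>half_scaling\<close> realises any factor
  of proportionality.
\<close>

lemma vanishing_coordinates_imp_coboundary:
  assumes m: "m > 1" and p: "CHAR('a::field) = p" "p > 2" and ex: "excluded m lam i"
    and v: "(\<phi>, \<omega>) \<in> carrier (Z2_star m p lam)"
    and piv: "\<And>q. q \<in> pivot_triples m \<Longrightarrow> pivot m q \<phi> = (0 :: 'a)"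
    and frob: "\<And>j. j \<in> {1..2*m+1} \<Longrightarrow> j \<noteq> i \<Longrightarrow> frobenius_coord m lam i j \<omega> = 0"
  shows "(\<phi>, \<omega>) \<in> B2_star m p lam"
proof -
  let ?Z = "Z2_star m p lam" and ?B = "B2_star m p lam"
  have simps: "add ?Z = (+)" "zero ?Z = 0" "smult ?Z = cscal"
    by (simp_all add: Z2_star_def)
  interpret B: submodule class_ring ?B ?Z
    using B2_star_subspace[OF p] by (simp add: subspace_def)
  have addB: "x + y \<in> ?B" if "x \<in> ?B" "y \<in> ?B" for x y
    using B.m_closed[of x y] that by (simp add: simps)
  have scB: "cscal a x \<in> ?B" if "x \<in> ?B" for a x
    using B.smult_closed[of a x] that by (simp add: simps)
  have \<phi>: "\<phi> \<in> C2 m" "d2 m \<phi> = 0"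
    using v by (auto simp: Z2_star_def C2_star_def d2_star_def zero_prod_def)
  define \<psi> where "\<psi> = gauge m \<phi>"
  have \<psi>: "\<psi> \<in> C1 m" unfolding \<psi>_def by (rule gauge_C1[OF \<phi>(1)])
  define \<omega>' where "\<omega>' = \<omega> + ind1 m p lam \<psi>"
  have eq: "(\<phi>, \<omega>) + d1_star m p lam \<psi> = (0, \<omega>')"
    using cocycle_is_gauge_coboundary[OF \<phi> m p piv] by (simp add: d1_star_def \<omega>'_def \<psi>_def)
  have dB: "d1_star m p lam \<chi> \<in> ?B" if "\<chi> \<in> C1 m" for \<chi> using that by (simp add: B2_star_def)
  have "(0, \<omega>') \<in> carrier ?Z"
  proof -
    interpret Z: vectorspace class_ring ?Z by (rule Z2_star_vectorspace)
    show ?thesis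
      unfolding eq[symmetric] using Z.M.add.m_closed[OF v, of "d1_star m p lam \<psi>"] dB[OF \<psi>] B.subset
      by (auto simp: simps)
  qed
  then have c: "compat m p 0 \<omega>'" and i2: "ind2 m p lam (0, \<omega>') = 0"
    by (auto simp: Z2_star_def C2_star_def d2_star_def zero_prod_def)
  have central: "\<omega>' h k = 0" if h: "h \<in> heis m" and k: "k \<in> {1..2*m}" for h k
  proof -
    have b: "(bas (prm m k) :: 'a hvec) \<in> heis m" using prm_simps(1)[OF k] by auto
    have "ind2 m p lam (0, \<omega>') (bas (prm m k)) h = 0" using i2 by simp
    then have "hbr m (bas (prm m k)) (\<omega>' h) = 0" using b h by (simp add: ind2_def ext2_def)
    then have "hbr m (bas (prm m k)) (\<omega>' h) (2*m+1) = 0" by simp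
    then have "half_sign m (prm m k) * \<omega>' h k = 0"
      unfolding hbr_symp symp_bas(1)[OF prm_simps(1)[OF k]] prm_simps(2)[OF k] by (simp add: scal_def bas_apply)
    then show ?thesis by (auto simp: half_sign_def split: if_splits)
  qed
  have top: "\<omega>' h = \<omega>' h (2*m+1) *\<^sub>h ctr m" if h: "h \<in> heis m" for h
  proof
    fix k
    have "\<omega>' h \<in> heis m" using c h by (auto simp: compat_def)
    then have "\<omega>' h k = 0" if "k \<notin> {1..2*m+1}" using that by (simp add: heis_def)
    moreover have "k \<in> {1..2*m} \<or> k = 2*m+1 \<or> k \<notin> {1..2*m+1}" by auto
    ultimately show "\<omega>' h k = (\<omega>' h (2*m+1) *\<^sub>h ctr m) k"
      using central[OF h] by (auto simp: scal_def bas_apply)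
  qed
  \<comment> \<open>If the index \<open>i\<close> is out of range, then all \<open>\<lambda>\<^sub>j\<close> are zero and the value of \<open>a\<close> is irrelevant.\<close>
  define a where "a = \<omega>' (bas i) (2*m+1) / lam i"
  have coord: "\<omega>' (bas j) (2*m+1) = lam j * a" if j: "j \<in> {1..2*m+1}" for j
  proof (cases "j = i")
    case True
    then show ?thesis using ex j by (simp add: a_def excluded_def)
  next
    case False
    have "frobenius_coord m lam i j \<omega>' = 0"
      unfolding \<omega>'_def frobenius_coord_linear using frob[OF j False] frobenius_coord_ind1[OF \<psi> p(2) ex j] by simp
    then show ?thesis by (simp add: frobenius_coord_def a_def)
  qed
  let ?\<chi> = "half_scaling m a"
  have "\<omega>' = ind1 m p lam ?\<chi>"
  proof (rule compat_eqI[OF c])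
    have "(- d1 m ?\<chi>, ind1 m p lam ?\<chi>) \<in> C2_star m p"
      using d1_star_in_C2_star[OF p half_scaling_derivation(1), where lam = lam] by (simp add: d1_star_def)
    then show "compat m p 0 (ind1 m p lam ?\<chi>)" by (simp add: C2_star_def half_scaling_derivation(2))
    show "\<omega>' (bas j) = ind1 m p lam ?\<chi> (bas j)" if j: "j \<in> {1..2*m+1}" for j
    proof -
      have "\<omega>' (bas j) = (lam j * a) *\<^sub>h ctr m" using top[OF bas_heis[OF j]] unfolding coord[OF j] .
      then show ?thesis
        unfolding ind1_bas[OF half_scaling_derivation(1) p(2) j] half_scaling_derivation(3) by simp
    qed
  qed (use p in simp)
  then have "(0, \<omega>') = d1_star m p lam ?\<chi>" by (simp add: d1_star_def half_scaling_derivation(2))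
  then have "(\<phi>, \<omega>) = d1_star m p lam ?\<chi> + cscal (- 1) (d1_star m p lam \<psi>)"
    using eq by (simp add: cscal_simps(5) eq_diff_eq)
  then show ?thesis using addB scB dB \<psi> half_scaling_derivation(1) by metis
qed

lemma restricted_cohomology_basis:
  fixes lam :: "nat \<Rightarrow> 'a::field"
  assumes m: "m > 1" and p: "CHAR('a) = p" "p > 2" and ex: "excluded m lam i"
  defines "S \<equiv> A_set_p m p \<union> {(0, ebar m p j (2*m+1)) | j. j \<in> {1..2*m+1} \<and> j \<noteq> i}"
  shows "inj_on (coh_class m p lam) S \<and>
    vectorspace.basis class_ring (H2_star m p lam) (coh_class m p lam ` S)"
proof -
  define J where "J = {j \<in> {1..2*m+1}. j \<noteq> i}"
  define x :: "(nat \<times> nat \<times> nat) + nat \<Rightarrow> 'a cochain2 \<times> 'a cochain1" where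
    "x = case_sum (\<lambda>q. (basis_cocycle m q, tilde m p (basis_cocycle m q))) (\<lambda>j. (0, ebar m p j (2*m+1)))"
  define f :: "(nat \<times> nat \<times> nat) + nat \<Rightarrow> 'a cochain2 \<times> 'a cochain1 \<Rightarrow> 'a" where
    "f = case_sum (\<lambda>q v. pivot m q (fst v)) (\<lambda>j v. frobenius_coord m lam i j (snd v))"
  have S: "x ` (Sum_Type.Plus (pivot_triples m) J) = S"
    unfolding S_def A_set_p_def A_set_eq Plus_def J_def x_def by (auto simp: image_Un image_image)
  have Z: "add (Z2_star m p lam) = (+)" "smult (Z2_star m p lam) = cscal"
    by (simp_all add: Z2_star_def)
  note basis = quotient_module_basis_dual[OF B2_star_subspace[OF p, of m lam], of "Sum_Type.Plus (pivot_triples m) J" x f]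
  have "inj_on (\<lambda>v. B2_star m p lam +>\<^bsub>Z2_star m p lam\<^esub> v) (x ` (Sum_Type.Plus (pivot_triples m) J)) \<and>
    vectorspace.basis class_ring (quotient_module (Z2_star m p lam) (B2_star m p lam))
      ((\<lambda>v. B2_star m p lam +>\<^bsub>Z2_star m p lam\<^esub> v) ` x ` (Sum_Type.Plus (pivot_triples m) J))"
  proof (intro conjI basis)
    show "finite (Sum_Type.Plus (pivot_triples m) J)" "finite (Sum_Type.Plus (pivot_triples m) J)" by (simp_all add: J_def finite_pivot_triples)
    show "x ` (Sum_Type.Plus (pivot_triples m) J) \<subseteq> carrier (Z2_star m p lam)" "x ` (Sum_Type.Plus (pivot_triples m) J) \<subseteq> carrier (Z2_star m p lam)"
      using lifted_normal_cocycle[OF basis_cocycle_normal p] ebar_cocycle[OF p] by (auto simp: x_def)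
    show "f k (v \<oplus>\<^bsub>Z2_star m p lam\<^esub> w) = f k v \<oplus>\<^bsub>class_ring\<^esub> f k w"
      "f k (v \<oplus>\<^bsub>Z2_star m p lam\<^esub> w) = f k v \<oplus>\<^bsub>class_ring\<^esub> f k w" for k v w
      by (cases k; simp add: f_def Z pivot_linear frobenius_coord_linear)+
    show "f k (a \<odot>\<^bsub>Z2_star m p lam\<^esub> v) = a \<otimes>\<^bsub>class_ring\<^esub> f k v"
      "f k (a \<odot>\<^bsub>Z2_star m p lam\<^esub> v) = a \<otimes>\<^bsub>class_ring\<^esub> f k v" for k a v
      by (cases k; cases v; simp add: f_def Z cscal_def pivot_linear frobenius_coord_linear)+
    have dual: "f k (x l) = (if k = l then \<one>\<^bsub>class_ring\<^esub> else \<zero>\<^bsub>class_ring\<^esub>)"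
      if "k \<in> Sum_Type.Plus (pivot_triples m) J" "l \<in> Sum_Type.Plus (pivot_triples m) J" for k l
    proof -
      have 1: "pivot m q (basis_cocycle m q') = (if q = q' then 1 else 0 :: 'a)" if "q \<in> pivot_triples m" "q' \<in> pivot_triples m" for q q'
        using that by (rule pivot_basis_cocycle)
      have 2: "frobenius_coord m lam i j (tilde m p (basis_cocycle m q)) = (0 :: 'a)" if "j \<in> J" "q \<in> pivot_triples m" for j q
        using frobenius_coord_tilde[OF basis_cocycle_normal[OF that(2)] p ex] that by (simp add: J_def)
      have 3: "frobenius_coord m lam i j (ebar m p j' (2*m+1)) = (if j = j' then 1 else 0 :: 'a)" if "j \<in> J" "j' \<in> J" for j j'
        using frobenius_coord_ebar[OF p(2) ex] that by (simp add: J_def)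
      show ?thesis
        using that 1 2 3 by (cases k; cases l) (auto simp: f_def x_def pivot_linear(4) split: if_splits)
    qed
    show "f k (x l) = (if k = l then \<one>\<^bsub>class_ring\<^esub> else \<zero>\<^bsub>class_ring\<^esub>)"
      "f k (x l) = (if k = l then \<one>\<^bsub>class_ring\<^esub> else \<zero>\<^bsub>class_ring\<^esub>)"
      if "k \<in> Sum_Type.Plus (pivot_triples m) J" "l \<in> Sum_Type.Plus (pivot_triples m) J" for k l
      using dual[OF that] by auto
    have van: "f k v = 0" if "k \<in> Sum_Type.Plus (pivot_triples m) J" "v \<in> B2_star m p lam" for k v
    proof -
      from that(2) obtain \<psi> where \<psi>: "\<psi> \<in> C1 m" "v = (- d1 m \<psi>, ind1 m p lam \<psi>)"
        by (auto simp: B2_star_def d1_star_def)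
      show ?thesis
        using that(1) pivot_d1[OF _ \<psi>(1)] frobenius_coord_ind1[OF \<psi>(1) p(2) ex]
        by (auto simp: f_def \<psi>(2) pivot_linear(3) J_def)
    qed
    show "f k v = \<zero>\<^bsub>class_ring\<^esub>" "f k v = \<zero>\<^bsub>class_ring\<^esub>" if "k \<in> Sum_Type.Plus (pivot_triples m) J" "v \<in> B2_star m p lam" for k v
      using van[OF that] by auto
    have sep: "v \<in> B2_star m p lam"
      if v: "v \<in> carrier (Z2_star m p lam)" and 0: "\<And>k. k \<in> Sum_Type.Plus (pivot_triples m) J \<Longrightarrow> f k v = 0" for v
    proof (cases v)
      case (Pair \<phi> \<omega>)
      show ?thesis unfolding Pair
      proof (rule vanishing_coordinates_imp_coboundary[OF m p ex])
        show "(\<phi>, \<omega>) \<in> carrier (Z2_star m p lam)" using v Pair by simp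
        show "pivot m q \<phi> = 0" if "q \<in> pivot_triples m" for q using 0[of "Inl q"] that Pair by (auto simp: f_def)
        show "frobenius_coord m lam i j \<omega> = 0" if "j \<in> {1..2*m+1}" "j \<noteq> i" for j
          using 0[of "Inr j"] that Pair by (auto simp: f_def J_def)
      qed
    qed
    show "v \<in> B2_star m p lam" "v \<in> B2_star m p lam"
      if "v \<in> carrier (Z2_star m p lam)" "\<And>k. k \<in> Sum_Type.Plus (pivot_triples m) J \<Longrightarrow> f k v = \<zero>\<^bsub>class_ring\<^esub>" for v
      using sep[OF that(1)] that(2) by auto
  qed auto
  then show ?thesis unfolding S H2_star_def coh_class_def by (simp add: fun_eq_iff[symmetric])
qed

theorem proposition3p6:
  fixes m p :: nat and lam :: "nat \<Rightarrow> 'a::alg_closed_field"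
  assumes "m > 1" and "CHAR('a) = p" and "p > 2"
  shows "((\<forall>i\<in>{1..2*m+1}. lam i = 0) \<longrightarrow>
      (let S = A_set_p m p \<union> {(0, ebar m p i (2*m+1)) | i. i \<in> {1..2*m+1}}
       in inj_on (coh_class m p lam) S \<and>
          vectorspace.basis class_ring (H2_star m p lam) (coh_class m p lam ` S))) \<and>
    (\<forall>i\<in>{1..2*m+1}. lam i \<noteq> 0 \<longrightarrow>
      (let S = A_set_p m p \<union> {(0, ebar m p j (2*m+1)) | j. j \<in> {1..2*m+1} \<and> j \<noteq> i}
       in inj_on (coh_class m p lam) S \<and>
          vectorspace.basis class_ring (H2_star m p lam) (coh_class m p lam ` S)))"
proof (intro conjI impI ballI)
  assume "\<forall>i\<in>{1..2*m+1}. lam i = 0"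
  \<comment> \<open>basis vectors are numbered from 1, so 0 excludes nothing\<close>
  then have ex: "excluded m lam 0" by (simp add: excluded_def)
  have "{(0, ebar m p j (2*m+1) :: 'a cochain1) | j. j \<in> {1..2*m+1} \<and> j \<noteq> 0} =
      {(0 :: 'a cochain2, ebar m p i (2*m+1)) | i. i \<in> {1..2*m+1}}" by auto
  then show "let S = A_set_p m p \<union> {(0, ebar m p i (2*m+1)) | i. i \<in> {1..2*m+1}}
       in inj_on (coh_class m p lam) S \<and>
          vectorspace.basis class_ring (H2_star m p lam) (coh_class m p lam ` S)"
    using restricted_cohomology_basis[OF assms ex] unfolding Let_def by simp
next
  fix i assume "i \<in> {1..2*m+1}" "lam i \<noteq> 0"
  then have "excluded m lam i" by (simp add: excluded_def)
  from restricted_cohomology_basis[OF assms this]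
  show "let S = A_set_p m p \<union> {(0, ebar m p j (2*m+1)) | j. j \<in> {1..2*m+1} \<and> j \<noteq> i}
       in inj_on (coh_class m p lam) S \<and>
          vectorspace.basis class_ring (H2_star m p lam) (coh_class m p lam ` S)"
    unfolding Let_def .
qed

end
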